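(* Let $n>1$ and let $\mathcal{C}_1$ be the tensor category of finite dimensional right comodules over the Hopf algebra $\Bbbk\mathcal{Z}(1)$ (that is, $\Bbbk\mathcal{Z}(q)$ with $q=1$). Then its Green ring satisfies $$\mathcal{GR}(\mathcal{C}_1)\cong\mathbb{Z}[x,y]/\langle x^n-1\rangle$$ as rings.
   Context: $\Bbbk$ is an algebraically closed field of characteristic $0$; $n>1$ is an integer; $\mathbb{Z}_n$ denotes the integers modulo $n$. For $q\in\Bbbk$ and integers $l,m\ge 0$ put $l_q=1+q+\cdots+q^{l-1}$, $l!_q=1_q\cdots l_q$, and let $\binom{l+m}{l}_q=\frac{(l+m)!_q}{l!_q\,m!_q}$ be the Gaussian binomial coefficient (a polynomial in $q$, evaluated at $q$). For $q\in\Bbbk$ with $q^n=1$, $\Bbbk\mathcal{Z}(q)$ is the Hopf algebra with $\Bbbk$-basis $\{p_i^l\mid i\in\mathbb{Z}_n,\ l\ge 0\}$ ($p_i^l$ is the path of length $l$ starting at vertex $i$ of the cyclic quiver with $n$ vertices), comultiplication $\Delta(p_i^l)=\sum_{j=0}^{l}p_{i+j}^{l-j}\otimes p_i^{j}$, counit $\varepsilon(p_i^l)=\delta_{l,0}$, multiplication $p_i^l\cdot p_j^m=q^{im}\binom{l+m}{l}_q\,p_{i+j}^{l+m}$, and unit $p_0^0$. $\mathcal{C}_q$ is the tensor category of finite dimensional right $\Bbbk\mathcal{Z}(q)$-comodules, where the comodule structure of $U\otimes V$ is $u\otimes v\mapsto u_0\otimes v_0\otimes u_1v_1$ (Sweedler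 notation). The Green ring $\mathcal{GR}(\mathcal{C})$ of a tensor category $\mathcal{C}$ is the abelian group generated by the isomorphism classes $[X]$ of objects of $\mathcal{C}$ modulo all split short exact sequences (i.e. $[X\oplus Y]=[X]+[Y]$), with multiplication $[X]\cdot[Y]=[X\otimes Y]$. *)

theory Defs
  imports
    "HOL-Computational_Algebra.Polynomial"
    "HOL-Algebra.Algebra"
    "HOL-Algebra.Free_Abelian_Groups"
    "HOL-Algebra.Algebraic_Closure_Type"
begin

section \<open>Vector spaces with a chosen basis\<close>

text \<open>
  The vector space with basis \<open>B\<close> consists of the finitely supported functions on \<open>B\<close>.
  A linear map out of it is given by its values on \<open>B\<close>, and the tensor product of the
  spaces with bases \<open>B\<close> and \<open>B'\<close> is the space with basis \<open>B \<times> B'\<close>.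
\<close>

definition free_space :: "'a set \<Rightarrow> ('a \<Rightarrow>\<^sub>0 'k::zero) set" where
  "free_space B = {v. Poly_Mapping.keys v \<subseteq> B}"

definition basis_vec :: "'a \<Rightarrow> ('a \<Rightarrow>\<^sub>0 'k::zero_neq_one)" where
  "basis_vec b = Poly_Mapping.single b 1"

definition scale_vec :: "'k::comm_semiring_1 \<Rightarrow> ('a \<Rightarrow>\<^sub>0 'k) \<Rightarrow> ('a \<Rightarrow>\<^sub>0 'k)" where
  "scale_vec c v = Poly_Mapping.map ((*) c) v"

definition lin_extend ::
  "('a \<Rightarrow> ('b \<Rightarrow>\<^sub>0 'k::comm_semiring_1)) \<Rightarrow> ('a \<Rightarrow>\<^sub>0 'k) \<Rightarrow> ('b \<Rightarrow>\<^sub>0 'k)" where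
  "lin_extend f v = (\<Sum>a\<in>Poly_Mapping.keys v. scale_vec (Poly_Mapping.lookup v a) (f a))"

definition tensor_vec ::
  "('a \<Rightarrow>\<^sub>0 'k::comm_semiring_1) \<Rightarrow> ('b \<Rightarrow>\<^sub>0 'k) \<Rightarrow> ('a \<times> 'b \<Rightarrow>\<^sub>0 'k)" where
  "tensor_vec v w = (\<Sum>a\<in>Poly_Mapping.keys v. \<Sum>b\<in>Poly_Mapping.keys w.
     Poly_Mapping.single (a, b) (Poly_Mapping.lookup v a * Poly_Mapping.lookup w b))"

text \<open>The tensor product of two linear maps, both given by their values on the basis:\<close>

definition tensor_map ::
  "('a \<Rightarrow> ('c \<Rightarrow>\<^sub>0 'k::comm_semiring_1)) \<Rightarrow> ('b \<Rightarrow> ('d \<Rightarrow>\<^sub>0 'k)) \<Rightarrow> 'a \<times> 'b \<Rightarrow> ('c \<times> 'd \<Rightarrow>\<^sub>0 'k)" where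
  "tensor_map f g = (\<lambda>(a, b). tensor_vec (f a) (g b))"

text \<open>The canonical isomorphism from \<open>(U \<otimes> V) \<otimes> W\<close> to \<open>U \<otimes> (V \<otimes> W)\<close>:\<close>

definition assoc_map :: "('a \<times> 'b) \<times> 'c \<Rightarrow> ('a \<times> 'b \<times> 'c \<Rightarrow>\<^sub>0 'k::comm_semiring_1)" where
  "assoc_map = (\<lambda>((a, b), c). basis_vec (a, b, c))"


section \<open>Gaussian binomial coefficients\<close>

definition q_int_poly :: "nat \<Rightarrow> 'k::field poly" where
  "q_int_poly l = (\<Sum>i<l. [:0, 1:] ^ i)"

definition q_fact_poly :: "nat \<Rightarrow> 'k::field poly" where
  "q_fact_poly l = (\<Prod>i=1..l. q_int_poly i)"

text \<open>
  The quotient is formed in the polynomial ring, where the division is exact, and is only then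
  evaluated; at a root of unity \<open>q\<close> the factorials themselves may vanish.
\<close>

definition q_binomial :: "nat \<Rightarrow> nat \<Rightarrow> 'k::field \<Rightarrow> 'k" where
  "q_binomial l m q = poly (q_fact_poly (l + m) div (q_fact_poly l * q_fact_poly m)) q"


section \<open>The Hopf algebra of the cyclic quiver\<close>

text \<open>
  The pair \<open>(i, l)\<close> with \<open>i < n\<close> stands for the path of length \<open>l\<close> starting at the
  vertex \<open>i\<close>, the integers modulo \<open>n\<close> being represented by \<open>{..<n}\<close>.
\<close>

type_synonym path = "nat \<times> nat"

definition paths :: "nat \<Rightarrow> path set" where
  "paths n = {..<n} \<times> UNIV"

definition path_comult :: "nat \<Rightarrow> path \<Rightarrow> (path \<times> path \<Rightarrow>\<^sub>0 'k::comm_semiring_1)" where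
  "path_comult n = (\<lambda>(i, l). \<Sum>j\<le>l. basis_vec (((i + j) mod n, l - j), (i, j)))"

definition path_counit :: "path \<Rightarrow> 'k::comm_semiring_1" where
  "path_counit = (\<lambda>(i, l). if l = 0 then 1 else 0)"

definition path_mult :: "nat \<Rightarrow> 'k::field \<Rightarrow> path \<times> path \<Rightarrow> (path \<Rightarrow>\<^sub>0 'k)" where
  "path_mult n q = (\<lambda>((i, l), (j, m)).
     scale_vec (q ^ (i * m) * q_binomial l m q) (basis_vec ((i + j) mod n, l + m)))"

definition path_unit :: "path \<Rightarrow>\<^sub>0 'k::comm_semiring_1" where
  "path_unit = basis_vec (0, 0)"


section \<open>Finite dimensional right comodules\<close>

record (overloaded) ('a, 'k) comodule =
  basis :: "'a set"
  coact :: "'a \<Rightarrow> ('a \<times> path \<Rightarrow>\<^sub>0 'k)"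

definition fd_comodule :: "nat \<Rightarrow> ('a, 'k::field) comodule \<Rightarrow> bool" where
  "fd_comodule n U \<longleftrightarrow> finite (basis U) \<and>
     (\<forall>b\<in>basis U. coact U b \<in> free_space (basis U \<times> paths n) \<and>
        lin_extend assoc_map (lin_extend (tensor_map (coact U) basis_vec) (coact U b)) =
          lin_extend (tensor_map basis_vec (path_comult n)) (coact U b) \<and>
        lin_extend (\<lambda>(a, p). scale_vec (path_counit p) (basis_vec a)) (coact U b) = basis_vec b)"

definition comodule_hom ::
  "('a, 'k::field) comodule \<Rightarrow> ('b, 'k) comodule \<Rightarrow> ('a \<Rightarrow> ('b \<Rightarrow>\<^sub>0 'k)) \<Rightarrow> bool" where
  "comodule_hom U V f \<longleftrightarrow>
     (\<forall>a\<in>basis U. f a \<in> free_space (basis V) \<and>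
        lin_extend (tensor_map f basis_vec) (coact U a) = lin_extend (coact V) (f a))"

definition comodule_iso :: "('a, 'k::field) comodule \<Rightarrow> ('b, 'k) comodule \<Rightarrow> bool" where
  "comodule_iso U V \<longleftrightarrow> (\<exists>f. comodule_hom U V f \<and>
     bij_betw (lin_extend f) (free_space (basis U)) (free_space (basis V)))"

definition direct_sum ::
  "('a, 'k::field) comodule \<Rightarrow> ('b, 'k) comodule \<Rightarrow> ('a + 'b, 'k) comodule" where
  "direct_sum U V = \<lparr>basis = Inl ` basis U \<union> Inr ` basis V,
     coact = case_sum
       (\<lambda>a. lin_extend (\<lambda>(a', p). basis_vec (Inl a', p)) (coact U a))
       (\<lambda>b. lin_extend (\<lambda>(b', p). basis_vec (Inr b', p)) (coact V b))\<rparr>"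

definition tensor_comodule ::
  "nat \<Rightarrow> 'k \<Rightarrow> ('a, 'k::field) comodule \<Rightarrow> ('b, 'k) comodule \<Rightarrow> ('a \<times> 'b, 'k) comodule" where
  "tensor_comodule n q U V = \<lparr>basis = basis U \<times> basis V,
     coact = (\<lambda>(a, b).
       lin_extend (\<lambda>((a', p), (b', r)). tensor_vec (basis_vec (a', b')) (path_mult n q (p, r)))
         (tensor_vec (coact U a) (coact V b)))\<rparr>"

definition unit_comodule :: "(unit, 'k::field) comodule" where
  "unit_comodule = \<lparr>basis = {()}, coact = (\<lambda>u. tensor_vec (basis_vec u) path_unit)\<rparr>"


section \<open>The Green ring\<close>

text \<open>
  Every finite dimensional comodule is isomorphic to one whose basis is a finite set of natural
  numbers, so that these comodules form a small model of the isomorphism classes. The class of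
  a comodule with another type of basis, such as a tensor product, is the set of its
  isomorphic copies among them.
\<close>

definition iso_class :: "nat \<Rightarrow> ('a, 'k::field) comodule \<Rightarrow> (nat, 'k) comodule set" where
  "iso_class n U = {V. fd_comodule n V \<and> comodule_iso U V}"

definition iso_classes :: "nat \<Rightarrow> (nat, 'k::field) comodule set set" where
  "iso_classes n = {iso_class n U | U :: (nat, 'k) comodule. fd_comodule n U}"

definition class_mult ::
  "nat \<Rightarrow> 'k \<Rightarrow> (nat, 'k::field) comodule set \<Rightarrow> (nat, 'k) comodule set \<Rightarrow> (nat, 'k) comodule set" where
  "class_mult n q A B = (\<Union>U\<in>A. \<Union>V\<in>B. iso_class n (tensor_comodule n q U V))"

text \<open>The free abelian group on the isomorphism classes, with the biadditive extension
  of the product of classes:\<close>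

definition class_ring :: "nat \<Rightarrow> 'k::field \<Rightarrow> ((nat, 'k) comodule set \<Rightarrow>\<^sub>0 int) ring" where
  "class_ring n q =
     \<lparr>carrier = carrier (free_Abelian_group (iso_classes n)),
      monoid.mult = (\<lambda>c d. frag_extend (\<lambda>A. frag_extend (\<lambda>B. frag_of (class_mult n q A B)) d) c),
      monoid.one = frag_of (iso_class n (unit_comodule :: (unit, 'k) comodule)),
      ring.zero = 0,
      ring.add = (+)\<rparr>"

definition split_relations :: "nat \<Rightarrow> ((nat, 'k::field) comodule set \<Rightarrow>\<^sub>0 int) set" where
  "split_relations n = generate (free_Abelian_group (iso_classes n))
     {frag_of (iso_class n (direct_sum U V)) - (frag_of (iso_class n U) + frag_of (iso_class n V))
      | (U :: (nat, 'k) comodule) (V :: (nat, 'k) comodule). fd_comodule n U \<and> fd_comodule n V}"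

definition green_ring :: "nat \<Rightarrow> 'k::field \<Rightarrow> ((nat, 'k) comodule set \<Rightarrow>\<^sub>0 int) set ring" where
  "green_ring n q = class_ring n q Quot split_relations n"

text \<open>
  The ring \<open>\<int>[x, y]\<close> is rendered as \<open>\<int>[x][y]\<close>: the inner indeterminate is \<open>x\<close>
  and the outer one is \<open>y\<close>.
\<close>

definition var_x :: "int poly poly" where
  "var_x = [:[:0, 1:]:]"

end

theory Submission
  imports Defs
begin

text \<open>
  A comodule is a nilpotent representation of the cyclic quiver: a space graded by the integers
  modulo \<open>n\<close> with a nilpotent operator \<open>T\<close> of degree one. At \<open>q = 1\<close> the tensor product carries
  the operator \<open>T \<otimes> 1 + 1 \<otimes> T\<close>. Every representation is a direct sum of strings
  \<open>V(i, l)\<close> (start \<open>i\<close>, length \<open>l\<close>), whose multiplicities are read off the dimensions of the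
  graded kernels of the powers of \<open>T\<close>. As in the representation theory of \<open>sl\<^sub>2\<close>, in characteristic 0
  \<open>V(1, 0) \<otimes> V(i, l) = V(i + 1, l)\<close> and \<open>V(0, 1) \<otimes> V(i, l) = V(i, l + 1) \<oplus> V(i + 1, l - 1)\<close>.
  Hence \<open>V(i, l) \<mapsto> x\<^sup>i P\<^sub>l\<close> with \<open>P\<^sub>l\<^sub>+\<^sub>1 = y P\<^sub>l - x P\<^sub>l\<^sub>-\<^sub>1\<close> is multiplicative modulo \<open>x\<^sup>n - 1\<close>.
  It is bijective because \<open>P\<^sub>l\<close> is monic of degree \<open>l\<close> in \<open>y\<close>.
\<close>

subsection \<open>Linear algebra on spaces with a basis\<close>

text \<open>Only two products are ever computed by hand, a point \<open>V(1, 0)\<close> and an arrow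
  \<open>V(0, 1)\<close> times a string. The product of two arbitrary strings is bypassed: the left
  factors on which the evaluation is multiplicative are closed under isomorphism, sums, tensor
  products and passage to a summand whose complement is such a factor, and the two small strings,
  with the unit, generate every string in this way. Characteristic 0 is used to divide by
  factorials, when Gaussian binomials are evaluated at 1, and by l + 1, when the arrow times a
  string of length l is split. No Krull-Schmidt argument occurs: multiplicities are defined for
  every comodule by dimensions of kernels, hence are invariant and additive, and independence of the
  polynomials separates the strings. The friction lies in the chosen bases: sums and products change
  the index type, and a subspace has to be given coordinates before it is a comodule.\<close>

abbreviation coeff_at :: "('a \<Rightarrow>\<^sub>0 'k::zero) \<Rightarrow> 'a \<Rightarrow> 'k" where
  "coeff_at \<equiv> Poly_Mapping.lookup"

lemma coeff_scale [simp]: "coeff_at (scale_vec c v) a = c * coeff_at v a"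
  by (simp add: scale_vec_def Poly_Mapping.map.rep_eq when_def)

lemma coeff_basis: "coeff_at (basis_vec b) a = (if a = b then 1 else 0)"
  by (simp add: basis_vec_def Poly_Mapping.lookup_single when_def)

lemma vec_eqI: "(\<And>a. coeff_at v a = coeff_at w a) \<Longrightarrow> v = w"
  by (rule poly_mapping_eqI)

global_interpretation vec: vector_space "scale_vec :: 'k::field \<Rightarrow> ('a \<Rightarrow>\<^sub>0 'k) \<Rightarrow> _"
  by unfold_locales (rule vec_eqI; simp add: Poly_Mapping.lookup_add algebra_simps)+

abbreviation lin :: "(('a \<Rightarrow>\<^sub>0 'k::field) \<Rightarrow> ('b \<Rightarrow>\<^sub>0 'k)) \<Rightarrow> bool" where
  "lin \<equiv> Vector_Spaces.linear scale_vec scale_vec"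

global_interpretation vecs: vector_space_pair
  "scale_vec :: 'k::field \<Rightarrow> ('a \<Rightarrow>\<^sub>0 'k) \<Rightarrow> _" "scale_vec :: 'k::field \<Rightarrow> ('b \<Rightarrow>\<^sub>0 'k) \<Rightarrow> _"
  by unfold_locales

lemma linI: "(\<And>v w. F (v + w) = F v + F w) \<Longrightarrow> (\<And>c v. F (scale_vec c v) = scale_vec c (F v)) \<Longrightarrow> lin F"
  by (rule Vector_Spaces.linear.intro [OF vec.vector_space_axioms vec.vector_space_axioms])
    (unfold_locales; simp)

lemma lin_add: "lin F \<Longrightarrow> F (v + w) = F v + F w"
  and lin_diff: "lin F \<Longrightarrow> F (v - w) = F v - F w"
  and lin_scale: "lin F \<Longrightarrow> F (scale_vec c v) = scale_vec c (F v)"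
  and lin_0: "lin F \<Longrightarrow> F 0 = 0"
  and lin_sum: "lin F \<Longrightarrow> F (sum f A) = (\<Sum>a\<in>A. F (f a))"
  by (simp_all add: vecs.linear_add vecs.linear_diff vecs.linear_scale vecs.linear_0 vecs.linear_sum)

text \<open>The collected rules carry an arbitrary inner linear map, so that a nested expression is
  peeled from the outside by \<open>intro\<close>.\<close>

named_theorems lin_intros

lemma lin_id [lin_intros]: "lin (\<lambda>v. v)"
  by (rule linI) auto

lemma lin_zero [lin_intros]: "lin (\<lambda>v. 0)"
  by (rule linI) auto

lemma lin_compose: "lin G \<Longrightarrow> lin F \<Longrightarrow> lin (\<lambda>v. G (F v))"
  by (rule linI) (simp_all add: lin_add lin_scale)

lemma lin_plus [lin_intros]: "lin F \<Longrightarrow> lin G \<Longrightarrow> lin (\<lambda>v. F v + G v)"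
  by (rule linI) (simp_all add: lin_add lin_scale algebra_simps vec.scale_right_distrib)

lemma lin_minus [lin_intros]: "lin F \<Longrightarrow> lin G \<Longrightarrow> lin (\<lambda>v. F v - G v)"
  by (rule linI) (simp_all add: lin_add lin_scale algebra_simps vec.scale_right_diff_distrib)

lemma lin_scaled [lin_intros]: "lin F \<Longrightarrow> lin (\<lambda>v. scale_vec c (F v))"
  by (rule linI) (simp_all add: lin_add lin_scale algebra_simps vec.scale_right_distrib mult.commute)

lemma lin_summed [lin_intros]: "(\<And>a. a \<in> A \<Longrightarrow> lin (F a)) \<Longrightarrow> lin (\<lambda>v. \<Sum>a\<in>A. F a v)"
  by (rule linI) (simp_all add: lin_add lin_scale sum.distrib vec.scale_sum_right)

lemma lin_funpow:
  fixes F :: "('a \<Rightarrow>\<^sub>0 'k::field) \<Rightarrow> ('a \<Rightarrow>\<^sub>0 'k)"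
  shows "lin F \<Longrightarrow> lin (F ^^ l)"
proof (induction l)
  case 0
  show ?case unfolding funpow.simps id_def by (rule lin_id)
next
  case (Suc l)
  then show ?case using lin_compose [OF Suc.prems] by (simp add: comp_def)
qed

lemma coeff_lin_extend:
  fixes f :: "'a \<Rightarrow> ('b \<Rightarrow>\<^sub>0 'k::field)"
  assumes "finite S" "Poly_Mapping.keys v \<subseteq> S"
  shows "lin_extend f v = (\<Sum>a\<in>S. scale_vec (coeff_at v a) (f a))"
  unfolding lin_extend_def
  by (rule sum.mono_neutral_left) (use assms in \<open>auto simp: Poly_Mapping.in_keys_iff\<close>)

lemma lin_lin_extend':
  fixes f :: "'a \<Rightarrow> ('b \<Rightarrow>\<^sub>0 'k::field)"
  shows "lin (lin_extend f)"
proof (rule linI)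
  fix v w :: "'a \<Rightarrow>\<^sub>0 'k"
  let ?S = "Poly_Mapping.keys v \<union> Poly_Mapping.keys w"
  have "Poly_Mapping.keys (v + w) \<subseteq> ?S" by (rule Poly_Mapping.keys_add)
  then show "lin_extend f (v + w) = lin_extend f v + lin_extend f w"
    by (simp add: coeff_lin_extend [of ?S] Poly_Mapping.lookup_add vec.scale_left_distrib sum.distrib)
next
  fix c and v :: "'a \<Rightarrow>\<^sub>0 'k"
  have "Poly_Mapping.keys (scale_vec c v) \<subseteq> Poly_Mapping.keys v"
    by (auto simp: Poly_Mapping.in_keys_iff)
  then show "lin_extend f (scale_vec c v) = scale_vec c (lin_extend f v)"
    by (simp add: coeff_lin_extend [of "Poly_Mapping.keys v"] vec.scale_sum_right)
qed

lemma lin_lin_extend [lin_intros]: "lin F \<Longrightarrow> lin (\<lambda>v. lin_extend f (F v))"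
  by (rule lin_compose [OF lin_lin_extend'])

lemma lin_extend_basis [simp]: "lin_extend f (basis_vec a) = (f a :: 'b \<Rightarrow>\<^sub>0 'k::field)"
  unfolding lin_extend_def basis_vec_def by simp

lemma vec_expand: "v = (\<Sum>a\<in>Poly_Mapping.keys v. scale_vec (coeff_at v a) (basis_vec a))"
  by (rule vec_eqI)
    (simp add: Poly_Mapping.lookup_sum coeff_basis if_distrib sum.delta cong: if_cong,
     simp add: Poly_Mapping.in_keys_iff)

lemma basis_in_free_space [simp]: "basis_vec b \<in> free_space B \<longleftrightarrow> b \<in> B"
  by (auto simp: free_space_def basis_vec_def)

lemma free_space_coeff: "v \<in> free_space B \<longleftrightarrow> (\<forall>a. a \<notin> B \<longrightarrow> coeff_at v a = 0)"
  by (auto simp: free_space_def Poly_Mapping.in_keys_iff)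

lemma subspace_free_space: "vec.subspace (free_space B)"
  by (auto simp: vec.subspace_def free_space_coeff Poly_Mapping.lookup_add)

lemmas free_space_0 [simp] = vec.subspace_0 [OF subspace_free_space]
lemmas free_space_add = vec.subspace_add [OF subspace_free_space]
lemmas free_space_diff = vec.subspace_diff [OF subspace_free_space]
lemmas free_space_scale = vec.subspace_scale [OF subspace_free_space]
lemmas free_space_sum = vec.subspace_sum [OF subspace_free_space]

lemma span_basis: "vec.span (basis_vec ` B) = (free_space B :: ('a \<Rightarrow>\<^sub>0 'k::field) set)"
proof
  show "vec.span (basis_vec ` B) \<subseteq> (free_space B :: ('a \<Rightarrow>\<^sub>0 'k::field) set)"
    by (rule vec.span_minimal [OF _ subspace_free_space]) auto
  show "(free_space B :: ('a \<Rightarrow>\<^sub>0 'k) set) \<subseteq> vec.span (basis_vec ` B)"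
  proof
    fix v :: "'a \<Rightarrow>\<^sub>0 'k" assume "v \<in> free_space B"
    then show "v \<in> vec.span (basis_vec ` B)"
      by (subst vec_expand) (auto intro!: vec.span_sum vec.span_scale intro: vec.span_base simp: free_space_def)
  qed
qed

lemma lin_in_subspace:
  assumes "lin F" "vec.subspace W" "v \<in> free_space B" "\<And>b. b \<in> B \<Longrightarrow> F (basis_vec b) \<in> W"
  shows "F v \<in> W"
  using assms by (subst vec_expand) (auto simp: lin_sum lin_scale free_space_def
    intro!: vec.subspace_sum vec.subspace_scale)

lemma lin_eqI:
  assumes "lin F" "lin G" "v \<in> free_space B" "\<And>b. b \<in> B \<Longrightarrow> F (basis_vec b) = G (basis_vec b)"
  shows "F v = G v"
proof -
  have "F v - G v \<in> {0}"
    by (rule lin_in_subspace [where F = "\<lambda>v. F v - G v", OF _ _ assms(3)])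
      (use assms in \<open>auto intro: lin_intros vec.subspace_single_0\<close>)
  then show ?thesis by simp
qed

lemma free_space_UNIV [simp]: "v \<in> free_space UNIV"
  by (simp add: free_space_def)

lemma lin_ext: "lin F \<Longrightarrow> lin G \<Longrightarrow> (\<And>b. F (basis_vec b) = G (basis_vec b)) \<Longrightarrow> F v = G v"
  by (rule lin_eqI [of F G v UNIV]) auto

text \<open>The definitions encode a linear map by its values on a basis, the proofs use the map
  itself; this rule connects the two forms.\<close>

lemma lin_extend_of_lin: "lin F \<Longrightarrow> lin_extend (\<lambda>b. F (basis_vec b)) = F"
  by (rule ext, rule lin_ext) (auto intro: lin_intros)

lemma inj_basis_vec: "inj (basis_vec :: 'a \<Rightarrow> ('a \<Rightarrow>\<^sub>0 'k::zero_neq_one))"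
proof (rule injI)
  fix a b :: 'a
  assume "(basis_vec a :: 'a \<Rightarrow>\<^sub>0 'k) = basis_vec b"
  from arg_cong [OF this, of "\<lambda>v. coeff_at v a"] show "a = b"
    by (simp add: coeff_basis split: if_splits)
qed

lemma independent_basis: "vec.independent (basis_vec ` B :: ('a \<Rightarrow>\<^sub>0 'k::field) set)"
  unfolding vec.independent_explicit_finite_subsets
proof (intro allI impI ballI)
  fix t :: "('a \<Rightarrow>\<^sub>0 'k) set" and c v
  assume t: "t \<subseteq> basis_vec ` B" "finite t" and s: "(\<Sum>v\<in>t. scale_vec (c v) v) = 0" and "v \<in> t"
  then obtain b where b: "v = basis_vec b" by auto
  have "coeff_at w b = (if w = v then 1 else 0)" if "w \<in> t" for w
    using that t b inj_eq [OF inj_basis_vec] by (auto simp: coeff_basis)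
  then have "(\<Sum>w\<in>t. coeff_at (scale_vec (c w) w) b) = (\<Sum>w\<in>t. if w = v then c w else 0)"
    by (intro sum.cong) auto
  also have "\<dots> = c v" using \<open>v \<in> t\<close> t by simp
  finally show "c v = 0"
    using arg_cong [OF s, of "\<lambda>v. coeff_at v b"] by (simp add: Poly_Mapping.lookup_sum)
qed

lemma dim_free_space: "vec.dim (free_space B :: ('a \<Rightarrow>\<^sub>0 'k::field) set) = card B"
proof -
  have "card (basis_vec ` B :: ('a \<Rightarrow>\<^sub>0 'k) set) = card B"
    using inj_on_subset [OF inj_basis_vec] by (intro card_image) auto
  moreover have "vec.dim (vec.span (basis_vec ` B :: ('a \<Rightarrow>\<^sub>0 'k) set)) = card (basis_vec ` B :: ('a \<Rightarrow>\<^sub>0 'k) set)"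
    by (rule vec.dim_span_eq_card_independent [OF independent_basis])
  ultimately show ?thesis by (simp add: span_basis)
qed

subsubsection \<open>Tensor products\<close>

lemma coeff_tensor [simp]:
  "coeff_at (tensor_vec v w) (a, b) = (coeff_at v a * coeff_at w b :: 'k::field)"
proof -
  have *: "coeff_at (Poly_Mapping.single (a', b') c) (a, b) = (if b' = b then if a' = a then c else 0 else 0)" for a' b' and c :: 'k
    by (auto simp: Poly_Mapping.lookup_single when_def)
  have "coeff_at (tensor_vec v w) (a, b) = (\<Sum>a'\<in>Poly_Mapping.keys v. if a' = a then coeff_at v a' * coeff_at w b else 0)"
    unfolding tensor_vec_def Poly_Mapping.lookup_sum *
    by (rule sum.cong) (auto simp: Poly_Mapping.in_keys_iff)
  also have "\<dots> = coeff_at v a * coeff_at w b"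
    by (simp add: Poly_Mapping.in_keys_iff)
  finally show ?thesis .
qed

lemma tensor_basis [simp]: "tensor_vec (basis_vec a) (basis_vec b) = (basis_vec (a, b) :: _ \<Rightarrow>\<^sub>0 'k::field)"
  by (rule vec_eqI) (auto simp: coeff_basis split: prod.splits if_splits)

lemma lin_tensor_left [lin_intros]: "lin F \<Longrightarrow> lin (\<lambda>v. tensor_vec (F v) w)"
  by (rule linI; rule vec_eqI)
    (auto simp: Poly_Mapping.lookup_add lin_add lin_scale algebra_simps)

lemma lin_tensor_right [lin_intros]: "lin F \<Longrightarrow> lin (\<lambda>v. tensor_vec w (F v))"
  by (rule linI; rule vec_eqI)
    (auto simp: Poly_Mapping.lookup_add lin_add lin_scale algebra_simps)

lemma tensor_in_free_space:
  fixes v :: "'a \<Rightarrow>\<^sub>0 'k::field"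
  shows "v \<in> free_space A \<Longrightarrow> w \<in> free_space B \<Longrightarrow> tensor_vec v w \<in> free_space (A \<times> B)"
  by (auto simp: free_space_coeff)

text \<open>Contraction of the second tensor factor with the dual basis vector at \<open>p\<close>.
  A tensor is determined by its slices, which turns identities between tensors into identities
  between vectors.\<close>

definition slice :: "'p \<Rightarrow> ('a \<times> 'p \<Rightarrow>\<^sub>0 'k::field) \<Rightarrow> ('a \<Rightarrow>\<^sub>0 'k)" where
  "slice p = lin_extend (\<lambda>(a, r). if r = p then basis_vec a else 0)"

lemma lin_slice [lin_intros]: "lin F \<Longrightarrow> lin (\<lambda>v. slice p (F v))"
  unfolding slice_def by (intro lin_intros)

lemma slice_tensor [simp]: "slice p (tensor_vec v w) = scale_vec (coeff_at w p) v"
proof -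
  have "slice p (tensor_vec v (basis_vec r)) = scale_vec (coeff_at (basis_vec r) p) v" for r
    by (rule lin_ext [of "\<lambda>v. slice p (tensor_vec v (basis_vec r))"])
      (intro lin_intros, intro lin_intros, simp add: slice_def coeff_basis)
  moreover have "lin (\<lambda>w. scale_vec (coeff_at w p) v)"
    by (rule linI) (simp_all add: Poly_Mapping.lookup_add vec.scale_left_distrib)
  moreover have "lin (\<lambda>w. slice p (tensor_vec v w))"
    by (intro lin_intros)
  ultimately show ?thesis
    by (rule_tac lin_ext [of "\<lambda>w. slice p (tensor_vec v w)"])
qed

lemma slice_basis: "slice p (basis_vec (a, r)) = (if r = p then basis_vec a else 0)"
  by (simp add: slice_def)

lemma coeff_slice: "coeff_at (slice p v) a = coeff_at v (a, p)"
proof -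
  have "slice p v = (\<Sum>b\<in>Poly_Mapping.keys v. scale_vec (coeff_at v b) (slice p (basis_vec b)))"
    by (subst vec_expand) (simp add: lin_sum [OF lin_slice [OF lin_id]] lin_scale [OF lin_slice [OF lin_id]])
  also have "coeff_at \<dots> a = (\<Sum>b\<in>Poly_Mapping.keys v. if b = (a, p) then coeff_at v b else 0)"
    unfolding Poly_Mapping.lookup_sum
    by (rule sum.cong) (auto simp: slice_basis coeff_basis split: prod.splits if_splits)
  also have "\<dots> = coeff_at v (a, p)"
    by (simp add: Poly_Mapping.in_keys_iff)
  finally show ?thesis .
qed

lemma slice_eqI:
  fixes v w :: "'a \<times> 'p \<Rightarrow>\<^sub>0 'k::field"
  assumes "\<And>p. slice p v = slice p w"
  shows "v = w"
proof (rule vec_eqI)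
  fix x :: "'a \<times> 'p"
  obtain a p where "x = (a, p)" by (cases x)
  then show "coeff_at v x = coeff_at w x"
    using arg_cong [OF assms [of p], of "\<lambda>v. coeff_at v a"] by (simp add: coeff_slice)
qed

lemma slice_in_free_space: "v \<in> free_space (B \<times> P) \<Longrightarrow> slice p v \<in> free_space B"
  by (auto simp: free_space_coeff coeff_slice)

subsection \<open>Comodules as representations of the cyclic quiver\<close>

text \<open>The action of the dual algebra: the coaction followed by contraction with the dual of
  the path \<open>p\<close>. Later arguments use these operators in place of the coaction.\<close>

definition act :: "('a, 'k::field) comodule \<Rightarrow> path \<Rightarrow> ('a \<Rightarrow>\<^sub>0 'k) \<Rightarrow> ('a \<Rightarrow>\<^sub>0 'k)" where
  "act U p v = slice p (lin_extend (coact U) v)"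

abbreviation vectors :: "('a, 'k::field) comodule \<Rightarrow> ('a \<Rightarrow>\<^sub>0 'k) set" where
  "vectors U \<equiv> free_space (basis U)"

lemma lin_act [lin_intros]: "lin F \<Longrightarrow> lin (\<lambda>v. act U p (F v))"
  unfolding act_def by (intro lin_intros)

lemma lin_act': "lin (act U p)"
  using lin_act [OF lin_id, of U p] by simp

lemma act_basis: "act U p (basis_vec b) = slice p (coact U b)"
  by (simp add: act_def)

lemma slice_tensor_map_left:
  fixes f :: "'a \<Rightarrow> ('b \<Rightarrow>\<^sub>0 'k::field)"
  shows "slice p (lin_extend (tensor_map f basis_vec) x) = lin_extend f (slice p x)"
proof (rule lin_ext [where v = x])
  fix b :: "'a \<times> 'c"
  show "slice p (lin_extend (tensor_map f basis_vec) (basis_vec b)) = lin_extend f (slice p (basis_vec b))"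
    by (cases b) (simp add: tensor_map_def slice_basis coeff_basis lin_0 [OF lin_lin_extend'])
qed (intro lin_intros)+

lemma slice_assoc:
  fixes y :: "('a \<times> 'p) \<times> 'p \<Rightarrow>\<^sub>0 'k::field"
  shows "slice (r, s) (lin_extend assoc_map y) = slice r (slice s y)"
proof (rule lin_ext [where v = y])
  fix b :: "('a \<times> 'p) \<times> 'p"
  obtain a p q where b: "b = ((a, p), q)" by (cases b) auto
  show "slice (r, s) (lin_extend assoc_map (basis_vec b)) = (slice r (slice s (basis_vec b)) :: 'a \<Rightarrow>\<^sub>0 'k)"
    by (simp add: b assoc_map_def slice_basis lin_0 [OF lin_slice [OF lin_id]])
qed (intro lin_intros)+

lemma coeff_path_comult:
  "coeff_at (path_comult n (i, l)) (r, s) =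
    (if fst r = (i + snd s) mod n \<and> fst s = i \<and> l = snd r + snd s then 1 else 0 :: 'k::field)"
proof -
  have "coeff_at (path_comult n (i, l)) (r, s) =
      (\<Sum>j\<le>l. if j = snd s then if fst r = (i + snd s) mod n \<and> fst s = i \<and> l = snd r + snd s then 1 else 0 else 0 :: 'k)"
    unfolding path_comult_def prod.case Poly_Mapping.lookup_sum
    by (rule sum.cong) (auto simp: coeff_basis prod_eq_iff)
  then show ?thesis by simp
qed

text \<open>Dual to concatenation of paths: \<open>s\<close> is the initial piece and
  \<open>r\<close> the final one, and a path has \<open>r \<otimes> s\<close> in its coproduct only
  if \<open>r\<close> starts at the vertex where \<open>s\<close> ends.\<close>

lemma slice_path_comult:
  "slice (r, s) (lin_extend (tensor_map basis_vec (path_comult n)) x) =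
    (if fst r = (fst s + snd s) mod n then slice (fst s, snd r + snd s) x else (0 :: 'a \<Rightarrow>\<^sub>0 'k::field))"
proof (rule lin_ext [where v = x])
  fix b :: "'a \<times> path"
  obtain a i l where b: "b = (a, i, l)" by (cases b) auto
  show "slice (r, s) (lin_extend (tensor_map basis_vec (path_comult n)) (basis_vec b)) =
    (if fst r = (fst s + snd s) mod n then slice (fst s, snd r + snd s) (basis_vec b) else (0 :: 'a \<Rightarrow>\<^sub>0 'k))"
    by (auto simp: b tensor_map_def slice_basis coeff_path_comult)
next
  show "lin (\<lambda>x. if fst r = (fst s + snd s) mod n then slice (fst s, snd r + snd s) x else (0 :: 'a \<Rightarrow>\<^sub>0 'k))"
    by (cases "fst r = (fst s + snd s) mod n") (simp_all add: lin_zero lin_slice [OF lin_id])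
qed (intro lin_intros)

lemma counit_slice:
  fixes x :: "'a \<times> path \<Rightarrow>\<^sub>0 'k::field"
  assumes "x \<in> free_space (B \<times> paths n)"
  shows "lin_extend (\<lambda>(a, p). scale_vec (path_counit p) (basis_vec a)) x = (\<Sum>i<n. slice (i, 0) x)"
proof (rule lin_eqI [OF _ _ assms])
  fix b :: "'a \<times> path"
  assume "b \<in> B \<times> paths n"
  then obtain a i l where b: "b = (a, i, l)" "i < n" by (auto simp: paths_def)
  have "(\<Sum>i<n. slice (i, 0) (basis_vec b)) = (\<Sum>j<n. if j = i then if l = 0 then basis_vec a else 0 else 0 :: 'a \<Rightarrow>\<^sub>0 'k)"
    by (rule sum.cong) (auto simp: b slice_basis)
  also have "\<dots> = (if l = 0 then basis_vec a else 0)"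
    using b(2) by simp
  finally show "lin_extend (\<lambda>(a, p). scale_vec (path_counit p) (basis_vec a)) (basis_vec b) =
      (\<Sum>i<n. slice (i, 0) (basis_vec b) :: 'a \<Rightarrow>\<^sub>0 'k)"
    by (simp add: b path_counit_def)
qed (intro lin_intros)+

lemma slice_pair_eqI:
  fixes x y :: "'a \<times> 'p \<times> 'p \<Rightarrow>\<^sub>0 'k::field"
  assumes "\<And>r s. slice (r, s) x = slice (r, s) y"
  shows "x = y"
proof (rule slice_eqI)
  fix p :: "'p \<times> 'p"
  show "slice p x = slice p y" using assms by (cases p) auto
qed

text \<open>Coassociativity, sliced at a pair of paths, says that the operators compose like paths;
  the counit axiom says that the operators of the trivial paths sum to the identity. This is the
  passage from comodules to graded spaces with operators.\<close>

lemma fd_comodule_iff: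
  "fd_comodule n U \<longleftrightarrow> finite (basis U) \<and> (\<forall>b\<in>basis U.
     coact U b \<in> free_space (basis U \<times> paths n) \<and>
     (\<forall>r s. act U r (act U s (basis_vec b)) =
       (if fst r = (fst s + snd s) mod n then act U (fst s, snd r + snd s) (basis_vec b) else 0)) \<and>
     (\<Sum>i<n. act U (i, 0) (basis_vec b)) = basis_vec b)"
proof -
  have "lin_extend assoc_map (lin_extend (tensor_map (coact U) basis_vec) (coact U b)) =
      lin_extend (tensor_map basis_vec (path_comult n)) (coact U b) \<longleftrightarrow>
    (\<forall>r s. act U r (act U s (basis_vec b)) =
       (if fst r = (fst s + snd s) mod n then act U (fst s, snd r + snd s) (basis_vec b) else 0))"
    (is "?l = ?r \<longleftrightarrow> _") for b
  proof -
    have "?l = ?r \<longleftrightarrow> (\<forall>r s. slice (r, s) ?l = slice (r, s) ?r)"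
      using slice_pair_eqI [of ?l ?r] by auto
    then show ?thesis
      by (simp add: slice_assoc slice_path_comult slice_tensor_map_left act_def)
  qed
  moreover have "coact U b \<in> free_space (basis U \<times> paths n) \<Longrightarrow>
    lin_extend (\<lambda>(a, p). scale_vec (path_counit p) (basis_vec a)) (coact U b) =
      (\<Sum>i<n. act U (i, 0) (basis_vec b))" for b
    by (simp add: counit_slice act_def)
  ultimately show ?thesis
    unfolding fd_comodule_def by auto
qed

lemma fd_finite: "fd_comodule n U \<Longrightarrow> finite (basis U)"
  by (simp add: fd_comodule_def)

lemma fd_coact: "fd_comodule n U \<Longrightarrow> b \<in> basis U \<Longrightarrow> coact U b \<in> free_space (basis U \<times> paths n)"
  by (simp add: fd_comodule_def)

lemma act_in:
  assumes "fd_comodule n U" "v \<in> vectors U"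
  shows "act U p v \<in> vectors U"
  by (rule lin_in_subspace [OF lin_act' subspace_free_space assms(2)])
    (use fd_coact [OF assms(1)] in \<open>auto simp: act_basis intro: slice_in_free_space\<close>)

lemma act_act:
  assumes "fd_comodule n U" "v \<in> vectors U"
  shows "act U (i, l) (act U (j, m) v) = (if i = (j + m) mod n then act U (j, l + m) v else 0)"
proof (rule lin_eqI [OF _ _ assms(2)])
  fix b assume "b \<in> basis U"
  then have "\<forall>r s. act U r (act U s (basis_vec b)) =
       (if fst r = (fst s + snd s) mod n then act U (fst s, snd r + snd s) (basis_vec b) else 0)"
    using assms(1) unfolding fd_comodule_iff by blast
  from this [rule_format, of "(i, l)" "(j, m)"]
  show "act U (i, l) (act U (j, m) (basis_vec b)) =
    (if i = (j + m) mod n then act U (j, l + m) (basis_vec b) else 0)"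
    by simp
next
  show "lin (\<lambda>v. if i = (j + m) mod n then act U (j, l + m) v else 0)"
    by (cases "i = (j + m) mod n") (simp_all add: lin_zero lin_act')
qed (intro lin_intros)

lemma act_decompose:
  assumes "fd_comodule n U" "v \<in> vectors U"
  shows "(\<Sum>i<n. act U (i, 0) v) = v"
  by (rule lin_eqI [OF _ _ assms(2)])
    (use assms(1) in \<open>simp_all add: fd_comodule_iff lin_summed lin_act' lin_id\<close>)

lemma act_outside:
  assumes "fd_comodule n U" "v \<in> vectors U" "\<not> i < n"
  shows "act U (i, l) v = 0"
proof (rule lin_eqI [OF _ _ assms(2)])
  fix b assume "b \<in> basis U"
  then have "coact U b \<in> free_space (basis U \<times> paths n)"
    by (rule fd_coact [OF assms(1)])
  then show "act U (i, l) (basis_vec b) = 0"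
    using assms(3) by (intro vec_eqI) (auto simp: act_basis coeff_slice free_space_coeff paths_def)
qed (intro lin_intros)+

text \<open>Nilpotency is hidden in the finite support of \<open>coact\<close>: finitely many basis
  vectors involve finitely many paths, so the lengths are bounded.\<close>

lemma act_nilpotent:
  assumes "fd_comodule n U"
  obtains N where "\<And>i l v. l \<ge> N \<Longrightarrow> v \<in> vectors U \<Longrightarrow> act U (i, l) v = 0"
proof -
  let ?S = "\<Union>b\<in>basis U. (snd \<circ> snd) ` Poly_Mapping.keys (coact U b)"
  have fin: "finite ?S" using fd_finite [OF assms] by auto
  then obtain N where N: "\<And>l. l \<in> ?S \<Longrightarrow> l < N"
    using iffD1 [OF finite_nat_set_iff_bounded fin] by blast
  have "act U (i, l) v = 0" if "l \<ge> N" "v \<in> vectors U" for i l v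
  proof (rule lin_eqI [OF _ _ that(2)])
    fix b assume b: "b \<in> basis U"
    have "coeff_at (coact U b) (a, i, l) = 0" for a
    proof (rule ccontr)
      assume "coeff_at (coact U b) (a, i, l) \<noteq> 0"
      then have "l \<in> ?S" using b by (force simp: Poly_Mapping.in_keys_iff)
      then show False using N that(1) by fastforce
    qed
    then show "act U (i, l) (basis_vec b) = 0"
      by (intro vec_eqI) (simp add: act_basis coeff_slice)
  qed (intro lin_intros)+
  then show ?thesis using that by blast
qed

section \<open>The operator of degree one and a criterion for comodules\<close>

definition shift :: "nat \<Rightarrow> ('a, 'k::field) comodule \<Rightarrow> ('a \<Rightarrow>\<^sub>0 'k) \<Rightarrow> ('a \<Rightarrow>\<^sub>0 'k)" where
  "shift n U v = (\<Sum>i<n. act U (i, 1) v)"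

lemma lin_shift [lin_intros]: "lin F \<Longrightarrow> lin (\<lambda>v. shift n U (F v))"
  unfolding shift_def by (intro lin_intros)

lemma lin_shift': "lin (shift n U)"
  using lin_shift [OF lin_id, of n U] by simp

lemma shift_in: "fd_comodule n U \<Longrightarrow> v \<in> vectors U \<Longrightarrow> shift n U v \<in> vectors U"
  unfolding shift_def by (intro free_space_sum act_in)

lemma shift_act:
  assumes "fd_comodule n U" "v \<in> vectors U"
  shows "shift n U (act U (i, l) v) = act U (i, Suc l) v"
proof (cases "n = 0")
  case True
  then show ?thesis using act_outside [OF assms] by (simp add: shift_def)
next
  case False
  then have "(i + l) mod n < n" by simp
  then show ?thesis
    by (simp add: shift_def act_act [OF assms] sum.delta)
qed

text \<open>Thus the projections \<open>act U (i, 0)\<close> and the single operator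
  \<open>shift n U\<close> carry the whole coaction.\<close>

lemma act_shift_power:
  assumes "fd_comodule n U" "v \<in> vectors U"
  shows "act U (i, l) v = (shift n U ^^ l) (act U (i, 0) v)"
  by (induction l) (simp_all add: shift_act [OF assms, symmetric])

lemma act_degree_shift:
  assumes "fd_comodule n U" "v \<in> vectors U" "i < n"
  shows "act U (Suc i mod n, 0) (shift n U v) = shift n U (act U (i, 0) v)"
proof -
  have "act U (Suc i mod n, 0) (shift n U v) = (\<Sum>j<n. if j = i then act U (i, 1) v else 0)"
    unfolding shift_def lin_sum [OF lin_act']
  proof (rule sum.cong)
    fix j assume "j \<in> {..<n}"
    then have j: "j < n" by simp
    have "Suc i mod n = Suc j mod n \<longleftrightarrow> i = j"
      using j assms(3) by (auto simp: mod_Suc split: if_splits)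
    then show "act U (Suc i mod n, 0) (act U (j, 1) v) = (if j = i then act U (i, 1) v else 0)"
      by (simp add: act_act [OF assms(1,2)])
  qed simp
  also have "\<dots> = shift n U (act U (i, 0) v)"
    using assms by (simp add: shift_act)
  finally show ?thesis .
qed

text \<open>Converse of the preceding description: orthogonal projections \<open>d i\<close> with
  sum 1 and an operator \<open>T\<close> of degree one yield the composition law of paths. It serves
  for tensor products, where a direct check of coassociativity would go through the compatibility of
  product and coproduct of paths.\<close>

lemma fd_comoduleI:
  fixes U :: "('a, 'k::field) comodule"
  assumes "finite (basis U)" "n > 0"
    and coact: "\<And>b. b \<in> basis U \<Longrightarrow> coact U b \<in> free_space (basis U \<times> paths n)"
    and T: "lin T" "\<And>v. v \<in> vectors U \<Longrightarrow> T v \<in> vectors U"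
    and d: "\<And>i. lin (d i)" "\<And>i v. v \<in> vectors U \<Longrightarrow> d i v \<in> vectors U"
    and act: "\<And>b i l. b \<in> basis U \<Longrightarrow> i < n \<Longrightarrow> act U (i, l) (basis_vec b) = (T ^^ l) (d i (basis_vec b))"
    and dd: "\<And>v i j. v \<in> vectors U \<Longrightarrow> i < n \<Longrightarrow> j < n \<Longrightarrow> d i (d j v) = (if i = j then d i v else 0)"
    and d_sum: "\<And>v. v \<in> vectors U \<Longrightarrow> (\<Sum>i<n. d i v) = v"
    and dT: "\<And>v i. v \<in> vectors U \<Longrightarrow> i < n \<Longrightarrow> d (Suc i mod n) (T v) = T (d i v)"
  shows "fd_comodule n U"
proof -
  have act0: "act U (i, l) v = 0" if "v \<in> vectors U" "\<not> i < n" for i l v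
  proof (rule lin_eqI [OF _ _ that(1)])
    fix b assume "b \<in> basis U"
    from coact [OF this] show "act U (i, l) (basis_vec b) = 0"
      using that(2) by (intro vec_eqI) (auto simp: act_basis coeff_slice free_space_coeff paths_def)
  qed (intro lin_intros)+
  have Tpow: "(T ^^ l) v \<in> vectors U" if "v \<in> vectors U" for l v
    by (induction l) (use that T(2) in auto)
  have actv: "act U (i, l) v = (T ^^ l) (d i v)" if "v \<in> vectors U" "i < n" for i l v
    by (rule lin_eqI [OF _ _ that(1)])
      (use that act in \<open>auto intro!: lin_act' lin_compose [OF lin_funpow] T d\<close>)
  have dTpow: "d ((i + l) mod n) ((T ^^ l) v) = (T ^^ l) (d i v)" if v: "v \<in> vectors U" and "i < n" for i l v
  proof (induction l)
    case (Suc l)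
    have "d ((i + Suc l) mod n) (T ((T ^^ l) v)) = T (d ((i + l) mod n) ((T ^^ l) v))"
      using dT [OF Tpow [OF v], of "(i + l) mod n" l] \<open>n > 0\<close> by (simp add: mod_Suc_eq)
    then show ?case using Suc by simp
  qed (use that in simp)
  have main: "act U (i, l) (act U (j, m) v) = (if i = (j + m) mod n then act U (j, l + m) v else 0)"
    if v: "v \<in> vectors U" for i j l m v
  proof (cases "i < n \<and> j < n")
    case True
    have Tl: "(T ^^ l) 0 = 0" for l by (rule lin_0 [OF lin_funpow [OF T(1)]])
    have "d i ((T ^^ m) (d j v)) = d i (d ((j + m) mod n) ((T ^^ m) v))"
      using dTpow v True by simp
    also have "\<dots> = (if i = (j + m) mod n then (T ^^ m) (d j v) else 0)"
      unfolding dd [OF Tpow [OF v] conjunct1 [OF True] mod_less_divisor [OF \<open>n > 0\<close>]]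
      using True dTpow [OF v, of j] by simp
    finally show ?thesis
      using True v d(2) Tpow by (simp add: actv Tl funpow_add)
  next
    \<comment> \<open>Both sides vanish here, because the coaction involves only paths that start at
      a vertex below \<open>n\<close>.\<close>
    case False
    then show ?thesis
    proof (cases "j < n")
      case True
      then have "\<not> i < n" using False by simp
      moreover have "act U (j, m) v \<in> vectors U" using True v d(2) Tpow by (simp add: actv)
      moreover have "i \<noteq> (j + m) mod n" using \<open>\<not> i < n\<close> \<open>n > 0\<close> by auto
      ultimately show ?thesis by (simp add: act0)
    next
      case False
      then show ?thesis using v by (simp add: act0 lin_0 [OF lin_act'])
    qed
  qed
  show ?thesis
    unfolding fd_comodule_iff
  proof (intro conjI ballI allI)
    fix b r s assume b: "b \<in> basis U"
    show "coact U b \<in> free_space (basis U \<times> paths n)" using coact b .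
    show "act U r (act U s (basis_vec b)) =
       (if fst r = (fst s + snd s) mod n then act U (fst s, snd r + snd s) (basis_vec b) else 0)"
      using main [of "basis_vec b" "fst r" "snd r" "fst s" "snd s"] b by simp
    show "(\<Sum>i<n. act U (i, 0) (basis_vec b)) = basis_vec b"
      using d_sum [of "basis_vec b"] b by (simp add: act)
  qed fact
qed

subsection \<open>Isomorphisms\<close>

lemma comodule_hom_iff:
  "comodule_hom U V f \<longleftrightarrow> (\<forall>a\<in>basis U. f a \<in> vectors V \<and>
     (\<forall>p. lin_extend f (act U p (basis_vec a)) = act V p (f a)))"
proof -
  have "lin_extend (tensor_map f basis_vec) (coact U a) = lin_extend (coact V) (f a) \<longleftrightarrow>
    (\<forall>p. lin_extend f (act U p (basis_vec a)) = act V p (f a))" (is "?l = ?r \<longleftrightarrow> _") for a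
  proof -
    have "?l = ?r \<longleftrightarrow> (\<forall>p. slice p ?l = slice p ?r)" using slice_eqI [of ?l ?r] by auto
    then show ?thesis by (simp add: slice_tensor_map_left act_def)
  qed
  then show ?thesis unfolding comodule_hom_def by simp
qed

text \<open>An isomorphism as a pair of linear maps on the ambient spaces, controlled only on the
  vectors of the comodules. Only \<open>F\<close> is asked to commute with the action; for
  \<open>G\<close> this follows (\<open>iso_maps_sym\<close>).\<close>

definition iso_maps :: "('a, 'k::field) comodule \<Rightarrow> ('b, 'k) comodule \<Rightarrow>
    (('a \<Rightarrow>\<^sub>0 'k) \<Rightarrow> ('b \<Rightarrow>\<^sub>0 'k)) \<Rightarrow> (('b \<Rightarrow>\<^sub>0 'k) \<Rightarrow> ('a \<Rightarrow>\<^sub>0 'k)) \<Rightarrow> bool" where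
  "iso_maps U V F G \<longleftrightarrow> lin F \<and> lin G \<and>
     (\<forall>v\<in>vectors U. F v \<in> vectors V \<and> G (F v) = v) \<and>
     (\<forall>w\<in>vectors V. G w \<in> vectors U \<and> F (G w) = w) \<and>
     (\<forall>v\<in>vectors U. \<forall>p. F (act U p v) = act V p (F v))"

lemma comodule_iso_iff: "comodule_iso U V \<longleftrightarrow> (\<exists>F G. iso_maps U V F G)"
proof
  assume "comodule_iso U V"
  then obtain f where f: "comodule_hom U V f" "bij_betw (lin_extend f) (vectors U) (vectors V)"
    unfolding comodule_iso_def by blast
  define F where "F = lin_extend f"
  \<comment> \<open>The set-theoretic inverse is meaningful only on the vectors of \<open>V\<close>;
    it is taken on basis vectors and extended linearly.\<close>
  define G where "G = lin_extend (\<lambda>b. inv_into (vectors U) F (basis_vec b))"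
  have lin: "lin F" "lin G" unfolding F_def G_def by (rule lin_lin_extend')+
  have F: "F v \<in> vectors V" if "v \<in> vectors U" for v
    using f(2) that unfolding F_def bij_betw_def by blast
  have surj: "F ` vectors U = vectors V" and inj: "inj_on F (vectors U)"
    using f(2) unfolding F_def bij_betw_def by auto
  have G: "G w \<in> vectors U" if "w \<in> vectors V" for w
    by (rule lin_in_subspace [OF lin(2) subspace_free_space that])
      (auto simp: G_def surj intro!: inv_into_into)
  have FG: "F (G w) = w" if "w \<in> vectors V" for w
    by (rule lin_eqI [OF lin_compose [OF lin] lin_id that])
      (auto simp: G_def surj intro!: f_inv_into_f)
  have GF: "G (F v) = v" if "v \<in> vectors U" for v
    using inj_onD [OF inj FG [OF F [OF that]] G [OF F [OF that]] that] .
  have "F (act U p v) = act V p (F v)" if "v \<in> vectors U" for v p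
    by (rule lin_eqI [OF lin_compose [OF lin(1) lin_act'] lin_compose [OF lin_act' lin(1)] that])
      (use f(1) in \<open>simp add: comodule_hom_iff F_def del: split_paired_All\<close>)
  then show "\<exists>F G. iso_maps U V F G"
    unfolding iso_maps_def using lin F G FG GF by blast
next
  assume "\<exists>F G. iso_maps U V F G"
  then obtain F G where FG: "iso_maps U V F G" by blast
  then have lin: "lin F" unfolding iso_maps_def by blast
  have "comodule_hom U V (\<lambda>a. F (basis_vec a))"
    using FG unfolding comodule_hom_iff iso_maps_def by (auto simp: lin_extend_of_lin [OF lin])
  moreover have "bij_betw F (vectors U) (vectors V)"
    by (rule bij_betw_byWitness [where f' = G]) (use FG in \<open>auto simp: iso_maps_def\<close>)
  ultimately show "comodule_iso U V"
    unfolding comodule_iso_def using lin_extend_of_lin [OF lin]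
    by (intro exI [of _ "\<lambda>a. F (basis_vec a)"]) simp
qed

lemma comodule_iso_refl: "comodule_iso U U"
  unfolding comodule_iso_iff
  by (intro exI [of _ "\<lambda>v. v"]) (auto simp: iso_maps_def intro: lin_id)

lemma iso_maps_sym:
  assumes U: "fd_comodule n U" and FG: "iso_maps U V F G"
  shows "iso_maps V U G F"
proof -
  have "G (act V p w) = act U p (G w)" if w: "w \<in> vectors V" for w p
  proof -
    have Gw: "G w \<in> vectors U" "F (G w) = w" using FG w by (auto simp: iso_maps_def)
    have "F (act U p (G w)) = act V p (F (G w))"
      using FG Gw(1) unfolding iso_maps_def by blast
    then have "G (act V p w) = G (F (act U p (G w)))" using Gw(2) by simp
    also have "\<dots> = act U p (G w)" using FG act_in [OF U Gw(1)] unfolding iso_maps_def by blast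
    finally show ?thesis .
  qed
  then show ?thesis using FG unfolding iso_maps_def by blast
qed

lemma comodule_iso_sym: "fd_comodule n U \<Longrightarrow> comodule_iso U V \<Longrightarrow> comodule_iso V U"
  unfolding comodule_iso_iff using iso_maps_sym by blast

lemma comodule_iso_trans:
  assumes "comodule_iso U V" "comodule_iso V W"
  shows "comodule_iso U W"
proof -
  obtain F G F' G' where *: "iso_maps U V F G" "iso_maps V W F' G'"
    using assms unfolding comodule_iso_iff by blast
  have "iso_maps U W (\<lambda>v. F' (F v)) (\<lambda>w. G (G' w))"
    using * unfolding iso_maps_def by (auto intro: lin_compose)
  then show ?thesis unfolding comodule_iso_iff by blast
qed

text \<open>Every path acts as a projection followed by a power of \<open>shift\<close>, so
  commuting with these two kinds of operators on basis vectors is enough.\<close>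

lemma act_commuteI_shift:
  assumes U: "fd_comodule n U" and V: "fd_comodule n V" and F: "lin F"
    and FV: "\<And>a. a \<in> basis U \<Longrightarrow> F (basis_vec a) \<in> vectors V"
    and d: "\<And>a i. a \<in> basis U \<Longrightarrow> i < n \<Longrightarrow> F (act U (i, 0) (basis_vec a)) = act V (i, 0) (F (basis_vec a))"
    and T: "\<And>a. a \<in> basis U \<Longrightarrow> F (shift n U (basis_vec a)) = shift n V (F (basis_vec a))"
    and v: "v \<in> vectors U"
  shows "F (act U p v) = act V p (F v)"
proof -
  obtain i l where p: "p = (i, l)" by (cases p)
  have FV': "F v \<in> vectors V" if "v \<in> vectors U" for v
    by (rule lin_in_subspace [OF F subspace_free_space that FV])
  have T': "F (shift n U v) = shift n V (F v)" if "v \<in> vectors U" for v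
    by (rule lin_eqI [OF lin_compose [OF F lin_shift'] lin_compose [OF lin_shift' F] that T])
  have d': "F (act U (i, 0) v) = act V (i, 0) (F v)" if "v \<in> vectors U" "i < n" for v
    by (rule lin_eqI [OF lin_compose [OF F lin_act'] lin_compose [OF lin_act' F] that(1) d]) (use that in auto)
  show ?thesis
  proof (cases "i < n")
    case True
    have "F (act U (i, l) v) = act V (i, l) (F v)"
    proof (induction l)
      case (Suc l)
      have "F (act U (i, Suc l) v) = F (shift n U (act U (i, l) v))"
        by (simp add: shift_act [OF U v])
      also have "\<dots> = shift n V (act V (i, l) (F v))"
        using T' [OF act_in [OF U v]] Suc by simp
      also have "\<dots> = act V (i, Suc l) (F v)"
        by (simp add: shift_act [OF V FV' [OF v]])
      finally show ?case .
    qed (simp add: d' v True)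
    then show ?thesis using p by simp
  next
    case False
    then show ?thesis
      using act_outside [OF U v] act_outside [OF V FV' [OF v]] lin_0 [OF F] by (simp add: p)
  qed
qed

lemma comodule_isoI:
  assumes U: "fd_comodule n U" and V: "fd_comodule n V" and F: "lin F" and G: "lin G"
    and FV: "\<And>a. a \<in> basis U \<Longrightarrow> F (basis_vec a) \<in> vectors V"
    and GU: "\<And>b. b \<in> basis V \<Longrightarrow> G (basis_vec b) \<in> vectors U"
    and GF: "\<And>a. a \<in> basis U \<Longrightarrow> G (F (basis_vec a)) = basis_vec a"
    and FG: "\<And>b. b \<in> basis V \<Longrightarrow> F (G (basis_vec b)) = basis_vec b"
    and d: "\<And>a i. a \<in> basis U \<Longrightarrow> i < n \<Longrightarrow> F (act U (i, 0) (basis_vec a)) = act V (i, 0) (F (basis_vec a))"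
    and T: "\<And>a. a \<in> basis U \<Longrightarrow> F (shift n U (basis_vec a)) = shift n V (F (basis_vec a))"
  shows "comodule_iso U V"
proof -
  have "F v \<in> vectors V \<and> G (F v) = v" if "v \<in> vectors U" for v
    using lin_in_subspace [OF F subspace_free_space that FV]
      lin_eqI [OF lin_compose [OF G F] lin_id that GF] by blast
  moreover have "G v \<in> vectors U \<and> F (G v) = v" if "v \<in> vectors V" for v
    using lin_in_subspace [OF G subspace_free_space that GU]
      lin_eqI [OF lin_compose [OF F G] lin_id that FG] by blast
  moreover have "F (act U p v) = act V p (F v)" if "v \<in> vectors U" for v p
    by (rule act_commuteI_shift [OF U V F FV d T that])
  ultimately show ?thesis
    unfolding comodule_iso_iff iso_maps_def using F G by blast
qed

text \<open>A stable subspace of \<open>U\<close> need not be spanned by basis vectors, so it is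
  presented by coordinates: \<open>e\<close> embeds the coordinate space and \<open>r\<close> reads
  coordinates off. The last hypothesis says that the image of \<open>e\<close> is stable. Used for
  copies on natural numbers and for complements.\<close>

lemma subcomodule_exists:
  fixes U :: "('a, 'k::field) comodule" and e :: "('b \<Rightarrow>\<^sub>0 'k) \<Rightarrow> ('a \<Rightarrow>\<^sub>0 'k)"
  assumes U: "fd_comodule n U" and "finite B" and lin: "lin e" "lin r"
    and e: "\<And>x. x \<in> free_space B \<Longrightarrow> e x \<in> vectors U \<and> r (e x) = x"
    and r: "\<And>v. v \<in> vectors U \<Longrightarrow> r v \<in> free_space B"
    and stable: "\<And>x p. x \<in> free_space B \<Longrightarrow> e (r (act U p (e x))) = act U p (e x)"
  obtains Y :: "('b, 'k) comodule" where "fd_comodule n Y" "basis Y = B"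
    "\<And>x p. x \<in> free_space B \<Longrightarrow> e (act Y p x) = act U p (e x)"
proof -
  define Y where "Y = \<lparr>basis = B, coact = \<lambda>b.
    lin_extend (tensor_map (\<lambda>a. r (basis_vec a)) basis_vec) (lin_extend (coact U) (e (basis_vec b)))\<rparr>"
  have B: "basis Y = B" by (simp add: Y_def)
  have coact: "coact Y b = lin_extend (tensor_map (\<lambda>a. r (basis_vec a)) basis_vec)
    (lin_extend (coact U) (e (basis_vec b)))" for b
    by (simp add: Y_def)
  have "act Y p (basis_vec b) = r (act U p (e (basis_vec b)))" for p b
    unfolding act_def lin_extend_basis coact slice_tensor_map_left lin_extend_of_lin [OF lin(2)] ..
  then have act: "act Y p x = r (act U p (e x))" for p x
    by (rule lin_ext [OF lin_act' lin_compose [OF lin(2) lin_compose [OF lin_act' lin(1)]]])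
  then have e_act: "e (act Y p x) = act U p (e x)" if "x \<in> free_space B" for x p
    using stable that by simp
  have in_B: "act Y p x \<in> free_space B" if "x \<in> free_space B" for p x
    using that by (simp add: act e r act_in [OF U])
  \<comment> \<open>Since \<open>e\<close> is injective on coordinates, the axioms for
    \<open>Y\<close> can be checked after applying \<open>e\<close>, where they are those of
    \<open>U\<close>.\<close>
  have inj: "x = y" if "e x = e y" "x \<in> free_space B" "y \<in> free_space B" for x y
  proof -
    have "x = r (e x)" using e [OF that(2)] by (simp only:)
    also have "\<dots> = r (e y)" by (simp only: that(1))
    also have "\<dots> = y" using e [OF that(3)] by (simp only:)
    finally show ?thesis .
  qed
  have "fd_comodule n Y"
    unfolding fd_comodule_iff B
  proof (intro conjI ballI allI)
    fix b assume b: "b \<in> B"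
    then have b': "basis_vec b \<in> free_space B" by simp
    have eb: "e (basis_vec b) \<in> vectors U" using e [OF b'] by blast
    show "coact Y b \<in> free_space (B \<times> paths n)"
      unfolding free_space_coeff
    proof (intro allI impI)
      fix x assume x: "x \<notin> B \<times> paths n"
      obtain a i l where ail: "x = (a, i, l)" by (cases x) auto
      have co: "coeff_at (coact Y b) x = coeff_at (act Y (i, l) (basis_vec b)) a"
        unfolding ail act_basis coeff_slice ..
      show "coeff_at (coact Y b) x = 0"
      proof (cases "i < n")
        case True
        then have "a \<notin> B" using x by (simp add: ail paths_def)
        then show ?thesis using in_B [OF b', of "(i, l)"] unfolding co free_space_coeff by blast
      next
        case False
        have "act Y (i, l) (basis_vec b) = 0"
          unfolding act act_outside [OF U eb False] by (rule lin_0 [OF lin(2)])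
        then show ?thesis unfolding co by simp
      qed
    qed
    show "act Y p (act Y q (basis_vec b)) =
       (if fst p = (fst q + snd q) mod n then act Y (fst q, snd p + snd q) (basis_vec b) else 0)" for p q
    proof (rule inj)
      show "e (act Y p (act Y q (basis_vec b))) =
        e (if fst p = (fst q + snd q) mod n then act Y (fst q, snd p + snd q) (basis_vec b) else 0)"
        using act_act [OF U eb, of "fst p" "snd p" "fst q" "snd q"]
        by (simp add: e_act [OF b'] e_act [OF in_B [OF b']] lin_0 [OF lin(1)])
    qed (simp_all add: in_B b)
    show "(\<Sum>i<n. act Y (i, 0) (basis_vec b)) = basis_vec b"
    proof (rule inj)
      show "e (\<Sum>i<n. act Y (i, 0) (basis_vec b)) = e (basis_vec b)"
        using act_decompose [OF U eb] by (simp add: e_act [OF b'] lin_sum [OF lin(1)])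
    qed (simp_all add: in_B b free_space_sum)
  qed fact
  from that [OF this B e_act] show ?thesis .
qed

text \<open>Isomorphism classes contain only comodules indexed by natural numbers; this makes the
  class of a direct sum or of a tensor product nonempty.\<close>

lemma nat_copy_exists:
  fixes U :: "('a, 'k::field) comodule"
  assumes U: "fd_comodule n U"
  obtains V :: "(nat, 'k) comodule" where "fd_comodule n V" "comodule_iso U V"
proof -
  obtain g where g: "bij_betw g (basis U) {..<card (basis U)}"
    using ex_bij_betw_finite_nat [OF fd_finite [OF U]] by (metis atLeast0LessThan)
  let ?h = "inv_into (basis U) g" and ?B = "{..<card (basis U)}"
  define r :: "('a \<Rightarrow>\<^sub>0 'k) \<Rightarrow> (nat \<Rightarrow>\<^sub>0 'k)" where "r = lin_extend (\<lambda>a. basis_vec (g a))"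
  define e :: "(nat \<Rightarrow>\<^sub>0 'k) \<Rightarrow> ('a \<Rightarrow>\<^sub>0 'k)" where "e = lin_extend (\<lambda>m. basis_vec (?h m))"
  have lin: "lin r" "lin e" unfolding r_def e_def by (rule lin_lin_extend')+
  have h: "?h m \<in> basis U" "g (?h m) = m" if "m \<in> ?B" for m
    using g that by (auto simp: bij_betw_def inv_into_into f_inv_into_f)
  have g': "g a \<in> ?B" "?h (g a) = a" if "a \<in> basis U" for a
    using g that by (auto simp: bij_betw_def inv_into_f_f)
  have 1: "e x \<in> vectors U \<and> r (e x) = x" if "x \<in> free_space ?B" for x
    using lin_in_subspace [OF lin(2) subspace_free_space that] lin_eqI [OF lin_compose [OF lin] lin_id that] h
    by (simp add: r_def e_def)
  have 2: "r v \<in> free_space ?B \<and> e (r v) = v" if "v \<in> vectors U" for v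
    using lin_in_subspace [OF lin(1) subspace_free_space that] lin_eqI [OF lin_compose [OF lin(2,1)] lin_id that] g'
    by (simp add: r_def e_def)
  obtain V where V: "fd_comodule n V" "basis V = ?B" "\<And>x p. x \<in> free_space ?B \<Longrightarrow> e (act V p x) = act U p (e x)"
    by (rule subcomodule_exists [OF U _ lin(2,1), of ?B]) (use 1 2 act_in [OF U] in auto)
  have "iso_maps V U e r"
    unfolding iso_maps_def using V 1 2 lin by auto
  then have "comodule_iso U V"
    using iso_maps_sym [OF V(1)] unfolding comodule_iso_iff by blast
  from that [OF V(1) this] show ?thesis .
qed

lemma iso_maps_lin: "iso_maps U V F G \<Longrightarrow> lin F" "iso_maps U V F G \<Longrightarrow> lin G"
  and iso_maps_in: "iso_maps U V F G \<Longrightarrow> v \<in> vectors U \<Longrightarrow> F v \<in> vectors V"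
    "iso_maps U V F G \<Longrightarrow> w \<in> vectors V \<Longrightarrow> G w \<in> vectors U"
  and iso_maps_inverse: "iso_maps U V F G \<Longrightarrow> v \<in> vectors U \<Longrightarrow> G (F v) = v"
    "iso_maps U V F G \<Longrightarrow> w \<in> vectors V \<Longrightarrow> F (G w) = w"
  and iso_maps_act: "iso_maps U V F G \<Longrightarrow> v \<in> vectors U \<Longrightarrow> F (act U p v) = act V p (F v)"
  by (simp_all add: iso_maps_def del: split_paired_All)

subsection \<open>Dimensions\<close>

lemma dim_injective_image:
  assumes F: "lin F" and S: "vec.subspace S" and inj: "inj_on F S"
  shows "vec.dim (F ` S) = vec.dim S"
proof -
  obtain A where A: "A \<subseteq> S" "vec.independent A" "S \<subseteq> vec.span A" "card A = vec.dim S"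
    by (rule vec.basis_exists)
  have "vec.span A = S" using A(1,3) S by (metis subset_antisym vec.span_minimal)
  then have "vec.independent (F ` A)" "F ` S = vec.span (F ` A)"
    using vecs.linear_independent_injective_image [OF F A(2)] vecs.linear_span_image [OF F, of A] inj by auto
  moreover have "card (F ` A) = card A"
    using card_image inj_on_subset [OF inj A(1)] by blast
  ultimately show ?thesis
    using A(4) by (metis vec.dim_span_eq_card_independent)
qed

lemma comodule_iso_card:
  assumes "comodule_iso U V"
  shows "card (basis U) = card (basis V)"
proof -
  obtain F G where FG: "iso_maps U V F G" using assms unfolding comodule_iso_iff by blast
  have "F ` vectors U = vectors V" "inj_on F (vectors U)"
    using FG unfolding iso_maps_def
    by (auto simp: image_iff intro!: inj_onI) metis+
  moreover have "lin F" using FG unfolding iso_maps_def by blast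
  ultimately show ?thesis
    using dim_injective_image [OF _ subspace_free_space, of F "basis U"] by (simp add: dim_free_space)
qed

lemma basis_of_subspace:
  assumes "finite B" "S \<subseteq> free_space B"
  obtains A where "A \<subseteq> S" "finite A" "vec.independent A" "S \<subseteq> vec.span A" "card A = vec.dim S"
proof -
  obtain A where A: "A \<subseteq> S" "vec.independent A" "S \<subseteq> vec.span A" "card A = vec.dim S"
    by (rule vec.basis_exists)
  have "A \<subseteq> vec.span (basis_vec ` B)" using A(1) assms(2) by (simp add: span_basis)
  then have "finite A" using vec.independent_span_bound [of "basis_vec ` B" A] assms(1) A(2) by auto
  then show ?thesis using that A by blast
qed

subsection \<open>Direct sums\<close>

definition inl_vec :: "('a \<Rightarrow>\<^sub>0 'k::field) \<Rightarrow> ('a + 'b \<Rightarrow>\<^sub>0 'k)" where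
  "inl_vec = lin_extend (\<lambda>a. basis_vec (Inl a))"

definition inr_vec :: "('b \<Rightarrow>\<^sub>0 'k::field) \<Rightarrow> ('a + 'b \<Rightarrow>\<^sub>0 'k)" where
  "inr_vec = lin_extend (\<lambda>b. basis_vec (Inr b))"

definition outl_vec :: "('a + 'b \<Rightarrow>\<^sub>0 'k::field) \<Rightarrow> ('a \<Rightarrow>\<^sub>0 'k)" where
  "outl_vec = lin_extend (case_sum basis_vec (\<lambda>_. 0))"

definition outr_vec :: "('a + 'b \<Rightarrow>\<^sub>0 'k::field) \<Rightarrow> ('b \<Rightarrow>\<^sub>0 'k)" where
  "outr_vec = lin_extend (case_sum (\<lambda>_. 0) basis_vec)"

lemma lin_inl [lin_intros]: "lin F \<Longrightarrow> lin (\<lambda>v. inl_vec (F v))"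
  unfolding inl_vec_def by (intro lin_intros)

lemma lin_inr [lin_intros]: "lin F \<Longrightarrow> lin (\<lambda>v. inr_vec (F v))"
  unfolding inr_vec_def by (intro lin_intros)

lemma lin_outl [lin_intros]: "lin F \<Longrightarrow> lin (\<lambda>v. outl_vec (F v))"
  unfolding outl_vec_def by (intro lin_intros)

lemma lin_outr [lin_intros]: "lin F \<Longrightarrow> lin (\<lambda>v. outr_vec (F v))"
  unfolding outr_vec_def by (intro lin_intros)

lemmas lin_in_out = lin_inl [OF lin_id] lin_inr [OF lin_id] lin_outl [OF lin_id] lin_outr [OF lin_id]

lemma inl_basis [simp]: "inl_vec (basis_vec a) = basis_vec (Inl a)"
  and inr_basis [simp]: "inr_vec (basis_vec b) = basis_vec (Inr b)"
  and outl_basis [simp]: "outl_vec (basis_vec (Inl a)) = basis_vec a" "outl_vec (basis_vec (Inr b)) = 0"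
  and outr_basis [simp]: "outr_vec (basis_vec (Inl a)) = 0" "outr_vec (basis_vec (Inr b)) = basis_vec b"
  by (simp_all add: inl_vec_def inr_vec_def outl_vec_def outr_vec_def)

lemma outl_inl [simp]: "outl_vec (inl_vec v) = v"
  by (rule lin_ext [of "\<lambda>v. outl_vec (inl_vec v)" "\<lambda>v. v"]) (intro lin_intros, intro lin_intros, simp)

lemma outl_inr [simp]: "outl_vec (inr_vec v) = 0"
  by (rule lin_ext [of "\<lambda>v. outl_vec (inr_vec v)" "\<lambda>v. 0"]) (intro lin_intros, intro lin_intros, simp)

lemma outr_inl [simp]: "outr_vec (inl_vec v) = 0"
  by (rule lin_ext [of "\<lambda>v. outr_vec (inl_vec v)" "\<lambda>v. 0"]) (intro lin_intros, intro lin_intros, simp)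

lemma outr_inr [simp]: "outr_vec (inr_vec v) = v"
  by (rule lin_ext [of "\<lambda>v. outr_vec (inr_vec v)" "\<lambda>v. v"]) (intro lin_intros, intro lin_intros, simp)

lemma inl_inr_split: "inl_vec (outl_vec v) + inr_vec (outr_vec v) = v"
proof (rule lin_ext [of "\<lambda>v. inl_vec (outl_vec v) + inr_vec (outr_vec v)" "\<lambda>v. v"])
  fix b :: "'a + 'b"
  show "inl_vec (outl_vec (basis_vec b)) + inr_vec (outr_vec (basis_vec b)) = (basis_vec b :: _ \<Rightarrow>\<^sub>0 'c)"
    by (cases b) (simp_all add: lin_0 [OF lin_in_out(1)] lin_0 [OF lin_in_out(2)])
qed (intro lin_intros)+

lemma basis_direct_sum: "basis (direct_sum U V) = Inl ` basis U \<union> Inr ` basis V"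
  by (simp add: direct_sum_def)

lemma inl_in: "v \<in> vectors U \<Longrightarrow> inl_vec v \<in> vectors (direct_sum U V)"
  by (rule lin_in_subspace [OF lin_in_out(1) subspace_free_space]) (auto simp: basis_direct_sum)

lemma inr_in: "v \<in> vectors V \<Longrightarrow> inr_vec v \<in> vectors (direct_sum U V)"
  by (rule lin_in_subspace [OF lin_in_out(2) subspace_free_space]) (auto simp: basis_direct_sum)

lemma outl_in: "v \<in> vectors (direct_sum U V) \<Longrightarrow> outl_vec v \<in> vectors U"
  by (rule lin_in_subspace [OF lin_in_out(3) subspace_free_space]) (auto simp: basis_direct_sum)

lemma outr_in: "v \<in> vectors (direct_sum U V) \<Longrightarrow> outr_vec v \<in> vectors V"
  by (rule lin_in_subspace [OF lin_in_out(4) subspace_free_space]) (auto simp: basis_direct_sum)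

lemma act_inl:
  fixes U :: "('a, 'k::field) comodule" and V :: "('b, 'k) comodule"
  shows "act (direct_sum U V) p (inl_vec v) = inl_vec (act U p v)"
proof (rule lin_ext [where v = v])
  fix a
  have "slice p (lin_extend (\<lambda>(a', p). basis_vec (Inl a', p)) y) = (inl_vec (slice p y) :: 'a + 'b \<Rightarrow>\<^sub>0 'k)" for y
  proof (rule lin_ext [where v = y])
    fix b :: "'a \<times> path"
    show "slice p (lin_extend (\<lambda>(a', p). basis_vec (Inl a', p)) (basis_vec b)) =
      (inl_vec (slice p (basis_vec b)) :: 'a + 'b \<Rightarrow>\<^sub>0 'k)"
      by (cases b) (simp add: slice_basis lin_0 [OF lin_in_out(1)])
  qed (intro lin_intros)+
  then show "act (direct_sum U V) p (inl_vec (basis_vec a)) = inl_vec (act U p (basis_vec a))"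
    by (simp add: act_basis) (simp add: direct_sum_def)
qed (intro lin_intros)+

lemma act_inr:
  fixes U :: "('a, 'k::field) comodule" and V :: "('b, 'k) comodule"
  shows "act (direct_sum U V) p (inr_vec v) = inr_vec (act V p v)"
proof (rule lin_ext [where v = v])
  fix a
  have "slice p (lin_extend (\<lambda>(a', p). basis_vec (Inr a', p)) y) = (inr_vec (slice p y) :: 'a + 'b \<Rightarrow>\<^sub>0 'k)" for y
  proof (rule lin_ext [where v = y])
    fix b :: "'b \<times> path"
    show "slice p (lin_extend (\<lambda>(a', p). basis_vec (Inr a', p)) (basis_vec b)) =
      (inr_vec (slice p (basis_vec b)) :: 'a + 'b \<Rightarrow>\<^sub>0 'k)"
      by (cases b) (simp add: slice_basis lin_0 [OF lin_in_out(2)])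
  qed (intro lin_intros)+
  then show "act (direct_sum U V) p (inr_vec (basis_vec a)) = inr_vec (act V p (basis_vec a))"
    by (simp add: act_basis) (simp add: direct_sum_def)
qed (intro lin_intros)+

lemma fd_direct_sum:
  fixes U :: "('a, 'k::field) comodule" and V :: "('b, 'k) comodule"
  assumes U: "fd_comodule n U" and V: "fd_comodule n V"
  shows "fd_comodule n (direct_sum U V)" (is "fd_comodule n ?W")
  unfolding fd_comodule_iff
proof (intro conjI ballI allI)
  show "finite (basis ?W)" using fd_finite [OF U] fd_finite [OF V] by (auto simp: basis_direct_sum)
  fix b assume "b \<in> basis ?W"
  then consider a where "b = Inl a" "a \<in> basis U" | a where "b = Inr a" "a \<in> basis V"
    by (auto simp: basis_direct_sum)
  then have "coact ?W b \<in> free_space (basis ?W \<times> paths n) \<and>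
    (\<forall>r s. act ?W r (act ?W s (basis_vec b)) =
       (if fst r = (fst s + snd s) mod n then act ?W (fst s, snd r + snd s) (basis_vec b) else 0)) \<and>
    (\<Sum>i<n. act ?W (i, 0) (basis_vec b)) = basis_vec b"
  proof cases
    case 1
    have v: "basis_vec a \<in> vectors U" using 1 by simp
    have "lin_extend (\<lambda>(a', p). basis_vec (Inl a', p)) (coact U a) \<in> free_space (basis ?W \<times> paths n)"
      by (rule lin_in_subspace [OF lin_lin_extend' subspace_free_space fd_coact [OF U 1(2)]])
        (auto simp: basis_direct_sum)
    moreover have "act ?W r (act ?W s (inl_vec (basis_vec a))) =
       (if fst r = (fst s + snd s) mod n then act ?W (fst s, snd r + snd s) (inl_vec (basis_vec a)) else 0)" for r s
      using act_act [OF U v, of "fst r" "snd r" "fst s" "snd s"] by (simp add: act_inl lin_0 [OF lin_in_out(1)] del: inl_basis)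
    moreover have "(\<Sum>i<n. act ?W (i, 0) (inl_vec (basis_vec a))) = inl_vec (basis_vec a)"
      using act_decompose [OF U v] by (simp add: act_inl flip: lin_sum [OF lin_in_out(1)] del: inl_basis)
    ultimately show ?thesis using 1 by (simp add: direct_sum_def)
  next
    case 2
    have v: "basis_vec a \<in> vectors V" using 2 by simp
    have "lin_extend (\<lambda>(a', p). basis_vec (Inr a', p)) (coact V a) \<in> free_space (basis ?W \<times> paths n)"
      by (rule lin_in_subspace [OF lin_lin_extend' subspace_free_space fd_coact [OF V 2(2)]])
        (auto simp: basis_direct_sum)
    moreover have "act ?W r (act ?W s (inr_vec (basis_vec a))) =
       (if fst r = (fst s + snd s) mod n then act ?W (fst s, snd r + snd s) (inr_vec (basis_vec a)) else 0)" for r s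
      using act_act [OF V v, of "fst r" "snd r" "fst s" "snd s"] by (simp add: act_inr lin_0 [OF lin_in_out(2)] del: inr_basis)
    moreover have "(\<Sum>i<n. act ?W (i, 0) (inr_vec (basis_vec a))) = inr_vec (basis_vec a)"
      using act_decompose [OF V v] by (simp add: act_inr flip: lin_sum [OF lin_in_out(2)] del: inr_basis)
    ultimately show ?thesis using 2 by (simp add: direct_sum_def)
  qed
  then show "coact ?W b \<in> free_space (basis ?W \<times> paths n)"
    and "act ?W r (act ?W s (basis_vec b)) =
       (if fst r = (fst s + snd s) mod n then act ?W (fst s, snd r + snd s) (basis_vec b) else 0)"
    and "(\<Sum>i<n. act ?W (i, 0) (basis_vec b)) = basis_vec b" for r s
    by blast+
qed

text \<open>The images of a basis of \<open>S\<close> and of a basis of \<open>T\<close> are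
  disjoint and together form a basis of the sum.\<close>

lemma dim_inl_inr:
  fixes S :: "('a \<Rightarrow>\<^sub>0 'k::field) set" and T :: "('b \<Rightarrow>\<^sub>0 'k) set"
  assumes "finite B" "S \<subseteq> free_space B" "finite C" "T \<subseteq> free_space C"
    and ST: "vec.subspace S" "vec.subspace T"
  shows "vec.dim {inl_vec u + inr_vec v | u v. u \<in> S \<and> v \<in> T} = vec.dim S + vec.dim T"
proof -
  obtain A where A: "A \<subseteq> S" "finite A" "vec.independent A" "S \<subseteq> vec.span A" "card A = vec.dim S"
    by (rule basis_of_subspace [OF assms(1,2)])
  obtain A' where A': "A' \<subseteq> T" "finite A'" "vec.independent A'" "T \<subseteq> vec.span A'" "card A' = vec.dim T"
    by (rule basis_of_subspace [OF assms(3,4)])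
  let ?l = "inl_vec :: _ \<Rightarrow> ('a + 'b \<Rightarrow>\<^sub>0 'k)" and ?r = "inr_vec :: _ \<Rightarrow> ('a + 'b \<Rightarrow>\<^sub>0 'k)"
  have inj_l: "inj_on ?l D" for D by (rule inj_on_inverseI [where g = outl_vec]) simp
  have inj_r: "inj_on ?r D" for D by (rule inj_on_inverseI [where g = outr_vec]) simp
  \<comment> \<open>The vectors of the right summand are added one at a time:
    \<open>outr_vec\<close> kills the left part, so it carries a dependency of a new vector to one
    inside \<open>D\<close>.\<close>
  have ind: "vec.independent (?l ` A \<union> ?r ` D)" if "finite D" "vec.independent D" for D
    using that
  proof (induction D rule: finite_induct)
    case empty
    have "vec.independent (?l ` A)"
      by (rule vecs.linear_independent_injective_image [OF lin_in_out(1) A(3)]) (rule inj_l)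
    then show ?case unfolding image_empty Un_empty_right .
  next
    case (insert d D)
    have D: "vec.independent D" "d \<notin> vec.span D"
      using insert.prems insert.hyps(2) by (simp_all add: vec.independent_insert)
    have "?r d \<notin> vec.span (?l ` A \<union> ?r ` D)"
    proof
      assume "?r d \<in> vec.span (?l ` A \<union> ?r ` D)"
      then have "outr_vec (?r d) \<in> outr_vec ` vec.span (?l ` A \<union> ?r ` D)" by (rule imageI)
      also have "\<dots> = vec.span (outr_vec ` (?l ` A \<union> ?r ` D))"
        by (rule vecs.linear_span_image [OF lin_in_out(4), symmetric])
      also have "\<dots> \<subseteq> vec.span (insert 0 D)"
        by (rule vec.span_mono) auto
      finally show False using D(2) by simp
    qed
    then have "vec.independent (insert (?r d) (?l ` A \<union> ?r ` D))"
      using insert.IH [OF D(1)] by (rule vec.independent_insertI)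
    then show ?case by simp
  qed
  have disj: "?l ` A \<inter> ?r ` A' = {}"
  proof -
    have "a = 0" if "?l a = ?r b" for a b
      using arg_cong [OF that, of outl_vec] by simp
    then show ?thesis using vec.dependent_zero [of A] A(3) by auto
  qed
  have c: "card (?l ` A \<union> ?r ` A') = vec.dim S + vec.dim T"
    using A A' card_Un_disjoint [OF _ _ disj] by (simp add: card_image [OF inj_l] card_image [OF inj_r])
  let ?Z = "{?l u + ?r v | u v. u \<in> S \<and> v \<in> T}"
  have span: "?Z \<subseteq> vec.span (?l ` A \<union> ?r ` A')"
  proof safe
    fix u v assume "u \<in> S" "v \<in> T"
    then have "?l u \<in> ?l ` vec.span A" "?r v \<in> ?r ` vec.span A'" using A(4) A'(4) by blast+
    then have "?l u \<in> vec.span (?l ` A)" "?r v \<in> vec.span (?r ` A')"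
      by (simp_all only: vecs.linear_span_image [OF lin_in_out(1)] vecs.linear_span_image [OF lin_in_out(2)])
    then show "?l u + ?r v \<in> vec.span (?l ` A \<union> ?r ` A')"
      using vec.span_mono [of "?l ` A" "?l ` A \<union> ?r ` A'"] vec.span_mono [of "?r ` A'" "?l ` A \<union> ?r ` A'"]
      by (intro vec.span_add) blast+
  qed
  have "?l ` A \<union> ?r ` A' \<subseteq> ?Z"
  proof -
    have "?l u = ?l u + ?r 0" "?r v = ?l 0 + ?r v" for u v
      by (simp_all add: lin_0 [OF lin_in_out(1)] lin_0 [OF lin_in_out(2)])
    then have "?l u \<in> ?Z" "?r v \<in> ?Z" if "u \<in> S" "v \<in> T" for u v
      using that vec.subspace_0 [OF ST(1)] vec.subspace_0 [OF ST(2)] by blast+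
    then show ?thesis using A(1) A'(1) vec.subspace_0 [OF ST(1)] vec.subspace_0 [OF ST(2)] by blast
  qed
  then show "vec.dim ?Z = vec.dim S + vec.dim T"
    using vec.dim_unique [OF _ span ind [OF A'(2,3)] c] by blast
qed

text \<open>Linear forms are handled as maps into the multiples of a fixed vector \<open>x\<close>,
  since \<open>lin\<close> speaks of maps between spaces of finitely supported functions.\<close>

lemma lin_coeff [lin_intros]: "lin F \<Longrightarrow> lin (\<lambda>v. scale_vec (coeff_at (F v) u) x)"
  by (rule linI) (simp_all add: lin_add lin_scale Poly_Mapping.lookup_add vec.scale_left_distrib)

text \<open>The comodule map \<open>r\<close> is a retraction of the comodule map \<open>s\<close>,
  so \<open>U\<close> is the sum of the image of \<open>s\<close> and the kernel of
  \<open>r\<close>. The kernel, with coordinates from one of its bases, becomes the complement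
  \<open>Y\<close>.\<close>

lemma split_off:
  fixes U :: "('a, 'k::field) comodule" and V :: "('b, 'k) comodule"
  assumes U: "fd_comodule n U" and V: "fd_comodule n V" and lin: "lin s" "lin r"
    and s_in: "\<And>v. v \<in> vectors V \<Longrightarrow> s v \<in> vectors U"
    and r_in: "\<And>u. u \<in> vectors U \<Longrightarrow> r u \<in> vectors V"
    and rs: "\<And>v. v \<in> vectors V \<Longrightarrow> r (s v) = v"
    and s_act: "\<And>v p. v \<in> vectors V \<Longrightarrow> s (act V p v) = act U p (s v)"
    and r_act: "\<And>u p. u \<in> vectors U \<Longrightarrow> r (act U p u) = act V p (r u)"
  obtains Y :: "(nat, 'k) comodule" where "fd_comodule n Y" "comodule_iso U (direct_sum V Y)"
proof -
  define C where "C = {u \<in> vectors U. r u = 0}"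
  have C_sub: "vec.subspace C"
    unfolding C_def vec.subspace_def
    by (auto simp: lin_add [OF lin(2)] lin_scale [OF lin(2)] lin_0 [OF lin(2)] free_space_add free_space_scale)
  have CU: "C \<subseteq> vectors U" by (auto simp: C_def)
  obtain A where A: "A \<subseteq> C" "finite A" "vec.independent A" "C \<subseteq> vec.span A"
    by (rule basis_of_subspace [OF fd_finite [OF U] CU])
  obtain h where h: "bij_betw h {..<card A} A"
    using ex_bij_betw_nat_finite [OF A(2)] by (metis atLeast0LessThan)
  let ?B = "{..<card A}"
  define e :: "(nat \<Rightarrow>\<^sub>0 'k) \<Rightarrow> ('a \<Rightarrow>\<^sub>0 'k)" where "e = lin_extend h"
  obtain g :: "('a \<Rightarrow>\<^sub>0 'k) \<Rightarrow> (nat \<Rightarrow>\<^sub>0 'k)" where g: "lin g" "\<forall>x\<in>A. g x = basis_vec (inv_into ?B h x)"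
    using vecs.linear_independent_extend [OF A(3), of "\<lambda>x. basis_vec (inv_into ?B h x)"] by blast
  \<comment> \<open>The extension \<open>g\<close> gives coordinates on the kernel \<open>C\<close>
    and is uncontrolled elsewhere, hence the projection \<open>u - s (r u)\<close> onto
    \<open>C\<close> comes first.\<close>
  define q where "q u = g (u - s (r u))" for u
  have le: "lin e" unfolding e_def by (rule lin_lin_extend')
  have lq: "lin q" unfolding q_def
    by (intro lin_compose [OF g(1)] lin_minus lin_id lin_compose [OF lin(1)] lin(2))
  have hA: "h j \<in> A" "g (h j) = basis_vec j" if "j \<in> ?B" for j
  proof -
    show "h j \<in> A" using bij_betwE [OF h] that by blast
    then have "g (h j) = basis_vec (inv_into ?B h (h j))" using g(2) by blast
    then show "g (h j) = basis_vec j"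
      unfolding inv_into_f_f [OF bij_betw_imp_inj_on [OF h] that] .
  qed
  have e_C: "e x \<in> C" if "x \<in> free_space ?B" for x
    by (rule lin_in_subspace [OF le C_sub that]) (use hA A(1) in \<open>auto simp: e_def\<close>)
  have ge: "g (e x) = x" if "x \<in> free_space ?B" for x
    by (rule lin_eqI [OF lin_compose [OF g(1) le] lin_id that]) (simp add: e_def hA)
  have eg: "e (g c) = c" if "c \<in> C" for c
  proof (rule vecs.linear_eq_on [OF lin_compose [OF le g(1)] lin_id])
    show "c \<in> vec.span A" using that A(4) by blast
    fix a assume "a \<in> A"
    then obtain j where j: "j \<in> ?B" "a = h j" using h by (auto simp: bij_betw_def)
    show "e (g a) = a" unfolding j(2) hA(2) [OF j(1)] by (simp add: e_def)
  qed
  have g_in: "g c \<in> free_space ?B" if "c \<in> C" for c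
  proof -
    have "g ` vec.span A \<subseteq> free_space ?B"
      unfolding vecs.linear_span_image [OF g(1), symmetric]
    proof (rule vec.span_minimal [OF _ subspace_free_space], safe)
      fix a assume "a \<in> A"
      then obtain j where j: "j \<in> ?B" "a = h j" using h by (auto simp: bij_betw_def)
      show "g a \<in> free_space ?B" unfolding j(2) hA(2) [OF j(1)] using j(1) by simp
    qed
    then show ?thesis using that A(4) by blast
  qed
  have rest_C: "u - s (r u) \<in> C" if "u \<in> vectors U" for u
  proof -
    have "r (u - s (r u)) = r u - r (s (r u))" by (rule lin_diff [OF lin(2)])
    also have "\<dots> = 0" using rs [OF r_in [OF that]] by simp
    finally show ?thesis
      using free_space_diff [OF that s_in [OF r_in [OF that]]] by (simp add: C_def)
  qed
  have q_in: "q u \<in> free_space ?B" if "u \<in> vectors U" for u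
    unfolding q_def by (rule g_in [OF rest_C [OF that]])
  have q_C: "q c = g c" if "c \<in> C" for c
    using that by (simp add: q_def C_def lin_0 [OF lin(1)])
  have eq: "e (q u) = u - s (r u)" if "u \<in> vectors U" for u
    unfolding q_def by (rule eg [OF rest_C [OF that]])
  have e_U: "e x \<in> vectors U" if "x \<in> free_space ?B" for x using e_C [OF that] CU by blast
  have re0: "r (e x) = 0" if "x \<in> free_space ?B" for x using e_C [OF that] by (simp add: C_def)
  have qe: "q (e x) = x" if "x \<in> free_space ?B" for x
    unfolding q_C [OF e_C [OF that]] by (rule ge [OF that])
  have stable: "act U p (e x) \<in> C" if "x \<in> free_space ?B" for x p
    using r_act [OF e_U [OF that], of p] act_in [OF U e_U [OF that], of p] re0 [OF that]
    by (simp add: C_def lin_0 [OF lin_act'])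
  obtain Y where Y: "fd_comodule n Y" "basis Y = ?B"
    "\<And>x p. x \<in> free_space ?B \<Longrightarrow> e (act Y p x) = act U p (e x)"
  proof (rule subcomodule_exists [OF U _ le lq, of ?B])
    fix x :: "nat \<Rightarrow>\<^sub>0 'k" and p assume x: "x \<in> free_space ?B"
    show "e x \<in> vectors U \<and> q (e x) = x" using e_U [OF x] qe [OF x] by blast
    show "e (q (act U p (e x))) = act U p (e x)"
      unfolding q_C [OF stable [OF x]] by (rule eg [OF stable [OF x]])
  qed (use q_in in auto)
  define G where "G w = s (outl_vec w) + e (outr_vec w)" for w
  define F where "F u = inl_vec (r u) + inr_vec (q u)" for u
  have lG: "lin G" unfolding G_def
    by (intro lin_plus lin_compose [OF lin(1)] lin_compose [OF le] lin_in_out)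
  have lF: "lin F" unfolding F_def by (intro lin_plus lin_inl lin_inr lin lq)
  have "iso_maps (direct_sum V Y) U G F"
    unfolding iso_maps_def
  proof (intro conjI ballI allI lG lF)
    fix w assume w: "w \<in> vectors (direct_sum V Y)"
    have w1: "outl_vec w \<in> vectors V" and w2: "outr_vec w \<in> free_space ?B"
      using outl_in [OF w] outr_in [OF w] Y(2) by auto
    show "G w \<in> vectors U"
      unfolding G_def by (intro free_space_add s_in e_U w1 w2)
    have "r (G w) = outl_vec w"
      unfolding G_def lin_add [OF lin(2)] rs [OF w1] re0 [OF w2] by simp
    moreover have "q (G w) = outr_vec w"
    proof -
      have "q (s (outl_vec w)) = 0"
        unfolding q_def rs [OF w1] by (simp add: lin_0 [OF g(1)])
      then show ?thesis unfolding G_def lin_add [OF lq] qe [OF w2] by simp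
    qed
    ultimately show "F (G w) = w" unfolding F_def by (simp add: inl_inr_split)
    fix p
    have "act (direct_sum V Y) p w = act (direct_sum V Y) p (inl_vec (outl_vec w) + inr_vec (outr_vec w))"
      by (simp add: inl_inr_split)
    also have "\<dots> = inl_vec (act V p (outl_vec w)) + inr_vec (act Y p (outr_vec w))"
      by (simp only: lin_add [OF lin_act'] act_inl act_inr)
    finally have "G (act (direct_sum V Y) p w) = s (act V p (outl_vec w)) + e (act Y p (outr_vec w))"
      by (simp add: G_def lin_add [OF lin_in_out(3)] lin_add [OF lin_in_out(4)])
    then show "G (act (direct_sum V Y) p w) = act U p (G w)"
      by (simp add: s_act [OF w1] Y(3) [OF w2] G_def lin_add [OF lin_act'])
  next
    fix u assume u: "u \<in> vectors U"
    show "F u \<in> vectors (direct_sum V Y)"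
      unfolding F_def using r_in [OF u] q_in [OF u] Y(2) by (intro free_space_add inl_in inr_in) auto
    show "G (F u) = u"
      unfolding F_def G_def
      by (simp add: lin_add [OF lin_in_out(3)] lin_add [OF lin_in_out(4)] eq [OF u])
  qed
  then have "comodule_iso U (direct_sum V Y)"
    using iso_maps_sym [OF fd_direct_sum [OF V Y(1)]] unfolding comodule_iso_iff by blast
  from that [OF Y(1) this] show ?thesis .
qed

subsection \<open>String comodules\<close>

text \<open>The basis vector \<open>k\<close> sits at the vertex \<open>i + k\<close>;
  \<open>shift\<close> moves it to \<open>k + 1\<close> and kills the last one. The length
  \<open>l\<close> counts arrows, so the dimension is \<open>l + 1\<close>.\<close>

definition string :: "nat \<Rightarrow> nat \<Rightarrow> nat \<Rightarrow> (nat, 'k::field) comodule" where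
  "string n i l = \<lparr>basis = {..l},
     coact = (\<lambda>k. \<Sum>m\<le>l - k. basis_vec (k + m, ((i + k) mod n, m)))\<rparr>"

lemma basis_string [simp]: "basis (string n i l) = {..l}"
  by (simp add: string_def)

lemma act_string:
  assumes "k \<le> l"
  shows "act (string n i l) (j, m) (basis_vec k :: nat \<Rightarrow>\<^sub>0 'k::field) =
    (if j = (i + k) mod n \<and> k + m \<le> l then basis_vec (k + m) else 0)"
proof -
  have "act (string n i l) (j, m) (basis_vec k :: nat \<Rightarrow>\<^sub>0 'k) =
      (\<Sum>m'\<le>l - k. if m' = m then if j = (i + k) mod n then basis_vec (k + m) else 0 else 0)"
    unfolding act_basis string_def comodule.simps lin_sum [OF lin_slice [OF lin_id]]
    by (rule sum.cong) (auto simp: slice_basis)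
  then show ?thesis using assms by auto
qed

lemma shift_string:
  assumes "k \<le> l" "n > 0"
  shows "shift n (string n i l) (basis_vec k) = (if k < l then basis_vec (Suc k) else (0 :: nat \<Rightarrow>\<^sub>0 'k::field))"
proof -
  have "shift n (string n i l) (basis_vec k :: nat \<Rightarrow>\<^sub>0 'k) =
      (\<Sum>j<n. if j = (i + k) mod n then if k < l then basis_vec (Suc k) else 0 else 0)"
    unfolding shift_def by (rule sum.cong) (auto simp: act_string [OF assms(1)])
  then show ?thesis using assms(2) by simp
qed

lemma fd_string:
  assumes "n > 0"
  shows "fd_comodule n (string n i l :: (nat, 'k::field) comodule)" (is "fd_comodule n ?V")
  unfolding fd_comodule_iff
proof (intro conjI ballI allI)
  show "finite (basis ?V)" by simp
  fix k assume "k \<in> basis ?V"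
  then have k: "k \<le> l" by simp
  show "coact ?V k \<in> free_space (basis ?V \<times> paths n)"
    using k assms unfolding string_def comodule.simps by (intro free_space_sum) (auto simp: paths_def)
  show "act ?V r (act ?V s (basis_vec k)) =
     (if fst r = (fst s + snd s) mod n then act ?V (fst s, snd r + snd s) (basis_vec k) else 0)" for r s
  proof -
    obtain j m j' m' where [simp]: "r = (j, m)" "s = (j', m')" by (cases r, cases s)
    have *: "(i + (k + m')) mod n = ((i + k) mod n + m') mod n"
      by (simp add: mod_add_left_eq add.assoc)
    show ?thesis
      by (auto simp: act_string k * lin_0 [OF lin_act'] add_ac)
  qed
  show "(\<Sum>j<n. act ?V (j, 0) (basis_vec k)) = basis_vec k"
  proof -
    have "(\<Sum>j<n. act ?V (j, 0) (basis_vec k)) = (\<Sum>j<n. if j = (i + k) mod n then basis_vec k else 0)"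
      by (rule sum.cong) (auto simp: act_string k)
    then show ?thesis using assms by simp
  qed
qed

text \<open>A homogeneous vector that survives a longest nonzero path generates a string. A functional
  with value 1 on the last vector of the string and 0 on the other ones yields a retraction onto it.\<close>

lemma split_string:
  fixes U :: "('a, 'k::field) comodule"
  assumes U: "fd_comodule n U" and "n > 0" and "basis U \<noteq> {}"
  obtains i l and Y :: "(nat, 'k) comodule" where "i < n" "fd_comodule n Y"
    "comodule_iso U (direct_sum (string n i l) Y)" "card (basis Y) < card (basis U)"
proof -
  \<comment> \<open>The greatest length for which some path acts nontrivially is the length of the
    string to be split off.\<close>
  define Q where "Q l \<longleftrightarrow> (\<exists>v\<in>vectors U. \<exists>i<n. act U (i, l) v \<noteq> 0)" for l
  obtain b where b: "b \<in> basis U" using assms(3) by blast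
  have e_b: "(basis_vec b :: 'a \<Rightarrow>\<^sub>0 'k) \<in> vectors U" using b by simp
  have nz: "(basis_vec b :: 'a \<Rightarrow>\<^sub>0 'k) \<noteq> 0"
  proof
    assume "(basis_vec b :: 'a \<Rightarrow>\<^sub>0 'k) = 0"
    from arg_cong [OF this, of "\<lambda>v. coeff_at v b"] show False by (simp add: coeff_basis)
  qed
  have "Q 0"
  proof (rule ccontr)
    assume "\<not> Q 0"
    then have "\<And>i. i < n \<Longrightarrow> act U (i, 0) (basis_vec b) = 0" using e_b unfolding Q_def by blast
    then have "(\<Sum>i<n. act U (i, 0) (basis_vec b)) = 0" by simp
    then show False using act_decompose [OF U e_b] nz by simp
  qed
  obtain N where N: "\<And>i l v. l \<ge> N \<Longrightarrow> v \<in> vectors U \<Longrightarrow> act U (i, l) v = 0"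
    using act_nilpotent [OF U] by blast
  have bound: "l \<le> N" if "Q l" for l
    using that N [of l] unfolding Q_def by (meson nat_le_linear)
  define l where "l = (GREATEST l. Q l)"
  have "Q l" unfolding l_def using GreatestI_nat [of Q 0 N] \<open>Q 0\<close> bound by blast
  have max: "m \<le> l" if "Q m" for m
    unfolding l_def using Greatest_le_nat [of Q m N] that bound by blast
  have zero: "act U (j, m) w = 0" if "w \<in> vectors U" "m > l" for j m w
    using max [of m] that act_outside [OF U that(1), of j m] unfolding Q_def by (meson not_le)
  obtain v i where v: "v \<in> vectors U" and i: "i < n" and tl: "act U (i, l) v \<noteq> 0"
    using \<open>Q l\<close> unfolding Q_def by blast
  define t where "t m = act U (i, m) v" for m
  have t_in: "t m \<in> vectors U" for m unfolding t_def by (rule act_in [OF U v])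
  have t0: "t m = 0" if "m > l" for m unfolding t_def by (rule zero [OF v that])
  have act_t: "act U (j, m) (t k) = (if j = (i + k) mod n then t (m + k) else 0)" for j m k
    unfolding t_def by (rule act_act [OF U v])
  \<comment> \<open>The span is enlarged downwards. In a relation that involves
    \<open>t (l - Suc j)\<close> and later vectors of the chain, the power of \<open>shift\<close>
    that carries \<open>t (l - Suc j)\<close> to \<open>t l\<close> kills all the later ones; hence
    the coefficient of \<open>t (l - Suc j)\<close> is zero.\<close>
  have not_span: "t l \<notin> vec.span (t ` {l - j..<l})" if "j \<le> l" for j
    using that
  proof (induction j)
    case 0
    then show ?case using tl by (simp add: t_def)
  next
    case (Suc j)
    let ?a = "l - Suc j"
    have set: "{?a..<l} = insert ?a {l - j..<l}" using Suc.prems by auto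
    show ?case
    proof
      assume "t l \<in> vec.span (t ` {?a..<l})"
      then obtain c where c: "t l - scale_vec c (t ?a) \<in> vec.span (t ` {l - j..<l})"
        unfolding set image_insert vec.span_breakdown_eq by blast
      let ?T = "act U ((i + ?a) mod n, Suc j)"
      have T_kill: "act U (j', Suc j) (t m) = 0" if "m > ?a" for j' m
        using that Suc.prems by (auto simp: act_t intro!: t0)
      \<comment> \<open>Summing over all starting vertices gives the power \<open>Suc j\<close> of
        \<open>shift\<close>, so degrees need not be tracked.\<close>
      let ?S = "\<lambda>w. \<Sum>j'<n. act U (j', Suc j) w"
      have lS: "lin ?S" by (intro lin_intros)
      have S_kill: "?S (t m) = 0" if "m > ?a" for m using T_kill [OF that] by simp
      have "?S w = 0" if "w \<in> vec.span (t ` {l - j..<l})" for w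
      proof (rule vecs.linear_eq_on [OF lS lin_zero that])
        fix x assume "x \<in> t ` {l - j..<l}"
        then obtain m where m: "x = t m" "m \<ge> l - j" by auto
        have "m > ?a" using m(2) Suc.prems by linarith
        then show "?S x = 0" unfolding m(1) by (rule S_kill)
      qed
      then have "?S (t l - scale_vec c (t ?a)) = 0" using c by blast
      then have "?S (t l) - scale_vec c (?S (t ?a)) = 0"
        unfolding lin_diff [OF lS] lin_scale [OF lS] .
      moreover have "?S (t l) = 0" by (rule S_kill) (use Suc.prems in linarith)
      moreover have "?S (t ?a) = t l"
      proof -
        have "?S (t ?a) = (\<Sum>j'<n. if j' = (i + ?a) mod n then t l else 0)"
          using Suc.prems by (intro sum.cong) (auto simp: act_t)
        then show ?thesis using \<open>n > 0\<close> by simp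
      qed
      ultimately have "scale_vec c (t l) = 0" by simp
      then have "c = 0" using tl by (simp add: t_def)
      then have "t l \<in> vec.span (t ` {l - j..<l})" using c by simp
      then show False using Suc.IH Suc.prems by simp
    qed
  qed
  have not_span: "t l \<notin> vec.span (t ` {0..<l})" using not_span [of l] by simp
  obtain D where D: "D \<subseteq> t ` {0..<l}" "vec.independent D" "t ` {0..<l} \<subseteq> vec.span D"
    by (rule vec.maximal_independent_subset)
  have tlD: "t l \<notin> vec.span D" using not_span vec.span_mono [OF D(1)] by blast
  \<comment> \<open>The functional takes its values in the line with basis \<open>()\<close>. It
    exists because \<open>t l\<close> lies outside the span of the vectors \<open>t m\<close> with
    \<open>m < l\<close>.\<close>
  obtain g :: "('a \<Rightarrow>\<^sub>0 'k) \<Rightarrow> (unit \<Rightarrow>\<^sub>0 'k)"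
    where g: "lin g" "\<forall>x\<in>insert (t l) D. g x = (if x = t l then basis_vec () else 0)"
    using vecs.linear_independent_extend [OF vec.independent_insertI [OF tlD D(2)],
      of "\<lambda>x. if x = t l then basis_vec () else 0"] by blast
  define \<phi> where "\<phi> w = coeff_at (g w) ()" for w
  have g_t: "g (t m) = 0" if "m < l" for m
  proof (rule vecs.linear_eq_on [OF g(1) lin_zero])
    show "t m \<in> vec.span D" using D(3) that by auto
    fix x assume x: "x \<in> D"
    then have "x \<noteq> t l" using tlD vec.span_base by blast
    then show "g x = 0" using g(2) x by simp
  qed
  have \<phi>_t: "\<phi> (t m) = (if m = l then 1 else 0)" for m
  proof -
    consider "m < l" | "m = l" | "m > l" by linarith
    then show ?thesis
      by cases (use g(2) in \<open>auto simp: \<phi>_def g_t coeff_basis t0 lin_0 [OF g(1)]\<close>)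
  qed
  have \<phi>0: "\<phi> 0 = 0" by (simp add: \<phi>_def lin_0 [OF g(1)])
  let ?V = "string n i l :: (nat, 'k) comodule"
  have V: "fd_comodule n ?V" by (rule fd_string [OF \<open>n > 0\<close>])
  define s where "s = lin_extend t"
  have ls: "lin s" unfolding s_def by (rule lin_lin_extend')
  have s_basis: "s (basis_vec k) = t k" for k by (simp add: s_def)
  \<comment> \<open>Coordinate \<open>k\<close> is found by pushing the component of degree
    \<open>i + k\<close> forward by \<open>l - k\<close> steps, to the end of the string, and
    applying \<open>\<phi>\<close> there.\<close>
  define r where "r w = (\<Sum>k\<le>l. scale_vec (\<phi> (act U ((i + k) mod n, l - k) w)) (basis_vec k :: nat \<Rightarrow>\<^sub>0 'k))" for w
  have lr: "lin r" unfolding r_def \<phi>_def by (intro lin_summed lin_coeff lin_compose [OF g(1)] lin_act')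
  have s_in: "s w \<in> vectors U" if "w \<in> vectors ?V" for w
    by (rule lin_in_subspace [OF ls subspace_free_space that]) (simp add: s_basis t_in)
  have r_in: "r u \<in> vectors ?V" for u
    unfolding r_def by (intro free_space_sum free_space_scale) simp
  have rs: "r (s w) = w" if "w \<in> vectors ?V" for w
  proof (rule lin_eqI [OF lin_compose [OF lr ls] lin_id that])
    fix k assume "k \<in> basis ?V"
    then have k: "k \<le> l" by simp
    have "\<phi> (act U ((i + m) mod n, l - m) (t k)) = (if m = k then 1 else 0)" if "m \<le> l" for m
    proof -
      have "\<phi> (t (l - m + k)) = (if m = k then 1 else 0)" using that k by (auto simp: \<phi>_t)
      then show ?thesis by (auto simp: act_t \<phi>0)
    qed
    then have "r (t k) = (\<Sum>m\<le>l. if m = k then basis_vec m else 0)"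
      unfolding r_def by (intro sum.cong) auto
    then show "r (s (basis_vec k)) = basis_vec k" using k by (simp add: s_basis)
  qed
  have s_act: "s (act ?V p w) = act U p (s w)" if "w \<in> vectors ?V" for w p
  proof (rule act_commuteI_shift [OF V U ls _ _ _ that])
    fix k assume "k \<in> basis ?V"
    then have k: "k \<le> l" by simp
    show "s (basis_vec k) \<in> vectors U" by (simp add: s_basis t_in)
    show "s (act ?V (j, 0) (basis_vec k)) = act U (j, 0) (s (basis_vec k))" for j
      using k by (simp add: act_string s_basis act_t lin_0 [OF ls])
    have "shift n U (t k) = t (Suc k)" unfolding t_def by (rule shift_act [OF U v])
    then show "s (shift n ?V (basis_vec k)) = shift n U (s (basis_vec k))"
      using k t0 [of "Suc k"] by (auto simp: shift_string [OF k \<open>n > 0\<close>] s_basis lin_0 [OF ls])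
  qed
  have r_act: "r (act U p u) = act ?V p (r u)" if u: "u \<in> vectors U" for u p
  proof (rule act_commuteI_shift [OF U V lr _ _ _ that])
    fix a assume a: "a \<in> basis U"
    let ?u = "basis_vec a :: 'a \<Rightarrow>\<^sub>0 'k"
    have u: "?u \<in> vectors U" using a by simp
    show "r ?u \<in> vectors ?V" by (rule r_in)
    show "r (act U (j, 0) ?u) = act ?V (j, 0) (r ?u)" if "j < n" for j
      unfolding r_def lin_sum [OF lin_act'] lin_scale [OF lin_act']
    proof (rule sum.cong [OF refl])
      fix k assume "k \<in> {..l}"
      then have k: "k \<le> l" by simp
      show "scale_vec (\<phi> (act U ((i + k) mod n, l - k) (act U (j, 0) ?u))) (basis_vec k) =
        scale_vec (\<phi> (act U ((i + k) mod n, l - k) ?u)) (act ?V (j, 0) (basis_vec k))"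
        using that k by (auto simp: act_act [OF U u] act_string \<phi>0)
    qed
    define h where "h k = \<phi> (act U ((i + k) mod n, l - k) ?u)" for k
    have step: "act U (Suc j mod n, m) (shift n U ?u) = act U (j, Suc m) ?u" if "j < n" for j m
    proof -
      have "act U (Suc j mod n, m) (shift n U ?u) = (\<Sum>j'<n. if j' = j then act U (j, Suc m) ?u else 0)"
        unfolding shift_def lin_sum [OF lin_act']
      proof (rule sum.cong)
        fix j' assume "j' \<in> {..<n}"
        then have "Suc j mod n = Suc j' mod n \<longleftrightarrow> j' = j"
          using that by (auto simp: mod_Suc split: if_splits)
        then show "act U (Suc j mod n, m) (act U (j', 1) ?u) = (if j' = j then act U (j, Suc m) ?u else 0)"
          by (simp add: act_act [OF U u])
      qed simp
      then show ?thesis using that by simp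
    qed
    \<comment> \<open>The coordinate at the start of the string comes from a path of length
      \<open>l + 1\<close>, which acts as zero because \<open>l\<close> is maximal. That path starts
      at the predecessor of \<open>i\<close>, written \<open>i + (n - 1)\<close> modulo
      \<open>n\<close>.\<close>
    have 0: "\<phi> (act U ((i + 0) mod n, l - 0) (shift n U ?u)) = 0"
    proof -
      have "i = Suc ((i + (n - 1)) mod n) mod n" using i \<open>n > 0\<close> by (simp add: mod_Suc_eq)
      then show ?thesis
        using step [of "(i + (n - 1)) mod n" l] i \<open>n > 0\<close> zero [OF u, of "Suc l"] by (simp add: \<phi>0)
    qed
    have S: "\<phi> (act U ((i + Suc k) mod n, l - Suc k) (shift n U ?u)) = h k" if "k < l" for k
    proof -
      have "(i + Suc k) mod n = Suc ((i + k) mod n) mod n" by (simp add: mod_Suc_eq)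
      moreover have "Suc (l - Suc k) = l - k" using that by simp
      ultimately show ?thesis
        using step [of "(i + k) mod n" "l - Suc k"] \<open>n > 0\<close> by (simp add: h_def)
    qed
    have "shift n ?V (r ?u) = (\<Sum>k\<le>l. scale_vec (h k) (if k < l then basis_vec (Suc k) else 0))"
      unfolding r_def lin_sum [OF lin_shift'] lin_scale [OF lin_shift'] h_def
      by (intro sum.cong refl) (simp add: shift_string \<open>n > 0\<close>)
    moreover have "r (shift n U ?u) = \<dots>"
    proof (cases l)
      case 0
      then show ?thesis using \<open>\<phi> (act U ((i + 0) mod n, l - 0) (shift n U ?u)) = 0\<close> by (simp add: r_def)
    next
      case (Suc l')
      have "r (shift n U ?u) = (\<Sum>k\<le>l'. scale_vec (\<phi> (act U ((i + Suc k) mod n, l - Suc k) (shift n U ?u))) (basis_vec (Suc k)))"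
        unfolding r_def Suc sum.atMost_Suc_shift using 0 by (simp add: Suc)
      also have "\<dots> = (\<Sum>k\<le>l'. scale_vec (h k) (basis_vec (Suc k)))"
        by (rule sum.cong [OF refl], subst S) (simp_all add: Suc)
      also have "\<dots> = (\<Sum>k\<le>l. scale_vec (h k) (if k < l then basis_vec (Suc k) else 0))"
        by (simp add: Suc)
      finally show ?thesis .
    qed
    ultimately show "r (shift n U ?u) = shift n ?V (r ?u)" by simp
  qed
  obtain Y :: "(nat, 'k) comodule" where Y: "fd_comodule n Y" "comodule_iso U (direct_sum ?V Y)"
    by (rule split_off [OF U V ls lr s_in r_in rs s_act r_act])
  have "card (basis (direct_sum ?V Y)) = card (basis ?V) + card (basis Y)"
    unfolding basis_direct_sum using fd_finite [OF V] fd_finite [OF Y(1)]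
    by (subst card_Un_disjoint) (auto simp: card_image)
  then have "card (basis Y) < card (basis U)"
    using comodule_iso_card [OF Y(2)] by simp
  from that [OF i Y this] show ?thesis .
qed

text \<open>This form replaces a decomposition into strings: an iterated direct sum would change its
  index type at every step, so strings are split off one at a time, by induction on the
  dimension.\<close>

lemma comodule_induct [consumes 2, case_names zero step]:
  fixes U :: "(nat, 'k::field) comodule"
  assumes "fd_comodule n U" "n > 0"
    and zero: "\<And>U. fd_comodule n U \<Longrightarrow> basis U = {} \<Longrightarrow> P U"
    and step: "\<And>U i l Y. fd_comodule n U \<Longrightarrow> i < n \<Longrightarrow> fd_comodule n Y \<Longrightarrow> P Y \<Longrightarrow>
      comodule_iso U (direct_sum (string n i l) Y) \<Longrightarrow> P U"
  shows "P U"
  using assms(1)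
proof (induction "card (basis U)" arbitrary: U rule: less_induct)
  case less
  show ?case
  proof (cases "basis U = {}")
    case True
    then show ?thesis using zero less.prems by blast
  next
    case False
    obtain i l and Y :: "(nat, 'k) comodule" where *: "i < n" "fd_comodule n Y"
      "comodule_iso U (direct_sum (string n i l) Y)" "card (basis Y) < card (basis U)"
      by (rule split_string [OF less.prems \<open>n > 0\<close> False])
    have "P Y" using less.hyps [OF *(4,2)] .
    then show ?thesis using step [OF less.prems *(1,2) _ *(3)] by blast
  qed
qed

subsection \<open>Gaussian binomial coefficients at 1\<close>

lemma q_int_poly_add: "q_int_poly (l + m) = q_int_poly l + [:0, 1:] ^ l * (q_int_poly m :: 'k::field poly)"
proof (induction m)
  case (Suc m)
  have "(q_int_poly (l + Suc m) :: 'k poly) = q_int_poly (l + m) + [:0, 1:] ^ (l + m)"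
    by (simp add: q_int_poly_def)
  also have "\<dots> = q_int_poly l + [:0, 1:] ^ l * (q_int_poly m + [:0, 1:] ^ m)"
    by (simp only: Suc.IH power_add distrib_left add.assoc)
  finally show ?case by (simp add: q_int_poly_def)
qed (simp add: q_int_poly_def)

lemma q_fact_poly_Suc: "q_fact_poly (Suc l) = q_fact_poly l * (q_int_poly (Suc l) :: 'k::field poly)"
  by (simp add: q_fact_poly_def atLeastAtMostSuc_conv mult.commute)

text \<open>The q-Pascal rule writes the q-integer of \<open>l + m\<close> as that of
  \<open>l\<close> plus a power of the variable times that of \<open>m\<close>. Each of the two
  parts supplies the factor missing from one of the two divisibilities known for
  \<open>l + m - 1\<close>.\<close>

lemma q_fact_poly_dvd: "q_fact_poly l * q_fact_poly m dvd (q_fact_poly (l + m) :: 'k::field poly)"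
proof (induction "l + m" arbitrary: l m)
  case 0
  then show ?case by (simp add: q_fact_poly_def)
next
  case (Suc s)
  show ?case
  proof (cases "l = 0 \<or> m = 0")
    case True
    then show ?thesis by (auto simp: q_fact_poly_def)
  next
    case False
    then obtain l' m' where lm: "l = Suc l'" "m = Suc m'" by (meson not0_implies_Suc)
    define F where "F = (q_fact_poly (l' + m) :: 'k poly)"
    have "q_fact_poly l' * q_fact_poly m dvd F"
      unfolding F_def by (rule Suc.hyps(1)) (use Suc.hyps(2) lm in simp)
    from mult_dvd_mono [OF this dvd_refl [of "q_int_poly (Suc l')"]]
    have 1: "q_fact_poly l * q_fact_poly m dvd F * q_int_poly l"
      unfolding lm(1) q_fact_poly_Suc by (simp only: mult_ac)
    have F: "F = q_fact_poly (l + m')" by (simp add: F_def lm)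
    have "q_fact_poly l * q_fact_poly m' dvd F"
      unfolding F by (rule Suc.hyps(1)) (use Suc.hyps(2) lm in simp)
    from mult_dvd_mono [OF this dvd_refl [of "q_int_poly (Suc m')"]]
    have 2: "q_fact_poly l * q_fact_poly m dvd F * q_int_poly m"
      unfolding lm(2) q_fact_poly_Suc by (simp only: mult_ac)
    have "q_fact_poly (l + m) = F * (q_int_poly l + [:0, 1:] ^ l * q_int_poly m)"
      unfolding q_int_poly_add [symmetric] F_def using q_fact_poly_Suc [of "l' + m", where 'k = 'k] by (simp add: lm)
    also have "\<dots> = F * q_int_poly l + [:0, 1:] ^ l * (F * q_int_poly m)"
      by (simp only: algebra_simps)
    finally show ?thesis using dvd_add [OF 1 dvd_mult [OF 2]] by (simp only:)
  qed
qed

lemma poly_q_fact_1: "poly (q_fact_poly l) 1 = (fact l :: 'k::field_char_0)"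
proof (induction l)
  case (Suc l)
  have "poly (q_int_poly (Suc l)) 1 = (of_nat (Suc l) :: 'k)"
    unfolding q_int_poly_def poly_sum poly_power by simp
  then show ?case using Suc by (simp add: q_fact_poly_Suc mult.commute)
qed (simp add: q_fact_poly_def)

text \<open>The division is exact, so the product identity may be evaluated at 1; the factorials are
  invertible in characteristic 0.\<close>

lemma q_binomial_1: "q_binomial l m 1 = (of_nat ((l + m) choose l) :: 'k::field_char_0)"
proof -
  have "q_fact_poly (l + m) = q_fact_poly (l + m) div (q_fact_poly l * q_fact_poly m) * (q_fact_poly l * (q_fact_poly m :: 'k poly))"
    by (rule dvd_div_mult_self [OF q_fact_poly_dvd, symmetric])
  from arg_cong [OF this, of "\<lambda>p. poly p 1"]
  have "fact (l + m) = q_binomial l m (1 :: 'k) * (fact l * fact m)"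
    unfolding poly_mult poly_q_fact_1 q_binomial_def .
  moreover have "(of_nat ((l + m) choose l) :: 'k) = fact (l + m) / (fact l * fact m)"
    by (simp add: binomial_fact)
  ultimately show ?thesis by simp
qed

subsection \<open>Tensor products of comodules\<close>

lemma tensor_zero [simp]: "tensor_vec 0 w = (0 :: _ \<Rightarrow>\<^sub>0 'k::field)" "tensor_vec v 0 = (0 :: _ \<Rightarrow>\<^sub>0 'k::field)"
  by (rule lin_0 [OF lin_tensor_left [OF lin_id]], rule lin_0 [OF lin_tensor_right [OF lin_id]])

lemma tensor_add_left: "tensor_vec (v + v') w = tensor_vec v w + (tensor_vec v' w :: _ \<Rightarrow>\<^sub>0 'k::field)"
  by (rule lin_add [OF lin_tensor_left [OF lin_id]])

lemma tensor_add_right: "tensor_vec w (v + v') = tensor_vec w v + (tensor_vec w v' :: _ \<Rightarrow>\<^sub>0 'k::field)"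
  by (rule lin_add [OF lin_tensor_right [OF lin_id]])

lemma tensor_scale_right: "tensor_vec w (scale_vec c v) = (scale_vec c (tensor_vec w v) :: _ \<Rightarrow>\<^sub>0 'k::field)"
  by (rule lin_scale [OF lin_tensor_right [OF lin_id]])

lemma lin_if [lin_intros]: "lin F \<Longrightarrow> lin G \<Longrightarrow> lin (\<lambda>v. if c then F v else G v)"
  by (cases c) simp_all

lemma bilinear_eqI:
  fixes F :: "('a \<Rightarrow>\<^sub>0 'k::field) \<Rightarrow> ('b \<Rightarrow>\<^sub>0 'k) \<Rightarrow> ('c \<Rightarrow>\<^sub>0 'k)"
  assumes "\<And>w. lin (\<lambda>v. F v w)" "\<And>w. lin (\<lambda>v. G v w)" "\<And>v. lin (F v)" "\<And>v. lin (G v)"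
    and "v \<in> free_space B" "w \<in> free_space C"
    and "\<And>b c. b \<in> B \<Longrightarrow> c \<in> C \<Longrightarrow> F (basis_vec b) (basis_vec c) = G (basis_vec b) (basis_vec c)"
  shows "F v w = G v w"
proof (rule lin_eqI [OF assms(1,2,5)])
  fix b assume "b \<in> B"
  then show "F (basis_vec b) w = G (basis_vec b) w"
    by (intro lin_eqI [OF assms(3,4,6)] assms(7))
qed

lemma bilinear_ext:
  fixes F :: "('a \<Rightarrow>\<^sub>0 'k::field) \<Rightarrow> ('b \<Rightarrow>\<^sub>0 'k) \<Rightarrow> ('c \<Rightarrow>\<^sub>0 'k)"
  assumes "\<And>w. lin (\<lambda>v. F v w)" "\<And>w. lin (\<lambda>v. G v w)" "\<And>v. lin (F v)" "\<And>v. lin (G v)"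
    and "\<And>b c. F (basis_vec b) (basis_vec c) = G (basis_vec b) (basis_vec c)"
  shows "F v w = G v w"
  by (rule bilinear_eqI [OF assms(1-4) free_space_UNIV free_space_UNIV assms(5)])

lemma basis_tensor_comodule [simp]: "basis (tensor_comodule n q U V) = basis U \<times> basis V"
  by (simp add: tensor_comodule_def)

definition path_mult_ext :: "nat \<Rightarrow> (('a \<times> path) \<times> 'b \<times> path \<Rightarrow>\<^sub>0 'k::field) \<Rightarrow> (('a \<times> 'b) \<times> path \<Rightarrow>\<^sub>0 'k)" where
  "path_mult_ext n = lin_extend (\<lambda>((a, p), (b, r)). tensor_vec (basis_vec (a, b)) (path_mult n 1 (p, r)))"

lemma path_mult_ext_basis:
  "path_mult_ext n (basis_vec ((a, i, l), (b, j, m))) =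
    scale_vec (of_nat ((l + m) choose l)) (basis_vec ((a, b), ((i + j) mod n, l + m)) :: _ \<Rightarrow>\<^sub>0 'k::field_char_0)"
  by (simp add: path_mult_ext_def path_mult_def q_binomial_1 tensor_scale_right)

text \<open>Paths of lengths \<open>l\<close> and \<open>m\<close> multiply with coefficient
  \<open>(l + m) choose l\<close>, so the slice at length \<open>L\<close> collects all splittings
  of \<open>L\<close> with binomial weights.\<close>

lemma slice_path_mult_ext:
  fixes x :: "'a \<times> path \<Rightarrow>\<^sub>0 'k::field_char_0" and y :: "'b \<times> path \<Rightarrow>\<^sub>0 'k"
  assumes "x \<in> free_space (B \<times> paths n)" "y \<in> free_space (C \<times> paths n)"
  shows "slice (k, L) (path_mult_ext n (tensor_vec x y)) =
    (\<Sum>i<n. \<Sum>j<n. if k = (i + j) mod n then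
      \<Sum>l\<le>L. scale_vec (of_nat (L choose l)) (tensor_vec (slice (i, l) x) (slice (j, L - l) y)) else 0)"
proof -
  define R :: "('a \<times> path \<Rightarrow>\<^sub>0 'k) \<Rightarrow> ('b \<times> path \<Rightarrow>\<^sub>0 'k) \<Rightarrow> ('a \<times> 'b \<Rightarrow>\<^sub>0 'k)" where
    "R x y = (\<Sum>i<n. \<Sum>j<n. if k = (i + j) mod n then
      \<Sum>l\<le>L. scale_vec (of_nat (L choose l)) (tensor_vec (slice (i, l) x) (slice (j, L - l) y)) else 0)" for x y
  have lR: "lin (\<lambda>x. R x y)" "lin (R x)" for x y
    unfolding R_def by (intro lin_summed lin_if lin_scaled lin_tensor_left lin_tensor_right lin_slice lin_id lin_zero)+
  have lP: "lin (\<lambda>x. slice (k, L) (path_mult_ext n (tensor_vec x y)))"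
    "lin (\<lambda>y. slice (k, L) (path_mult_ext n (tensor_vec x y)))"
    for x :: "'a \<times> path \<Rightarrow>\<^sub>0 'k" and y :: "'b \<times> path \<Rightarrow>\<^sub>0 'k"
    unfolding path_mult_ext_def by (intro lin_slice lin_lin_extend lin_tensor_left lin_tensor_right lin_id)+
  have "slice (k, L) (path_mult_ext n (tensor_vec x y)) = R x y"
  proof (rule bilinear_eqI [OF lP(1) lR(1) lP(2) lR(2) assms])
    fix b c assume "b \<in> B \<times> paths n" "c \<in> C \<times> paths n"
    then obtain b' i l c' j m where bc: "b = (b', i, l)" "c = (c', j, m)" "i < n" "j < n"
      by (auto simp: paths_def)
    \<comment> \<open>For fixed basis vectors only the starting vertices \<open>(i, j)\<close> and
      the splitting \<open>L = l + m\<close> contribute; \<open>Q\<close> is that one term.\<close>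
    define Q :: "'a \<times> 'b \<Rightarrow>\<^sub>0 'k" where "Q = (if k = (i + j) mod n then if L = l + m then
      scale_vec (of_nat (L choose l)) (basis_vec (b', c')) else 0 else 0)"
    have "(if k = (i' + j') mod n then \<Sum>l'\<le>L. scale_vec (of_nat (L choose l'))
        (tensor_vec (slice (i', l') (basis_vec b)) (slice (j', L - l') (basis_vec c))) else 0) =
      (if j' = j then if i' = i then Q else 0 else 0)" for i' j'
    proof -
      have "(\<Sum>l'\<le>L. scale_vec (of_nat (L choose l'))
        (tensor_vec (slice (i', l') (basis_vec b)) (slice (j', L - l') (basis_vec c)))) =
        (\<Sum>l'\<le>L. if l' = l then if i' = i \<and> j' = j \<and> m = L - l then
          scale_vec (of_nat (L choose l)) (basis_vec (b', c')) else 0 else 0 :: 'a \<times> 'b \<Rightarrow>\<^sub>0 'k)"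
        by (rule sum.cong [OF refl]) (simp add: bc slice_basis)
      also have "\<dots> = (if l \<le> L then if i' = i \<and> j' = j \<and> m = L - l then
          scale_vec (of_nat (L choose l)) (basis_vec (b', c')) else 0 else 0)"
        by simp
      finally have *: "(\<Sum>l'\<le>L. scale_vec (of_nat (L choose l'))
        (tensor_vec (slice (i', l') (basis_vec b)) (slice (j', L - l') (basis_vec c)))) =
        (if l \<le> L then if i' = i \<and> j' = j \<and> m = L - l then
          scale_vec (of_nat (L choose l)) (basis_vec (b', c')) else 0 else 0 :: 'a \<times> 'b \<Rightarrow>\<^sub>0 'k)" .
      have "l \<le> L \<and> m = L - l \<longleftrightarrow> L = l + m" by linarith
      then show ?thesis unfolding * Q_def by (cases "i' = i"; cases "j' = j"; simp)
    qed
    then have "R (basis_vec b) (basis_vec c) = Q"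
      unfolding R_def using bc(3,4) by simp
    moreover have "slice (k, L) (path_mult_ext n (tensor_vec (basis_vec b) (basis_vec c))) = Q"
      unfolding bc(1,2) tensor_basis path_mult_ext_basis lin_scale [OF lin_slice [OF lin_id]] slice_basis Q_def
      by simp
    ultimately show "slice (k, L) (path_mult_ext n (tensor_vec (basis_vec b) (basis_vec c))) =
      R (basis_vec b) (basis_vec c)" by simp
  qed
  then show ?thesis unfolding R_def .
qed

lemma lin_extend_coact_tensor:
  "lin_extend (coact (tensor_comodule n 1 U V)) (tensor_vec v w) =
    path_mult_ext n (tensor_vec (lin_extend (coact U) v) (lin_extend (coact V) w))"
proof (rule bilinear_ext [where v = v and w = w])
  show "lin_extend (coact (tensor_comodule n 1 U V)) (tensor_vec (basis_vec b) (basis_vec c)) =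
    path_mult_ext n (tensor_vec (lin_extend (coact U) (basis_vec b)) (lin_extend (coact V) (basis_vec c)))" for b c
    by (simp add: tensor_comodule_def path_mult_ext_def)
qed (unfold path_mult_ext_def, (intro lin_intros)+)

lemma coact_ext_in:
  assumes "fd_comodule n U" "v \<in> vectors U"
  shows "lin_extend (coact U) v \<in> free_space (basis U \<times> paths n)"
  by (rule lin_in_subspace [OF lin_lin_extend' subspace_free_space assms(2)])
    (simp add: fd_coact [OF assms(1)])

lemma act_tensor:
  fixes U :: "('a, 'k::field_char_0) comodule" and V :: "('b, 'k) comodule"
  assumes "fd_comodule n U" "fd_comodule n V" "v \<in> vectors U" "w \<in> vectors V"
  shows "act (tensor_comodule n 1 U V) (k, L) (tensor_vec v w) =
    (\<Sum>i<n. \<Sum>j<n. if k = (i + j) mod n then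
      \<Sum>l\<le>L. scale_vec (of_nat (L choose l)) (tensor_vec (act U (i, l) v) (act V (j, L - l) w)) else 0)"
  unfolding act_def lin_extend_coact_tensor
  by (rule slice_path_mult_ext [OF coact_ext_in [OF assms(1,3)] coact_ext_in [OF assms(2,4)]])

section \<open>Homogeneous vectors and reduction to them\<close>

definition homogeneous :: "nat \<Rightarrow> ('a, 'k::field) comodule \<Rightarrow> nat \<Rightarrow> ('a \<Rightarrow>\<^sub>0 'k) \<Rightarrow> bool" where
  "homogeneous n U i v \<longleftrightarrow> v \<in> vectors U \<and> i < n \<and> act U (i, 0) v = v"

lemma homogeneous_in: "homogeneous n U i v \<Longrightarrow> v \<in> vectors U"
  and homogeneous_less: "homogeneous n U i v \<Longrightarrow> i < n"
  by (simp_all add: homogeneous_def)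

lemma homogeneous_act:
  assumes "fd_comodule n U" "homogeneous n U i v" "j \<noteq> i"
  shows "act U (j, l) v = 0"
  using assms act_act [OF assms(1), of v j l i 0] by (simp add: homogeneous_def)

lemma homogeneous_shift:
  assumes "fd_comodule n U" "homogeneous n U i v"
  shows "homogeneous n U (Suc i mod n) (shift n U v)" "act U (i, 1) v = shift n U v"
proof -
  have v: "v \<in> vectors U" "i < n" "act U (i, 0) v = v" using assms(2) by (simp_all add: homogeneous_def)
  show "homogeneous n U (Suc i mod n) (shift n U v)"
    using v shift_in [OF assms(1) v(1)] act_degree_shift [OF assms(1) v(1,2)] by (simp add: homogeneous_def)
  show "act U (i, 1) v = shift n U v"
    using shift_act [OF assms(1) v(1), of i 0] v(3) by simp
qed

lemma homogeneous_component:
  assumes "fd_comodule n U" "v \<in> vectors U" "i < n"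
  shows "homogeneous n U i (act U (i, 0) v)"
  using assms act_act [OF assms(1,2), of i 0 i 0] act_in [OF assms(1,2)] by (simp add: homogeneous_def)

lemma homogeneous_eqI:
  assumes "fd_comodule n U" "lin F" "lin G" "v \<in> vectors U"
    and "\<And>i x. homogeneous n U i x \<Longrightarrow> F x = G x"
  shows "F v = G v"
proof -
  have "F (\<Sum>i<n. act U (i, 0) v) = G (\<Sum>i<n. act U (i, 0) v)"
    unfolding lin_sum [OF assms(2)] lin_sum [OF assms(3)]
    using assms(5) [OF homogeneous_component [OF assms(1,4)]] by (intro sum.cong) auto
  then show ?thesis by (simp add: act_decompose [OF assms(1,4)])
qed

text \<open>The chosen basis of a comodule need not be homogeneous, but each of its vectors is the
  sum of its components; so pure tensors of homogeneous vectors span the tensor product.\<close>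

lemma tensor_lin_eqI:
  assumes U: "fd_comodule n U" and V: "fd_comodule n V" and "lin F" "lin G" "x \<in> free_space (basis U \<times> basis V)"
    and eq: "\<And>i j v w. homogeneous n U i v \<Longrightarrow> homogeneous n V j w \<Longrightarrow> F (tensor_vec v w) = G (tensor_vec v w)"
  shows "F x = G x"
proof (rule lin_eqI [OF assms(3-5)])
  fix b assume "b \<in> basis U \<times> basis V"
  then obtain a c where b: "b = (a, c)" "a \<in> basis U" "c \<in> basis V" by blast
  note linF = lin_compose [OF assms(3)] and linG = lin_compose [OF assms(4)]
  have "F (tensor_vec (basis_vec a) (basis_vec c)) = G (tensor_vec (basis_vec a) (basis_vec c))"
  proof (rule homogeneous_eqI [OF U, of "\<lambda>v. F (tensor_vec v (basis_vec c))" "\<lambda>v. G (tensor_vec v (basis_vec c))"])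
    fix i v assume v: "homogeneous n U i v"
    show "F (tensor_vec v (basis_vec c)) = G (tensor_vec v (basis_vec c))"
      by (rule homogeneous_eqI [OF V, of "\<lambda>w. F (tensor_vec v w)" "\<lambda>w. G (tensor_vec v w)"])
        (use b eq [OF v] in \<open>auto intro!: linF linG lin_tensor_right lin_id\<close>)
  qed (use b in \<open>auto intro!: linF linG lin_tensor_left lin_id\<close>)
  then show "F (basis_vec b) = G (basis_vec b)" by (simp add: b)
qed

lemma act_tensor_homogeneous:
  fixes U :: "('a, 'k::field_char_0) comodule" and V :: "('b, 'k) comodule"
  assumes U: "fd_comodule n U" and V: "fd_comodule n V"
    and v: "homogeneous n U i v" and w: "homogeneous n V j w"
  shows "act (tensor_comodule n 1 U V) (k, L) (tensor_vec v w) =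
    (if k = (i + j) mod n then
      \<Sum>l\<le>L. scale_vec (of_nat (L choose l)) (tensor_vec (act U (i, l) v) (act V (j, L - l) w)) else 0)"
    (is "_ = ?R")
proof -
  have eq: "(if k = (i' + j') mod n then
      \<Sum>l\<le>L. scale_vec (of_nat (L choose l)) (tensor_vec (act U (i', l) v) (act V (j', L - l) w)) else 0) =
      (if j' = j then if i' = i then ?R else 0 else 0)" for i' j'
    by (cases "i' = i"; cases "j' = j"; simp add: homogeneous_act [OF U v] homogeneous_act [OF V w])
  have "act (tensor_comodule n 1 U V) (k, L) (tensor_vec v w) =
      (\<Sum>i'<n. \<Sum>j'<n. if j' = j then if i' = i then ?R else 0 else 0)"
    unfolding act_tensor [OF U V homogeneous_in [OF v] homogeneous_in [OF w]] by (intro sum.cong refl eq)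
  also have "\<dots> = ?R"
    using homogeneous_less [OF v] homogeneous_less [OF w] by (simp only: sum.delta finite_lessThan lessThan_iff if_True)
  finally show ?thesis .
qed

definition tmap :: "(('a \<Rightarrow>\<^sub>0 'k::field) \<Rightarrow> ('c \<Rightarrow>\<^sub>0 'k)) \<Rightarrow> (('b \<Rightarrow>\<^sub>0 'k) \<Rightarrow> ('d \<Rightarrow>\<^sub>0 'k)) \<Rightarrow>
    ('a \<times> 'b \<Rightarrow>\<^sub>0 'k) \<Rightarrow> ('c \<times> 'd \<Rightarrow>\<^sub>0 'k)" where
  "tmap F G = lin_extend (\<lambda>(a, b). tensor_vec (F (basis_vec a)) (G (basis_vec b)))"

lemma lin_tmap: "lin (tmap F G)"
  unfolding tmap_def by (rule lin_lin_extend')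

lemma tmap_tensor:
  assumes "lin F" "lin G"
  shows "tmap F G (tensor_vec v w) = tensor_vec (F v) (G w)"
proof (rule bilinear_ext [where v = v and w = w])
  show "tmap F G (tensor_vec (basis_vec b) (basis_vec c)) = tensor_vec (F (basis_vec b)) (G (basis_vec c))" for b c
    by (simp add: tmap_def)
  show "lin (\<lambda>v. tensor_vec (F v) (G w))" for w by (intro lin_tensor_left assms)
  show "lin (\<lambda>w. tensor_vec (F v) (G w))" for v by (intro lin_tensor_right assms)
qed (unfold tmap_def, (intro lin_intros)+)

text \<open>This operator and \<open>tensor_degree\<close> are the candidates for
  \<open>shift\<close> and for the projections of the tensor product; both are fed to
  \<open>fd_comoduleI\<close>.\<close>

definition tensor_shift :: "nat \<Rightarrow> ('a, 'k::field) comodule \<Rightarrow> ('b, 'k) comodule \<Rightarrow> ('a \<times> 'b \<Rightarrow>\<^sub>0 'k) \<Rightarrow> ('a \<times> 'b \<Rightarrow>\<^sub>0 'k)" where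
  "tensor_shift n U V x = tmap (shift n U) (\<lambda>w. w) x + tmap (\<lambda>v. v) (shift n V) x"

definition tensor_degree :: "nat \<Rightarrow> ('a, 'k::field) comodule \<Rightarrow> ('b, 'k) comodule \<Rightarrow> nat \<Rightarrow> ('a \<times> 'b \<Rightarrow>\<^sub>0 'k) \<Rightarrow> ('a \<times> 'b \<Rightarrow>\<^sub>0 'k)" where
  "tensor_degree n U V k x = (\<Sum>i<n. \<Sum>j<n. if k = (i + j) mod n then tmap (act U (i, 0)) (act V (j, 0)) x else 0)"

lemma lin_tensor_shift: "lin (tensor_shift n U V)"
  unfolding tensor_shift_def by (intro lin_plus lin_tmap)

lemma lin_tensor_degree: "lin (tensor_degree n U V k)"
  unfolding tensor_degree_def by (intro lin_summed lin_if lin_tmap lin_zero)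

lemma tensor_shift_tensor:
  "tensor_shift n U V (tensor_vec v w) = tensor_vec (shift n U v) w + tensor_vec v (shift n V w)"
  by (simp add: tensor_shift_def tmap_tensor lin_shift' lin_id)

lemma tensor_degree_homogeneous:
  assumes U: "fd_comodule n U" and V: "fd_comodule n V"
    and v: "homogeneous n U i v" and w: "homogeneous n V j w"
  shows "tensor_degree n U V k (tensor_vec v w) = (if k = (i + j) mod n then tensor_vec v w else 0)"
proof -
  have eq: "(if k = (i' + j') mod n then tmap (act U (i', 0)) (act V (j', 0)) (tensor_vec v w) else 0) =
     (if j' = j then if i' = i then if k = (i + j) mod n then tensor_vec v w else 0 else 0 else 0)" for i' j'
    unfolding tmap_tensor [OF lin_act' lin_act'] using v w
    by (cases "i' = i"; cases "j' = j"; simp add: homogeneous_act [OF U v] homogeneous_act [OF V w])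
      (simp add: homogeneous_def)
  have "tensor_degree n U V k (tensor_vec v w) =
      (\<Sum>i'<n. \<Sum>j'<n. if j' = j then if i' = i then if k = (i + j) mod n then tensor_vec v w else 0 else 0 else 0)"
    unfolding tensor_degree_def by (intro sum.cong refl eq)
  also have "\<dots> = (if k = (i + j) mod n then tensor_vec v w else 0)"
    using homogeneous_less [OF v] homogeneous_less [OF w] by (simp only: sum.delta finite_lessThan lessThan_iff if_True)
  finally show ?thesis .
qed

text \<open>The binomial theorem for the commuting operators \<open>T \<otimes> 1\<close> and
  \<open>1 \<otimes> T\<close>. Its coefficients are those of the coaction at q = 1, which is what
  makes the tensor product a comodule.\<close>

lemma tensor_shift_power:
  fixes U :: "('a, 'k::field_char_0) comodule" and V :: "('b, 'k) comodule"
  shows "(tensor_shift n U V ^^ L) (tensor_vec v w) =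
    (\<Sum>l\<le>L. scale_vec (of_nat (L choose l)) (tensor_vec ((shift n U ^^ l) v) ((shift n V ^^ (L - l)) w)))"
proof (induction L)
  case (Suc L)
  define f where "f a b = tensor_vec ((shift n U ^^ a) v) ((shift n V ^^ b) w)" for a b
  have "(tensor_shift n U V ^^ Suc L) (tensor_vec v w) =
      (\<Sum>l\<le>L. scale_vec (of_nat (L choose l)) (f (Suc l) (L - l) + f l (Suc (L - l))))"
    unfolding funpow.simps comp_def Suc lin_sum [OF lin_tensor_shift] lin_scale [OF lin_tensor_shift] tensor_shift_tensor f_def
    by simp
  also have "\<dots> = (\<Sum>l\<le>L. scale_vec (of_nat (L choose l)) (f (Suc l) (L - l))) +
      (\<Sum>l\<le>L. scale_vec (of_nat (L choose l)) (f l (Suc L - l)))"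
    by (simp add: vec.scale_right_distrib sum.distrib Suc_diff_le)
  \<comment> \<open>The added term has coefficient \<open>L choose Suc L\<close>, which is 0; it
    aligns the two sums for Pascal's rule.\<close>
  also have "(\<Sum>l\<le>L. scale_vec (of_nat (L choose l)) (f l (Suc L - l))) =
      (\<Sum>l\<le>Suc L. scale_vec (of_nat (L choose l)) (f l (Suc L - l)))"
    by (simp add: binomial_eq_0)
  also have "\<dots> = f 0 (Suc L) + (\<Sum>l\<le>L. scale_vec (of_nat (L choose Suc l)) (f (Suc l) (L - l)))"
    unfolding sum.atMost_Suc_shift by simp
  also have "(\<Sum>l\<le>L. scale_vec (of_nat (L choose l)) (f (Suc l) (L - l))) +
      (f 0 (Suc L) + (\<Sum>l\<le>L. scale_vec (of_nat (L choose Suc l)) (f (Suc l) (L - l)))) =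
      f 0 (Suc L) + (\<Sum>l\<le>L. scale_vec (of_nat (Suc L choose Suc l)) (f (Suc l) (L - l)))"
    by (simp add: vec.scale_left_distrib sum.distrib algebra_simps)
  also have "\<dots> = (\<Sum>l\<le>Suc L. scale_vec (of_nat (Suc L choose l)) (f l (Suc L - l)))"
    unfolding sum.atMost_Suc_shift by simp
  finally show ?case unfolding f_def .
qed simp

lemma fd_tensor:
  fixes U :: "('a, 'k::field_char_0) comodule" and V :: "('b, 'k) comodule"
  assumes U: "fd_comodule n U" and V: "fd_comodule n V" and n: "n > 0"
  shows "fd_comodule n (tensor_comodule n 1 U V)" (is "fd_comodule n ?W")
proof (rule fd_comoduleI [OF _ n _ lin_tensor_shift [of n U V] _ lin_tensor_degree [of n U V]])
  note tensor_eqI = tensor_lin_eqI [OF U V]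
  note deg = tensor_degree_homogeneous [OF U V]
  note linT = lin_tensor_shift [of n U V] and lind = lin_tensor_degree [of n U V]
  show "finite (basis ?W)" using fd_finite [OF U] fd_finite [OF V] by simp
  fix b assume "b \<in> basis ?W"
  then obtain a c where b: "b = (a, c)" "a \<in> basis U" "c \<in> basis V" by auto
  have bt: "basis_vec b = (tensor_vec (basis_vec a) (basis_vec c) :: _ \<Rightarrow>\<^sub>0 'k)" by (simp add: b)
  have mem: "tensor_vec (coact U a) (coact V c) \<in> free_space ((basis U \<times> paths n) \<times> (basis V \<times> paths n))"
    by (intro tensor_in_free_space fd_coact [OF U] fd_coact [OF V] b)
  have co: "coact ?W b = path_mult_ext n (tensor_vec (coact U a) (coact V c))"
    using lin_extend_coact_tensor [of n U V "basis_vec a" "basis_vec c"] by (simp add: b)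
  show "coact ?W b \<in> free_space (basis ?W \<times> paths n)"
    unfolding co
  proof (rule lin_in_subspace [OF _ subspace_free_space mem])
    fix z assume "z \<in> (basis U \<times> paths n) \<times> (basis V \<times> paths n)"
    then obtain a' i l c' j m where z: "z = ((a', i, l), (c', j, m))" "a' \<in> basis U" "c' \<in> basis V"
      by (auto simp: paths_def)
    show "(path_mult_ext n (basis_vec z) :: _ \<Rightarrow>\<^sub>0 'k) \<in> free_space (basis ?W \<times> paths n)"
      unfolding z(1) path_mult_ext_basis using z n by (intro free_space_scale) (simp add: paths_def)
  qed (unfold path_mult_ext_def, rule lin_lin_extend')
  fix i l assume "i < n"
  show "act ?W (i, l) (basis_vec b) = (tensor_shift n U V ^^ l) (tensor_degree n U V i (basis_vec b))"
  proof (rule tensor_eqI [OF lin_act' lin_compose [OF lin_funpow [OF linT] lind]])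
    show "(basis_vec b :: _ \<Rightarrow>\<^sub>0 'k) \<in> free_space (basis U \<times> basis V)" by (simp add: b)
    fix i' j' v w assume v: "homogeneous n U i' v" and w: "homogeneous n V j' w"
    have "act U (i', l') v = (shift n U ^^ l') v" "act V (j', l') w = (shift n V ^^ l') w" for l'
      using act_shift_power [OF U homogeneous_in [OF v], of i' l'] v act_shift_power [OF V homogeneous_in [OF w], of j' l'] w
      by (simp_all add: homogeneous_def)
    then show "act ?W (i, l) (tensor_vec v w) = (tensor_shift n U V ^^ l) (tensor_degree n U V i (tensor_vec v w))"
      unfolding act_tensor_homogeneous [OF U V v w] deg [OF v w]
      by (simp add: tensor_shift_power lin_0 [OF lin_funpow [OF linT]])
  qed
next
  note tensor_eqI = tensor_lin_eqI [OF U V]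
  note deg = tensor_degree_homogeneous [OF U V]
  note linT = lin_tensor_shift [of n U V] and lind = lin_tensor_degree [of n U V]
  fix x assume "x \<in> vectors ?W"
  then have x: "x \<in> free_space (basis U \<times> basis V)" by simp
  show "tensor_shift n U V x \<in> vectors ?W"
  proof (rule lin_in_subspace [OF linT subspace_free_space x])
    fix b assume "b \<in> basis U \<times> basis V"
    then obtain a c where b: "b = (a, c)" "a \<in> basis U" "c \<in> basis V" by auto
    have "tensor_shift n U V (tensor_vec (basis_vec a) (basis_vec c)) \<in> free_space (basis U \<times> basis V)"
      unfolding tensor_shift_tensor
      by (intro free_space_add tensor_in_free_space shift_in U V) (simp_all add: b)
    then show "tensor_shift n U V (basis_vec b) \<in> vectors ?W" by (simp add: b)
  qed
  show "tensor_degree n U V i x \<in> vectors ?W" for i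
  proof (rule lin_in_subspace [OF lind subspace_free_space x])
    fix b assume "b \<in> basis U \<times> basis V"
    then obtain a c where b: "b = (a, c)" "a \<in> basis U" "c \<in> basis V" by auto
    have "tmap (act U (i, 0)) (act V (j, 0)) (tensor_vec (basis_vec a) (basis_vec c)) \<in> free_space (basis U \<times> basis V)" for i j
      unfolding tmap_tensor [OF lin_act' lin_act']
      by (intro tensor_in_free_space act_in [OF U] act_in [OF V]) (simp_all add: b)
    then show "tensor_degree n U V i (basis_vec b) \<in> vectors ?W"
      unfolding tensor_degree_def by (intro free_space_sum) (simp add: b)
  qed
  show "tensor_degree n U V i (tensor_degree n U V j x) = (if i = j then tensor_degree n U V i x else 0)" for i j
    by (rule tensor_eqI [OF lin_compose [OF lind lind] lin_if [OF lind lin_zero] x])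
      (simp add: deg lin_0 [OF lind])
  show "(\<Sum>i<n. tensor_degree n U V i x) = x"
    by (rule tensor_eqI [OF lin_summed [OF lind] lin_id x]) (simp add: deg n)
  show "tensor_degree n U V (Suc i mod n) (tensor_shift n U V x) = tensor_shift n U V (tensor_degree n U V i x)"
    if "i < n" for i
  proof (rule tensor_eqI [OF lin_compose [OF lind linT] lin_compose [OF linT lind] x])
    fix i' j' v w assume v: "homogeneous n U i' v" and w: "homogeneous n V j' w"
    have "Suc i mod n = Suc (i' + j') mod n \<longleftrightarrow> i = (i' + j') mod n"
      using that mod_Suc [of "i' + j'" n] mod_Suc [of i n] by (auto split: if_splits)
    moreover have "(Suc i' mod n + j') mod n = Suc (i' + j') mod n" "(i' + Suc j' mod n) mod n = Suc (i' + j') mod n"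
      by (simp_all add: mod_add_left_eq mod_add_right_eq)
    ultimately show "tensor_degree n U V (Suc i mod n) (tensor_shift n U V (tensor_vec v w)) =
      tensor_shift n U V (tensor_degree n U V i (tensor_vec v w))"
      by (simp add: tensor_shift_tensor lin_add [OF lind] deg [OF v w] deg [OF v homogeneous_shift(1) [OF V w]]
        deg [OF homogeneous_shift(1) [OF U v] w] lin_0 [OF linT])
  qed
qed

text \<open>At length 1 both binomial weights are 1, which leaves the Leibniz rule.\<close>

lemma shift_tensor:
  fixes U :: "('a, 'k::field_char_0) comodule" and V :: "('b, 'k) comodule"
  assumes U: "fd_comodule n U" and V: "fd_comodule n V" and v: "v \<in> vectors U" and w: "w \<in> vectors V"
  shows "shift n (tensor_comodule n 1 U V) (tensor_vec v w) = tensor_vec (shift n U v) w + tensor_vec v (shift n V w)"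
  unfolding tensor_shift_tensor [symmetric]
proof (rule tensor_lin_eqI [OF U V lin_shift' lin_tensor_shift tensor_in_free_space [OF v w]])
  fix i j v w assume v: "homogeneous n U i v" and w: "homogeneous n V j w"
  then have n: "n > 0" by (auto simp: homogeneous_def)
  have "shift n (tensor_comodule n 1 U V) (tensor_vec v w) =
    (\<Sum>k<n. if k = (i + j) mod n then tensor_vec v (shift n V w) + tensor_vec (shift n U v) w else 0)"
    unfolding shift_def [of n "tensor_comodule n 1 U V"] act_tensor_homogeneous [OF U V v w]
    using homogeneous_shift(2) [OF U v] homogeneous_shift(2) [OF V w] v w
    by (simp add: homogeneous_def)
  then show "shift n (tensor_comodule n 1 U V) (tensor_vec v w) = tensor_shift n U V (tensor_vec v w)"
    using n by (simp add: tensor_shift_tensor add.commute)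
qed

lemma degree_tensor_homogeneous:
  fixes U :: "('a, 'k::field_char_0) comodule" and V :: "('b, 'k) comodule"
  assumes U: "fd_comodule n U" and V: "fd_comodule n V"
    and v: "homogeneous n U i v" and w: "homogeneous n V j w"
  shows "act (tensor_comodule n 1 U V) (k, 0) (tensor_vec v w) = (if k = (i + j) mod n then tensor_vec v w else 0)"
  unfolding act_tensor_homogeneous [OF U V v w] using v w by (simp add: homogeneous_def)

lemma homogeneous_tensor:
  fixes U :: "('a, 'k::field_char_0) comodule" and V :: "('b, 'k) comodule"
  assumes U: "fd_comodule n U" and V: "fd_comodule n V"
    and v: "homogeneous n U i v" and w: "homogeneous n V j w"
  shows "homogeneous n (tensor_comodule n 1 U V) ((i + j) mod n) (tensor_vec v w)"
  using degree_tensor_homogeneous [OF assms] tensor_in_free_space [OF homogeneous_in [OF v] homogeneous_in [OF w]]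
    homogeneous_less [OF v]
  by (simp add: homogeneous_def)

subsection \<open>Isomorphisms between tensor products\<close>

lemma homogeneous_act_eq:
  assumes "fd_comodule n U" "homogeneous n U i v"
  shows "act U (k, 0) v = (if k = i then v else 0)"
  using homogeneous_act [OF assms] assms(2) by (simp add: homogeneous_def)

text \<open>A comodule map out of a tensor product is recognised on homogeneous pure tensors: it has
  to add degrees and to satisfy the Leibniz rule.\<close>

lemma tensor_isoI:
  fixes U :: "('a, 'k::field_char_0) comodule" and V :: "('b, 'k) comodule" and W :: "('c, 'k) comodule"
  assumes U: "fd_comodule n U" and V: "fd_comodule n V" and W: "fd_comodule n W" and n: "n > 0"
    and lin: "lin F" "lin G"
    and F_in: "\<And>a b. a \<in> basis U \<Longrightarrow> b \<in> basis V \<Longrightarrow> F (basis_vec (a, b)) \<in> vectors W"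
    and G_in: "\<And>c. c \<in> basis W \<Longrightarrow> G (basis_vec c) \<in> free_space (basis U \<times> basis V)"
    and GF: "\<And>a b. a \<in> basis U \<Longrightarrow> b \<in> basis V \<Longrightarrow> G (F (basis_vec (a, b))) = basis_vec (a, b)"
    and FG: "\<And>c. c \<in> basis W \<Longrightarrow> F (G (basis_vec c)) = basis_vec c"
    and hom: "\<And>i j v w. homogeneous n U i v \<Longrightarrow> homogeneous n V j w \<Longrightarrow>
      homogeneous n W ((i + j) mod n) (F (tensor_vec v w))"
    and shift: "\<And>i j v w. homogeneous n U i v \<Longrightarrow> homogeneous n V j w \<Longrightarrow>
      shift n W (F (tensor_vec v w)) = F (tensor_vec (shift n U v) w) + F (tensor_vec v (shift n V w))"
  shows "comodule_iso (tensor_comodule n 1 U V) W" (is "comodule_iso ?T W")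
proof (rule comodule_isoI [OF fd_tensor [OF U V n] W lin])
  fix x assume "x \<in> basis ?T"
  then obtain a b where x: "x = (a, b)" "a \<in> basis U" "b \<in> basis V" by auto
  show "F (basis_vec x) \<in> vectors W" "G (F (basis_vec x)) = basis_vec x"
    using F_in GF x by auto
  have x_in: "(basis_vec x :: _ \<Rightarrow>\<^sub>0 'k) \<in> free_space (basis U \<times> basis V)" using x by simp
  show "F (act ?T (k, 0) (basis_vec x)) = act W (k, 0) (F (basis_vec x))" for k
  proof (rule tensor_lin_eqI [OF U V lin_compose [OF lin(1) lin_act'] lin_compose [OF lin_act' lin(1)] x_in])
    fix i j v w assume v: "homogeneous n U i v" and w: "homogeneous n V j w"
    show "F (act ?T (k, 0) (tensor_vec v w)) = act W (k, 0) (F (tensor_vec v w))"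
      unfolding degree_tensor_homogeneous [OF U V v w] homogeneous_act_eq [OF W hom [OF v w]]
      by (simp add: lin_0 [OF lin(1)])
  qed
  show "F (shift n ?T (basis_vec x)) = shift n W (F (basis_vec x))"
  proof (rule tensor_lin_eqI [OF U V lin_compose [OF lin(1) lin_shift'] lin_compose [OF lin_shift' lin(1)] x_in])
    fix i j v w assume v: "homogeneous n U i v" and w: "homogeneous n V j w"
    show "F (shift n ?T (tensor_vec v w)) = shift n W (F (tensor_vec v w))"
      unfolding shift_tensor [OF U V homogeneous_in [OF v] homogeneous_in [OF w]] shift [OF v w]
      by (rule lin_add [OF lin(1)])
  qed
next
  fix c assume c: "c \<in> basis W"
  show "G (basis_vec c) \<in> vectors ?T" "F (G (basis_vec c)) = basis_vec c"
    using G_in FG c by auto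
qed

lemma iso_maps_shift:
  assumes "iso_maps U V F G" "v \<in> vectors U"
  shows "F (shift n U v) = shift n V (F v)"
  unfolding shift_def lin_sum [OF iso_maps_lin(1) [OF assms(1)]] iso_maps_act [OF assms] ..

lemma iso_maps_homogeneous:
  assumes "iso_maps U V F G" "homogeneous n U i v"
  shows "homogeneous n V i (F v)"
  using iso_maps_act [OF assms(1) homogeneous_in [OF assms(2)], of "(i, 0)", symmetric]
    iso_maps_in(1) [OF assms(1)] assms(2)
  by (simp add: homogeneous_def)

text \<open>Makes the product of isomorphism classes independent of the representatives.\<close>

lemma tensor_iso:
  fixes U :: "('a, 'k::field_char_0) comodule" and V :: "('b, 'k) comodule"
    and U' :: "('c, 'k) comodule" and V' :: "('d, 'k) comodule"
  assumes fd: "fd_comodule n U" "fd_comodule n V" "fd_comodule n U'" "fd_comodule n V'" and n: "n > 0"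
    and iso: "comodule_iso U U'" "comodule_iso V V'"
  shows "comodule_iso (tensor_comodule n 1 U V) (tensor_comodule n 1 U' V')"
proof -
  obtain F G F' G' where 1: "iso_maps U U' F G" and 2: "iso_maps V V' F' G'"
    using iso unfolding comodule_iso_iff by blast
  note lin = iso_maps_lin [OF 1] iso_maps_lin [OF 2]
  note F = tmap_tensor [OF lin(1,3)] and G = tmap_tensor [OF lin(2,4)]
  show ?thesis
  proof (rule tensor_isoI [OF fd(1,2) fd_tensor [OF fd(3,4) n] n lin_tmap lin_tmap])
    fix a b assume a: "a \<in> basis U" and b: "b \<in> basis V"
    have ab: "(basis_vec a :: _ \<Rightarrow>\<^sub>0 'k) \<in> vectors U" "(basis_vec b :: _ \<Rightarrow>\<^sub>0 'k) \<in> vectors V" using a b by simp_all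
    show "tmap F F' (basis_vec (a, b)) \<in> vectors (tensor_comodule n 1 U' V')"
      unfolding tensor_basis [symmetric] F basis_tensor_comodule
      by (intro tensor_in_free_space iso_maps_in(1) [OF 1] iso_maps_in(1) [OF 2] ab)
    show "tmap G G' (tmap F F' (basis_vec (a, b))) = basis_vec (a, b)"
      unfolding tensor_basis [symmetric] F G iso_maps_inverse(1) [OF 1 ab(1)] iso_maps_inverse(1) [OF 2 ab(2)] ..
  next
    fix c assume "c \<in> basis (tensor_comodule n 1 U' V')"
    then obtain a b where c: "c = (a, b)" "a \<in> basis U'" "b \<in> basis V'" by auto
    have ab: "(basis_vec a :: _ \<Rightarrow>\<^sub>0 'k) \<in> vectors U'" "(basis_vec b :: _ \<Rightarrow>\<^sub>0 'k) \<in> vectors V'" using c by simp_all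
    show "tmap G G' (basis_vec c) \<in> free_space (basis U \<times> basis V)"
      unfolding c tensor_basis [symmetric] G
      by (intro tensor_in_free_space iso_maps_in(2) [OF 1] iso_maps_in(2) [OF 2] ab)
    show "tmap F F' (tmap G G' (basis_vec c)) = basis_vec c"
      unfolding c tensor_basis [symmetric] F G iso_maps_inverse(2) [OF 1 ab(1)] iso_maps_inverse(2) [OF 2 ab(2)] ..
  next
    fix i j v w assume v: "homogeneous n U i v" and w: "homogeneous n V j w"
    note v' = iso_maps_homogeneous [OF 1 v] and w' = iso_maps_homogeneous [OF 2 w]
    show "homogeneous n (tensor_comodule n 1 U' V') ((i + j) mod n) (tmap F F' (tensor_vec v w))"
      unfolding F by (rule homogeneous_tensor [OF fd(3,4) v' w'])
    show "shift n (tensor_comodule n 1 U' V') (tmap F F' (tensor_vec v w)) =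
      tmap F F' (tensor_vec (shift n U v) w) + tmap F F' (tensor_vec v (shift n V w))"
      unfolding F shift_tensor [OF fd(3,4) homogeneous_in [OF v'] homogeneous_in [OF w']]
        iso_maps_shift [OF 1 homogeneous_in [OF v]] iso_maps_shift [OF 2 homogeneous_in [OF w]] ..
  qed
qed

lemma act_outl: "act U p (outl_vec v) = outl_vec (act (direct_sum U V) p v)"
  and act_outr: "act V p (outr_vec v) = outr_vec (act (direct_sum U V) p v)"
proof -
  have "act (direct_sum U V) p v = act (direct_sum U V) p (inl_vec (outl_vec v) + inr_vec (outr_vec v))"
    by (simp add: inl_inr_split)
  also have "\<dots> = inl_vec (act U p (outl_vec v)) + inr_vec (act V p (outr_vec v))"
    by (simp only: lin_add [OF lin_act'] act_inl act_inr)
  finally have *: "act (direct_sum U V) p v = inl_vec (act U p (outl_vec v)) + inr_vec (act V p (outr_vec v))" .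
  show "act U p (outl_vec v) = outl_vec (act (direct_sum U V) p v)"
    "act V p (outr_vec v) = outr_vec (act (direct_sum U V) p v)"
    unfolding * by (simp_all add: lin_add [OF lin_in_out(3)] lin_add [OF lin_in_out(4)])
qed

lemma shift_in_out:
  "shift n (direct_sum U V) (inl_vec u) = inl_vec (shift n U u)"
  "shift n (direct_sum U V) (inr_vec w) = inr_vec (shift n V w)"
  "shift n U (outl_vec v) = outl_vec (shift n (direct_sum U V) v)"
  "shift n V (outr_vec v) = outr_vec (shift n (direct_sum U V) v)"
  unfolding shift_def act_inl act_inr act_outl [of U _ _ V] act_outr [of V _ _ U]
    lin_sum [OF lin_in_out(1)] lin_sum [OF lin_in_out(2)] lin_sum [OF lin_in_out(3)] lin_sum [OF lin_in_out(4)]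
  by (rule refl)+

lemma homogeneous_out:
  assumes "homogeneous n (direct_sum U V) i v"
  shows "homogeneous n U i (outl_vec v)" "homogeneous n V i (outr_vec v)"
  using assms unfolding homogeneous_def act_outl [of U _ _ V] act_outr [of V _ _ U]
  using outl_in [of v U V] outr_in [of v U V] by simp_all

lemma homogeneous_in_sum:
  assumes "homogeneous n U i u" "homogeneous n V i w"
  shows "homogeneous n (direct_sum U V) i (inl_vec u + inr_vec w)"
  using assms unfolding homogeneous_def
  by (simp add: lin_add [OF lin_act'] act_inl act_inr free_space_add inl_in inr_in)

section \<open>Distributivity and associativity of the tensor product\<close>

lemma tensor_sum_distrib_right:
  fixes A :: "('a, 'k::field_char_0) comodule" and B :: "('b, 'k) comodule" and V :: "('c, 'k) comodule"
  assumes A: "fd_comodule n A" and B: "fd_comodule n B" and V: "fd_comodule n V" and n: "n > 0"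
  shows "comodule_iso (tensor_comodule n 1 (direct_sum A B) V)
    (direct_sum (tensor_comodule n 1 A V) (tensor_comodule n 1 B V))" (is "comodule_iso _ ?W")
proof -
  define F :: "(('a + 'b) \<times> 'c \<Rightarrow>\<^sub>0 'k) \<Rightarrow> ('a \<times> 'c + 'b \<times> 'c \<Rightarrow>\<^sub>0 'k)" where
    "F = lin_extend (\<lambda>(s, c). case s of Inl a \<Rightarrow> basis_vec (Inl (a, c)) | Inr b \<Rightarrow> basis_vec (Inr (b, c)))"
  define G :: "('a \<times> 'c + 'b \<times> 'c \<Rightarrow>\<^sub>0 'k) \<Rightarrow> (('a + 'b) \<times> 'c \<Rightarrow>\<^sub>0 'k)" where
    "G = lin_extend (case_sum (\<lambda>(a, c). basis_vec (Inl a, c)) (\<lambda>(b, c). basis_vec (Inr b, c)))"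
  have lin: "lin F" "lin G" unfolding F_def G_def by (rule lin_lin_extend')+
  have F: "F (tensor_vec v w) = inl_vec (tensor_vec (outl_vec v) w) + inr_vec (tensor_vec (outr_vec v) w)" for v w
  proof (rule bilinear_ext [where v = v and w = w])
    fix s c
    show "F (tensor_vec (basis_vec s) (basis_vec c)) =
      inl_vec (tensor_vec (outl_vec (basis_vec s)) (basis_vec c)) + inr_vec (tensor_vec (outr_vec (basis_vec s)) (basis_vec c))"
      by (cases s) (simp_all add: F_def lin_0 [OF lin_in_out(1)] lin_0 [OF lin_in_out(2)])
  qed (unfold F_def, (intro lin_intros)+)
  show ?thesis
  proof (rule tensor_isoI [OF fd_direct_sum [OF A B] V fd_direct_sum [OF fd_tensor [OF A V n] fd_tensor [OF B V n]] n lin])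
    fix i j v w assume v: "homogeneous n (direct_sum A B) i v" and w: "homogeneous n V j w"
    note v' = homogeneous_out [OF v]
    show "homogeneous n ?W ((i + j) mod n) (F (tensor_vec v w))"
      unfolding F by (intro homogeneous_in_sum homogeneous_tensor A B V v' w)
    show "shift n ?W (F (tensor_vec v w)) = F (tensor_vec (shift n (direct_sum A B) v) w) + F (tensor_vec v (shift n V w))"
      unfolding F lin_add [OF lin_shift'] shift_in_out(1,2)
        shift_tensor [OF A V homogeneous_in [OF v'(1)] homogeneous_in [OF w]]
        shift_tensor [OF B V homogeneous_in [OF v'(2)] homogeneous_in [OF w]]
        shift_in_out(3) [of n A v B] shift_in_out(4) [of n B v A] lin_add [OF lin_in_out(1)] lin_add [OF lin_in_out(2)]
      by (simp only: add_ac)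
  qed (auto simp: F_def G_def basis_direct_sum)
qed

lemma tensor_sum_distrib_left:
  fixes A :: "('a, 'k::field_char_0) comodule" and B :: "('b, 'k) comodule" and V :: "('c, 'k) comodule"
  assumes A: "fd_comodule n A" and B: "fd_comodule n B" and V: "fd_comodule n V" and n: "n > 0"
  shows "comodule_iso (tensor_comodule n 1 V (direct_sum A B))
    (direct_sum (tensor_comodule n 1 V A) (tensor_comodule n 1 V B))" (is "comodule_iso _ ?W")
proof -
  define F :: "('c \<times> ('a + 'b) \<Rightarrow>\<^sub>0 'k) \<Rightarrow> ('c \<times> 'a + 'c \<times> 'b \<Rightarrow>\<^sub>0 'k)" where
    "F = lin_extend (\<lambda>(c, s). case s of Inl a \<Rightarrow> basis_vec (Inl (c, a)) | Inr b \<Rightarrow> basis_vec (Inr (c, b)))"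
  define G :: "('c \<times> 'a + 'c \<times> 'b \<Rightarrow>\<^sub>0 'k) \<Rightarrow> ('c \<times> ('a + 'b) \<Rightarrow>\<^sub>0 'k)" where
    "G = lin_extend (case_sum (\<lambda>(c, a). basis_vec (c, Inl a)) (\<lambda>(c, b). basis_vec (c, Inr b)))"
  have lin: "lin F" "lin G" unfolding F_def G_def by (rule lin_lin_extend')+
  have F: "F (tensor_vec w v) = inl_vec (tensor_vec w (outl_vec v)) + inr_vec (tensor_vec w (outr_vec v))" for v w
  proof (rule bilinear_ext [where v = w and w = v])
    fix s c
    show "F (tensor_vec (basis_vec c) (basis_vec s)) =
      inl_vec (tensor_vec (basis_vec c) (outl_vec (basis_vec s))) + inr_vec (tensor_vec (basis_vec c) (outr_vec (basis_vec s)))"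
      by (cases s) (simp_all add: F_def lin_0 [OF lin_in_out(1)] lin_0 [OF lin_in_out(2)])
  qed (unfold F_def, (intro lin_intros)+)
  show ?thesis
  proof (rule tensor_isoI [OF V fd_direct_sum [OF A B] fd_direct_sum [OF fd_tensor [OF V A n] fd_tensor [OF V B n]] n lin])
    fix i j w v assume w: "homogeneous n V i w" and v: "homogeneous n (direct_sum A B) j v"
    note v' = homogeneous_out [OF v]
    show "homogeneous n ?W ((i + j) mod n) (F (tensor_vec w v))"
      unfolding F by (intro homogeneous_in_sum homogeneous_tensor A B V v' w)
    show "shift n ?W (F (tensor_vec w v)) = F (tensor_vec (shift n V w) v) + F (tensor_vec w (shift n (direct_sum A B) v))"
      unfolding F lin_add [OF lin_shift'] shift_in_out(1,2)
        shift_tensor [OF V A homogeneous_in [OF w] homogeneous_in [OF v'(1)]]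
        shift_tensor [OF V B homogeneous_in [OF w] homogeneous_in [OF v'(2)]]
        shift_in_out(3) [of n A v B] shift_in_out(4) [of n B v A] lin_add [OF lin_in_out(1)] lin_add [OF lin_in_out(2)]
      by (simp only: add_ac)
  qed (auto simp: F_def G_def basis_direct_sum)
qed

lemma tensor_assoc:
  fixes A :: "('a, 'k::field_char_0) comodule" and B :: "('b, 'k) comodule" and C :: "('c, 'k) comodule"
  assumes A: "fd_comodule n A" and B: "fd_comodule n B" and C: "fd_comodule n C" and n: "n > 0"
  shows "comodule_iso (tensor_comodule n 1 (tensor_comodule n 1 A B) C)
    (tensor_comodule n 1 A (tensor_comodule n 1 B C))" (is "comodule_iso ?L ?R")
proof -
  define F :: "(('a \<times> 'b) \<times> 'c \<Rightarrow>\<^sub>0 'k) \<Rightarrow> ('a \<times> 'b \<times> 'c \<Rightarrow>\<^sub>0 'k)" where "F = lin_extend assoc_map"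
  define G :: "('a \<times> 'b \<times> 'c \<Rightarrow>\<^sub>0 'k) \<Rightarrow> (('a \<times> 'b) \<times> 'c \<Rightarrow>\<^sub>0 'k)" where
    "G = lin_extend (\<lambda>(a, b, c). basis_vec ((a, b), c))"
  have lin: "lin F" "lin G" unfolding F_def G_def by (rule lin_lin_extend')+
  have F: "F (tensor_vec (tensor_vec u v) w) = tensor_vec u (tensor_vec v w)" for u v w
  proof -
    have "F (tensor_vec (tensor_vec (basis_vec a) v) w) = tensor_vec (basis_vec a) (tensor_vec v w)" for a
    proof (rule bilinear_ext [where v = v and w = w])
      show "F (tensor_vec (tensor_vec (basis_vec a) (basis_vec b)) (basis_vec c)) =
        tensor_vec (basis_vec a) (tensor_vec (basis_vec b) (basis_vec c))" for b c
        by (simp add: F_def assoc_map_def)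
    qed (intro lin_compose [OF lin(1)] lin_tensor_left lin_tensor_right lin_id)+
    then show ?thesis
      by (rule lin_ext [OF lin_compose [OF lin(1) lin_tensor_left [OF lin_tensor_left [OF lin_id]]]
        lin_tensor_left [OF lin_id]])
  qed
  note AB = fd_tensor [OF A B n] and BC = fd_tensor [OF B C n]
  \<comment> \<open>Homogeneous pure tensors of three factors suffice: the left pair is reduced
    first, then the third vector.\<close>
  have tri: "H (tensor_vec (tensor_vec u v) w) = K (tensor_vec (tensor_vec u v) w)"
    if "lin H" "lin K" "u \<in> vectors A" "v \<in> vectors B" "w \<in> vectors C"
      and hom: "\<And>i j k u v w. homogeneous n A i u \<Longrightarrow> homogeneous n B j v \<Longrightarrow> homogeneous n C k w \<Longrightarrow>
        H (tensor_vec (tensor_vec u v) w) = K (tensor_vec (tensor_vec u v) w)"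
    for H K :: "(('a \<times> 'b) \<times> 'c \<Rightarrow>\<^sub>0 'k) \<Rightarrow> ('a \<times> 'b \<times> 'c \<Rightarrow>\<^sub>0 'k)" and u v w
  proof (rule tensor_lin_eqI [OF A B, of "\<lambda>t. H (tensor_vec t w)" "\<lambda>t. K (tensor_vec t w)"])
    show "lin (\<lambda>t. H (tensor_vec t w))" "lin (\<lambda>t. K (tensor_vec t w))"
      by (rule lin_compose [OF that(1) lin_tensor_left [OF lin_id]], rule lin_compose [OF that(2) lin_tensor_left [OF lin_id]])
    show "tensor_vec u v \<in> free_space (basis A \<times> basis B)" by (rule tensor_in_free_space [OF that(3,4)])
    fix i j u v assume uv: "homogeneous n A i u" "homogeneous n B j v"
    show "H (tensor_vec (tensor_vec u v) w) = K (tensor_vec (tensor_vec u v) w)"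
      by (rule homogeneous_eqI [OF C lin_compose [OF that(1) lin_tensor_right [OF lin_id]]
        lin_compose [OF that(2) lin_tensor_right [OF lin_id]] that(5) hom [OF uv]])
  qed
  show ?thesis
  proof (rule comodule_isoI [OF fd_tensor [OF AB C n] fd_tensor [OF A BC n] lin])
    fix x assume "x \<in> basis ?L"
    then obtain a b c where x: "x = ((a, b), c)" "a \<in> basis A" "b \<in> basis B" "c \<in> basis C" by auto
    show "F (basis_vec x) \<in> vectors ?R" "G (F (basis_vec x)) = basis_vec x"
      using x by (simp_all add: F_def G_def assoc_map_def)
    have xt: "basis_vec x = (tensor_vec (tensor_vec (basis_vec a) (basis_vec b)) (basis_vec c) :: _ \<Rightarrow>\<^sub>0 'k)"
      by (simp add: x)
    have e: "(basis_vec a :: _ \<Rightarrow>\<^sub>0 'k) \<in> vectors A" "(basis_vec b :: _ \<Rightarrow>\<^sub>0 'k) \<in> vectors B" "(basis_vec c :: _ \<Rightarrow>\<^sub>0 'k) \<in> vectors C"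
      using x by simp_all
    show "F (act ?L (m, 0) (basis_vec x)) = act ?R (m, 0) (F (basis_vec x))" for m
      unfolding xt
    proof (rule tri [OF lin_compose [OF lin(1) lin_act'] lin_compose [OF lin_act' lin(1)] e])
      fix i j k u v w
      assume u: "homogeneous n A i u" and v: "homogeneous n B j v" and w: "homogeneous n C k w"
      have "((i + j) mod n + k) mod n = (i + (j + k) mod n) mod n"
        by (simp add: mod_add_left_eq mod_add_right_eq add.assoc)
      then show "F (act ?L (m, 0) (tensor_vec (tensor_vec u v) w)) = act ?R (m, 0) (F (tensor_vec (tensor_vec u v) w))"
        unfolding F degree_tensor_homogeneous [OF AB C homogeneous_tensor [OF A B u v] w]
          degree_tensor_homogeneous [OF A BC u homogeneous_tensor [OF B C v w]]
        by (simp only: F lin_0 [OF lin(1)] if_distrib [of F])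
    qed
    show "F (shift n ?L (basis_vec x)) = shift n ?R (F (basis_vec x))"
      unfolding xt F shift_tensor [OF AB C, simplified, OF tensor_in_free_space [OF e(1,2)] e(3)]
        shift_tensor [OF A BC, simplified, OF e(1) tensor_in_free_space [OF e(2,3)]]
        shift_tensor [OF A B e(1,2)] shift_tensor [OF B C e(2,3)]
        tensor_add_left tensor_add_right lin_add [OF lin(1)] F
      by (simp only: add_ac)
  next
    fix x assume "x \<in> basis ?R"
    then obtain a b c where x: "x = (a, b, c)" "a \<in> basis A" "b \<in> basis B" "c \<in> basis C" by auto
    then show "G (basis_vec x) \<in> vectors ?L" "F (G (basis_vec x)) = basis_vec x"
      by (simp_all add: F_def G_def assoc_map_def)
  qed
qed

section \<open>Strings tensored with a point, an arrow and the unit\<close>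

lemma homogeneous_string:
  assumes "k \<le> l" "n > 0"
  shows "homogeneous n (string n i l) ((i + k) mod n) (basis_vec k :: nat \<Rightarrow>\<^sub>0 'k::field)"
  using assms by (simp add: homogeneous_def act_string)

text \<open>A comodule with a homogeneous basis along which \<open>shift\<close> moves step by step
  is a string. Here \<open>t\<close> lists that basis and \<open>G\<close> is the coordinate map
  inverse to it.\<close>

lemma string_isoI:
  fixes W :: "('a, 'k::field) comodule"
  assumes W: "fd_comodule n W" and n: "n > 0" and G: "lin G"
    and t: "\<And>k. k \<le> l \<Longrightarrow> homogeneous n W ((i + k) mod n) (t k)"
    and shift: "\<And>k. k \<le> l \<Longrightarrow> shift n W (t k) = (if k < l then t (Suc k) else 0)"
    and G_in: "\<And>c. c \<in> basis W \<Longrightarrow> G (basis_vec c) \<in> free_space {..l}"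
    and Gt: "\<And>k. k \<le> l \<Longrightarrow> G (t k) = basis_vec k"
    and tG: "\<And>c. c \<in> basis W \<Longrightarrow> lin_extend t (G (basis_vec c)) = basis_vec c"
  shows "comodule_iso (string n i l) W"
proof (rule comodule_isoI [OF fd_string [OF n] W lin_lin_extend' [of t] G])
  fix k assume "k \<in> basis (string n i l :: (nat, 'k) comodule)"
  then have k: "k \<le> l" by simp
  show "lin_extend t (basis_vec k) \<in> vectors W" using homogeneous_in [OF t [OF k]] by simp
  show "G (lin_extend t (basis_vec k)) = basis_vec k" using Gt [OF k] by simp
  show "lin_extend t (act (string n i l) (j, 0) (basis_vec k)) = act W (j, 0) (lin_extend t (basis_vec k))" for j
    using k by (simp add: act_string homogeneous_act_eq [OF W t [OF k]] lin_0 [OF lin_lin_extend'])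
  show "lin_extend t (shift n (string n i l) (basis_vec k)) = shift n W (lin_extend t (basis_vec k))"
    using shift [OF k] by (simp add: shift_string [OF k n] lin_0 [OF lin_lin_extend'])
qed (use G_in tG in auto)

text \<open>The same criterion with two chains, listed by the two summands of the index type of
  \<open>t\<close>.\<close>

lemma string_sum_isoI:
  fixes W :: "('a, 'k::field) comodule"
  assumes W: "fd_comodule n W" and n: "n > 0" and G: "lin G"
    and t: "\<And>k. k \<le> l \<Longrightarrow> homogeneous n W ((i + k) mod n) (t (Inl k))"
    and t': "\<And>k. k \<le> l' \<Longrightarrow> homogeneous n W ((i' + k) mod n) (t (Inr k))"
    and shift: "\<And>k. k \<le> l \<Longrightarrow> shift n W (t (Inl k)) = (if k < l then t (Inl (Suc k)) else 0)"
    and shift': "\<And>k. k \<le> l' \<Longrightarrow> shift n W (t (Inr k)) = (if k < l' then t (Inr (Suc k)) else 0)"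
    and G_in: "\<And>c. c \<in> basis W \<Longrightarrow> G (basis_vec c) \<in> free_space (Inl ` {..l} \<union> Inr ` {..l'})"
    and Gt: "\<And>k. k \<le> l \<Longrightarrow> G (t (Inl k)) = basis_vec (Inl k)" "\<And>k. k \<le> l' \<Longrightarrow> G (t (Inr k)) = basis_vec (Inr k)"
    and tG: "\<And>c. c \<in> basis W \<Longrightarrow> lin_extend t (G (basis_vec c)) = basis_vec c"
  shows "comodule_iso (direct_sum (string n i l) (string n i' l')) W" (is "comodule_iso (direct_sum ?A ?B) W")
proof (rule comodule_isoI [OF fd_direct_sum [OF fd_string [OF n] fd_string [OF n]] W lin_lin_extend' [of t] G])
  fix x assume "x \<in> basis (direct_sum (string n i l) (string n i' l') :: (nat + nat, 'k) comodule)"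
  then consider k where "x = Inl k" "k \<le> l" | k where "x = Inr k" "k \<le> l'"
    by (auto simp: basis_direct_sum)
  then have "lin_extend t (basis_vec x) \<in> vectors W \<and> G (lin_extend t (basis_vec x)) = basis_vec x \<and>
    (\<forall>j. lin_extend t (act (direct_sum ?A ?B) (j, 0) (basis_vec x)) = act W (j, 0) (lin_extend t (basis_vec x))) \<and>
    lin_extend t (shift n (direct_sum ?A ?B) (basis_vec x)) = shift n W (lin_extend t (basis_vec x))"
  proof cases
    case 1
    note k = 1(2)
    show ?thesis
      using homogeneous_in [OF t [OF k]] Gt(1) [OF k] shift [OF k]
        act_inl [of ?A ?B _ "basis_vec k"] shift_in_out(1) [of n ?A ?B "basis_vec k"]
      by (simp add: 1(1) act_string k shift_string n homogeneous_act_eq [OF W t [OF k]]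
          lin_0 [OF lin_lin_extend'] lin_0 [OF lin_in_out(1)])
  next
    case 2
    note k = 2(2)
    show ?thesis
      using homogeneous_in [OF t' [OF k]] Gt(2) [OF k] shift' [OF k]
        act_inr [of ?A ?B _ "basis_vec k"] shift_in_out(2) [of n ?A ?B "basis_vec k"]
      by (simp add: 2(1) act_string k shift_string n homogeneous_act_eq [OF W t' [OF k]]
          lin_0 [OF lin_lin_extend'] lin_0 [OF lin_in_out(2)])
  qed
  then show "lin_extend t (basis_vec x) \<in> vectors W" "G (lin_extend t (basis_vec x)) = basis_vec x"
    "lin_extend t (act (direct_sum ?A ?B) (j, 0) (basis_vec x)) = act W (j, 0) (lin_extend t (basis_vec x))"
    "lin_extend t (shift n (direct_sum ?A ?B) (basis_vec x)) = shift n W (lin_extend t (basis_vec x))" for j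
    by blast+
qed (use G_in tG in \<open>auto simp: basis_direct_sum\<close>)

context
  fixes n :: nat
  assumes n: "n > 0"
begin

lemma shift_tensor_string:
  assumes "a \<le> l" "k \<le> l'"
  shows "shift n (tensor_comodule n 1 (string n i l) (string n i' l')) (basis_vec (a, k)) =
    (if a < l then basis_vec (Suc a, k) else 0) + (if k < l' then basis_vec (a, Suc k) else 0 :: nat \<times> nat \<Rightarrow>\<^sub>0 'k::field_char_0)"
proof -
  have "shift n (tensor_comodule n 1 (string n i l) (string n i' l')) (tensor_vec (basis_vec a) (basis_vec k)) =
    (if a < l then basis_vec (Suc a, k) else 0) + (if k < l' then basis_vec (a, Suc k) else 0 :: nat \<times> nat \<Rightarrow>\<^sub>0 'k)"
    using assms by (subst shift_tensor [OF fd_string [OF n] fd_string [OF n]]) (simp_all add: shift_string n)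
  then show ?thesis by simp
qed

lemma homogeneous_tensor_string:
  assumes "a \<le> l" "k \<le> l'" and d: "(i + a + (i' + k)) mod n = d mod n"
  shows "homogeneous n (tensor_comodule n 1 (string n i l) (string n i' l')) (d mod n)
    (basis_vec (a, k) :: nat \<times> nat \<Rightarrow>\<^sub>0 'k::field_char_0)"
proof -
  have "((i + a) mod n + (i' + k) mod n) mod n = d mod n" using d by (simp add: mod_add_eq)
  then show ?thesis
    using homogeneous_tensor [OF fd_string [OF n] fd_string [OF n] homogeneous_string [OF assms(1) n] homogeneous_string [OF assms(2) n],
        of i i', where 'k = 'k] by simp
qed

lemma homogeneous_add: "homogeneous n U i v \<Longrightarrow> homogeneous n U i w \<Longrightarrow> homogeneous n U i (v + w)"
  by (simp add: homogeneous_def lin_add [OF lin_act'] free_space_add)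

lemma homogeneous_scale: "homogeneous n U i v \<Longrightarrow> homogeneous n U i (scale_vec c v)"
  by (simp add: homogeneous_def lin_scale [OF lin_act'] free_space_scale)

lemma homogeneous_zero: "i < n \<Longrightarrow> homogeneous n U i 0"
  by (simp add: homogeneous_def lin_0 [OF lin_act'])

text \<open>The point is one-dimensional, placed at the vertex 1 and killed by \<open>shift\<close>;
  tensoring with it leaves \<open>shift\<close> unchanged and raises every degree by 1.\<close>

lemma string_tensor_point:
  "comodule_iso (string n ((Suc i) mod n) l :: (nat, 'k::field_char_0) comodule)
    (tensor_comodule n 1 (string n 1 0) (string n i l))" (is "comodule_iso _ ?W")
proof (rule string_isoI [where t = "\<lambda>k. basis_vec (0, k)",
    OF fd_tensor [OF fd_string [OF n] fd_string [OF n] n] n lin_lin_extend' [of "\<lambda>(a, k). basis_vec k"]])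
  fix k assume k: "k \<le> l"
  have "(Suc i mod n + k) mod n = (Suc i + k) mod n" by (rule mod_add_left_eq)
  then show "homogeneous n ?W ((Suc i mod n + k) mod n) (basis_vec (0, k))"
    using homogeneous_tensor_string [of 0 0 k l 1 i "Suc i + k", where 'k = 'k] k by simp
  show "shift n ?W (basis_vec (0, k)) = (if k < l then basis_vec (0, Suc k) else 0)"
    using shift_tensor_string [of 0 0 k l 1 i, where 'k = 'k] k by simp
qed auto

lemma string_tensor_arrow_0:
  "comodule_iso (string n i 1 :: (nat, 'k::field_char_0) comodule)
    (tensor_comodule n 1 (string n 0 1) (string n i 0))" (is "comodule_iso _ ?W")
proof (rule string_isoI [where t = "\<lambda>a. basis_vec (a, 0)",
    OF fd_tensor [OF fd_string [OF n] fd_string [OF n] n] n lin_lin_extend' [of "\<lambda>(a, k). basis_vec a"]])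
  fix a :: nat assume a: "a \<le> 1"
  show "homogeneous n ?W ((i + a) mod n) (basis_vec (a, 0))"
    using homogeneous_tensor_string [of a 1 0 0 0 i "i + a", where 'k = 'k] a by (simp add: add.commute)
  show "shift n ?W (basis_vec (a, 0)) = (if a < 1 then basis_vec (Suc a, 0) else 0)"
    using shift_tensor_string [of a 1 0 0 0 i, where 'k = 'k] a by simp
qed auto

text \<open>The Clebsch-Gordan rule: \<open>T\<^sup>k(e\<^sub>0 \<otimes> f\<^sub>0) = e\<^sub>0 \<otimes> f\<^sub>k + k e\<^sub>1 \<otimes> f\<^sub>k\<^sub>-\<^sub>1\<close>, and
  \<open>e\<^sub>0 \<otimes> f\<^sub>1 - l e\<^sub>1 \<otimes> f\<^sub>0\<close> generates a complement.\<close>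

lemma string_tensor_arrow:
  "comodule_iso (direct_sum (string n i (Suc (Suc m))) (string n (Suc i mod n) m))
    (tensor_comodule n 1 (string n 0 1) (string n i (Suc m)) :: (nat \<times> nat, 'k::field_char_0) comodule)"
  (is "comodule_iso _ ?W")
proof -
  let ?l = "Suc m"
  define W where "W = ?W"
  have W: "fd_comodule n W" unfolding W_def by (rule fd_tensor [OF fd_string [OF n] fd_string [OF n] n])
  \<comment> \<open>These are the pure tensors of the vectors 0 and 1 of the arrow with the vector
    \<open>k\<close> of the string. They are 0 beyond the end, so that the rules
    \<open>shift_e\<close> and \<open>shift_f\<close> hold for every \<open>k\<close>.\<close>
  define e f :: "nat \<Rightarrow> (nat \<times> nat \<Rightarrow>\<^sub>0 'k)"
    where "e k = (if k \<le> ?l then basis_vec (0, k) else 0)" and "f k = (if k \<le> ?l then basis_vec (1, k) else 0)" for k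
  \<comment> \<open>Each application of \<open>shift\<close> adds 1 to the factor of
    \<open>f\<close>. The second chain starts with the factor \<open>- ?l\<close>; after
    \<open>?l\<close> steps the factor would be 0 and the \<open>e\<close> term is past the end, so
    the chain stops there. At \<open>k = 0\<close> the first chain has factor 0, which makes
    \<open>k - 1\<close> harmless.\<close>
  define t :: "nat + nat \<Rightarrow> (nat \<times> nat \<Rightarrow>\<^sub>0 'k)" where "t = case_sum
    (\<lambda>k. e k + scale_vec (of_nat k) (f (k - 1))) (\<lambda>k. e (Suc k) + scale_vec (of_nat k - of_nat ?l) (f k))"
  define a b :: "nat \<Rightarrow> (nat + nat \<Rightarrow>\<^sub>0 'k)"
    where "a k = basis_vec (Inl k)" and "b k = (if k \<le> m then basis_vec (Inr k) else 0)" for k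
  \<comment> \<open>The difference of \<open>t (Inl (k + 1))\<close> and \<open>t (Inr k)\<close> is
    \<open>f k\<close> times \<open>?l + 1\<close>. Solving for \<open>f k\<close>, and then for
    \<open>e k\<close>, gives the inverse \<open>g\<close>; it divides by \<open>?l + 1\<close>,
    which characteristic 0 permits.\<close>
  define c :: 'k where "c = 1 / of_nat (Suc ?l)"
  define g :: "nat \<times> nat \<Rightarrow> (nat + nat \<Rightarrow>\<^sub>0 'k)" where "g = (\<lambda>(s, k). if s = 0
    then a k - scale_vec (of_nat k * c) (a k - b (k - 1)) else scale_vec c (a (Suc k) - b k))"
  have c: "of_nat (Suc ?l) * c = 1" "c * of_nat (Suc ?l) = 1" by (simp_all add: c_def del: of_nat_Suc)
  have shift_e: "shift n W (e k) = f k + e (Suc k)" for k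
    unfolding W_def using shift_tensor_string [of 0 1 k ?l 0 i, where 'k = 'k] by (simp add: e_def f_def lin_0 [OF lin_shift'])
  have shift_f: "shift n W (f k) = f (Suc k)" for k
    unfolding W_def using shift_tensor_string [of 1 1 k ?l 0 i, where 'k = 'k] by (simp add: f_def lin_0 [OF lin_shift'])
  have hom_e: "homogeneous n W (d mod n) (e k)" if "(i + k) mod n = d mod n" for k d
    unfolding W_def using homogeneous_tensor_string [of 0 1 k ?l 0 i d, where 'k = 'k] that n by (simp add: e_def homogeneous_zero)
  have hom_f: "homogeneous n W (d mod n) (f k)" if "(Suc i + k) mod n = d mod n" for k d
    unfolding W_def using homogeneous_tensor_string [of 1 1 k ?l 0 i d, where 'k = 'k] that n by (simp add: f_def homogeneous_zero)
  have lg: "lin (lin_extend g)" and lt: "lin (lin_extend t)" by (rule lin_lin_extend')+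
  have ge: "lin_extend g (e k) = (if k \<le> ?l then a k - scale_vec (of_nat k * c) (a k - b (k - 1)) else 0)" for k
    by (simp add: e_def lin_0 [OF lg]) (simp add: g_def)
  have gf: "lin_extend g (f k) = (if k \<le> ?l then scale_vec c (a (Suc k) - b k) else 0)" for k
    by (simp add: f_def lin_0 [OF lg]) (simp add: g_def)
  have ta: "lin_extend t (a k) = e k + scale_vec (of_nat k) (f (k - 1))" for k
    by (simp add: a_def t_def)
  have tb: "lin_extend t (b k) = (if k \<le> m then e (Suc k) + scale_vec (of_nat k - of_nat ?l) (f k) else 0)" for k
    by (simp add: b_def lin_0 [OF lt]) (simp add: t_def)
  have bW: "basis W = {..1} \<times> {..?l}" by (simp add: W_def)
  have "comodule_iso (direct_sum (string n i (Suc ?l)) (string n (Suc i mod n) m)) W"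
  proof (rule string_sum_isoI [where t = t, OF W n lin_lin_extend' [of g]])
    fix k assume k: "k \<le> Suc ?l"
    show "homogeneous n W ((i + k) mod n) (t (Inl k))"
    proof (cases k)
      case 0
      then show ?thesis using hom_e [of k "i + k"] by (simp add: t_def)
    next
      case (Suc k')
      then show ?thesis
        unfolding t_def sum.case by (intro homogeneous_add homogeneous_scale hom_e hom_f) simp_all
    qed
    show "shift n W (t (Inl k)) = (if k < Suc ?l then t (Inl (Suc k)) else 0)"
    proof (cases k)
      case 0
      then show ?thesis by (simp add: t_def shift_e add.commute)
    next
      case (Suc k')
      have "shift n W (t (Inl k)) = (f k + e (Suc k)) + scale_vec (of_nat k) (f k)"
        by (simp add: t_def lin_add [OF lin_shift'] lin_scale [OF lin_shift'] shift_e shift_f Suc del: of_nat_Suc)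
      also have "\<dots> = e (Suc k) + scale_vec (of_nat (Suc k)) (f k)"
        by (simp add: vec.scale_left_distrib add_ac)
      finally have *: "shift n W (t (Inl k)) = e (Suc k) + scale_vec (of_nat (Suc k)) (f k)" .
      show ?thesis
      proof (cases "k < Suc ?l")
        case True
        then show ?thesis unfolding * by (simp add: t_def)
      next
        case False
        then have "e (Suc k) = 0" "f k = 0" by (simp_all add: e_def f_def)
        then show ?thesis unfolding * using False by simp
      qed
    qed
    show "lin_extend g (t (Inl k)) = basis_vec (Inl k)"
    proof -
      consider "k = 0" | "0 < k" "k \<le> ?l" | "k = Suc ?l" using k by linarith
      then show ?thesis
      proof cases
        case 1
        then show ?thesis by (simp add: t_def ge a_def)
      next
        case 2
        then obtain k' where k': "k = Suc k'" by (cases k) auto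
        then show ?thesis
          using 2 by (simp add: t_def lin_add [OF lg] lin_scale [OF lg] ge gf vec.scale_scale a_def del: of_nat_Suc)
      next
        case 3
        have "lin_extend g (t (Inl k)) = scale_vec (of_nat (Suc ?l) * c) (a k - b ?l)"
          by (simp add: 3 t_def lin_add [OF lg] lin_scale [OF lg] ge gf del: of_nat_Suc)
        then show ?thesis unfolding c(1) by (simp add: a_def b_def)
      qed
    qed
  next
    fix k assume k: "k \<le> m"
    have "(Suc i mod n + k) mod n = (Suc i + k) mod n" by (rule mod_add_left_eq)
    then show "homogeneous n W ((Suc i mod n + k) mod n) (t (Inr k))"
      unfolding t_def sum.case by (intro homogeneous_add homogeneous_scale hom_e hom_f) simp_all
    show "shift n W (t (Inr k)) = (if k < m then t (Inr (Suc k)) else 0)"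
    proof -
      have "shift n W (t (Inr k)) = (f (Suc k) + e (Suc (Suc k))) + scale_vec (of_nat k - of_nat ?l) (f (Suc k))"
        by (simp only: t_def sum.case lin_add [OF lin_shift'] lin_scale [OF lin_shift'] shift_e shift_f)
      also have "\<dots> = e (Suc (Suc k)) + scale_vec (of_nat (Suc k) - of_nat ?l) (f (Suc k))"
        by (simp add: vec.scale_left_distrib vec.scale_left_diff_distrib)
      finally have *: "shift n W (t (Inr k)) = e (Suc (Suc k)) + scale_vec (of_nat (Suc k) - of_nat ?l) (f (Suc k))" .
      show ?thesis
      proof (cases "k < m")
        case True
        then show ?thesis unfolding * by (simp add: t_def)
      next
        case False
        then have "k = m" using k by simp
        then show ?thesis unfolding * by (simp add: e_def)
      qed
    qed
    have "lin_extend g (t (Inr k)) = a (Suc k) - scale_vec (of_nat (Suc k) * c) (a (Suc k) - b k) +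
      scale_vec ((of_nat k - of_nat ?l) * c) (a (Suc k) - b k)"
      using k by (simp add: t_def lin_add [OF lg] lin_scale [OF lg] ge gf del: of_nat_Suc)
    also have "\<dots> = a (Suc k) - scale_vec ((of_nat (Suc k) - (of_nat k - of_nat ?l)) * c) (a (Suc k) - b k)"
      unfolding left_diff_distrib vec.scale_left_diff_distrib by simp
    also have "of_nat (Suc k) - (of_nat k - of_nat ?l) = (of_nat (Suc ?l) :: 'k)" by simp
    finally show "lin_extend g (t (Inr k)) = basis_vec (Inr k)"
      unfolding c(1) using k by (simp add: b_def)
  next
    fix x assume "x \<in> basis W"
    then obtain s k where x: "x = (s, k)" "s \<le> 1" "k \<le> ?l" by (auto simp: bW)
    have ab: "a k' \<in> free_space (Inl ` {..Suc ?l} \<union> Inr ` {..m})" if "k' \<le> Suc ?l" for k'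
      using that by (simp add: a_def)
    have bb: "b k' \<in> free_space (Inl ` {..Suc ?l} \<union> Inr ` {..m})" for k'
      by (simp add: b_def)
    show "lin_extend g (basis_vec x) \<in> free_space (Inl ` {..Suc ?l} \<union> Inr ` {..m})"
      using x(3) by (auto simp: x(1) g_def intro!: free_space_diff free_space_scale ab bb)
    have tab: "lin_extend t (a (Suc k') - b k') = scale_vec (of_nat (Suc ?l)) (f k')" if "k' \<le> ?l" for k'
    proof (cases "k' \<le> m")
      case True
      then have "lin_extend t (a (Suc k') - b k') = scale_vec (of_nat (Suc k') - (of_nat k' - of_nat ?l)) (f k')"
        by (simp add: lin_diff [OF lt] ta tb vec.scale_left_diff_distrib del: of_nat_Suc)
      also have "of_nat (Suc k') - (of_nat k' - of_nat ?l) = (of_nat (Suc ?l) :: 'k)" by simp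
      finally show ?thesis .
    next
      \<comment> \<open>At the end of the string \<open>b\<close> is 0 and the \<open>e\<close> term
        of the first chain has vanished, so its last vector alone is the required multiple of
        \<open>f\<close>.\<close>
      case False
      then have "k' = ?l" using that by simp
      then show ?thesis by (simp add: lin_diff [OF lt] ta tb del: of_nat_Suc) (simp add: e_def)
    qed
    consider "s = 0" "k = 0" | k' where "s = 0" "k = Suc k'" | "s = 1"
      using x(2) by (cases k; cases "s = 0") auto
    then show "lin_extend t (lin_extend g (basis_vec x)) = basis_vec x"
    proof cases
      case 1
      then show ?thesis by (simp add: x(1) g_def ta e_def)
    next
      case 2
      have "lin_extend t (lin_extend g (basis_vec x)) =
        e k + scale_vec (of_nat k) (f k') - scale_vec (of_nat k * c) (scale_vec (of_nat (Suc ?l)) (f k'))"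
        using x(3) 2 tab [of k'] ta [of k] by (simp add: x(1) g_def lin_diff [OF lt] lin_scale [OF lt] del: of_nat_Suc)
      also have "\<dots> = e k" by (simp only: vec.scale_scale mult.assoc c) simp
      finally show ?thesis using x(3) 2 by (simp add: e_def x(1))
    next
      case 3
      have "lin_extend t (lin_extend g (basis_vec x)) = scale_vec c (scale_vec (of_nat (Suc ?l)) (f k))"
        using x(3) 3 tab [of k] by (simp add: x(1) g_def lin_scale [OF lt] del: of_nat_Suc)
      also have "\<dots> = f k" by (simp only: vec.scale_scale c) simp
      finally show ?thesis using x(3) 3 by (simp add: f_def x(1))
    qed
  qed
  then show ?thesis unfolding W_def .
qed

lemma fd_unit: "fd_comodule n (unit_comodule :: (unit, 'k::field) comodule)"
  and string_unit_iso: "comodule_iso (string n 0 0) (unit_comodule :: (unit, 'k::field) comodule)"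
proof -
  let ?U = "unit_comodule :: (unit, 'k) comodule"
  have act: "act ?U (j, m) (basis_vec u) = (if j = 0 \<and> m = 0 then basis_vec u else 0)" for j m u
    by (simp add: act_basis unit_comodule_def path_unit_def slice_basis)
  have bU: "basis ?U = {()}" by (simp add: unit_comodule_def)
  have shift: "shift n ?U (basis_vec u) = 0" for u
    by (simp add: shift_def act)
  show fd: "fd_comodule n ?U"
    unfolding fd_comodule_iff
  proof (intro conjI ballI allI)
    fix b r s assume "b \<in> basis ?U"
    show "coact ?U b \<in> free_space (basis ?U \<times> paths n)"
      using n by (simp add: unit_comodule_def path_unit_def paths_def)
    show "act ?U r (act ?U s (basis_vec b)) =
       (if fst r = (fst s + snd s) mod n then act ?U (fst s, snd r + snd s) (basis_vec b) else 0)"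
      by (cases r; cases s) (auto simp: act lin_0 [OF lin_act'])
    show "(\<Sum>i<n. act ?U (i, 0) (basis_vec b)) = basis_vec b"
      using n by (simp add: act)
  qed (simp add: unit_comodule_def)
  show "comodule_iso (string n 0 0) ?U"
    by (rule string_isoI [where t = "\<lambda>_. basis_vec ()", OF fd n lin_lin_extend' [of "\<lambda>_. basis_vec 0"]])
      (use n in \<open>auto simp: homogeneous_def act shift bU\<close>)
qed

lemma tensor_unit_left:
  fixes V :: "('a, 'k::field_char_0) comodule"
  assumes V: "fd_comodule n V"
  shows "comodule_iso (tensor_comodule n 1 (string n 0 0) V) V"
proof -
  let ?S = "string n 0 0 :: (nat, 'k) comodule"
  define F :: "(nat \<times> 'a \<Rightarrow>\<^sub>0 'k) \<Rightarrow> ('a \<Rightarrow>\<^sub>0 'k)" where "F = lin_extend (\<lambda>(k, b). basis_vec b)"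
  define G :: "('a \<Rightarrow>\<^sub>0 'k) \<Rightarrow> (nat \<times> 'a \<Rightarrow>\<^sub>0 'k)" where "G = lin_extend (\<lambda>b. basis_vec (0, b))"
  have lin: "lin F" "lin G" unfolding F_def G_def by (rule lin_lin_extend')+
  have F: "F (tensor_vec (basis_vec k) w) = w" for k w
    by (rule lin_ext [OF lin_compose [OF lin(1) lin_tensor_right [OF lin_id]] lin_id]) (simp add: F_def)
  have S: "fd_comodule n ?S" by (rule fd_string [OF n])
  have e0: "homogeneous n ?S 0 (basis_vec 0)" using homogeneous_string [of 0 0 n 0] n by simp
  show ?thesis
  proof (rule comodule_isoI [OF fd_tensor [OF S V n] V lin])
    fix x assume "x \<in> basis (tensor_comodule n 1 ?S V)"
    then obtain b where x: "x = (0, b)" "b \<in> basis V" by auto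
    have xt: "basis_vec x = (tensor_vec (basis_vec 0) (basis_vec b) :: _ \<Rightarrow>\<^sub>0 'k)" by (simp add: x)
    have b: "(basis_vec b :: _ \<Rightarrow>\<^sub>0 'k) \<in> vectors V" using x by simp
    show "F (basis_vec x) \<in> vectors V" "G (F (basis_vec x)) = basis_vec x"
      using x by (simp_all add: F_def G_def)
    show "F (act (tensor_comodule n 1 ?S V) (m, 0) (basis_vec x)) = act V (m, 0) (F (basis_vec x))" for m
      unfolding xt F
    proof (rule homogeneous_eqI [OF V lin_compose [OF lin(1) lin_act [OF lin_tensor_right [OF lin_id]]] lin_act' b])
      fix j w assume w: "homogeneous n V j w"
      have "(0 + j) mod n = j" using homogeneous_less [OF w] by simp
      then show "F (act (tensor_comodule n 1 ?S V) (m, 0) (tensor_vec (basis_vec 0) w)) = act V (m, 0) w"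
        unfolding degree_tensor_homogeneous [OF S V e0 w] homogeneous_act_eq [OF V w]
        by (simp only: if_distrib [of F] F lin_0 [OF lin(1)])
    qed
    show "F (shift n (tensor_comodule n 1 ?S V) (basis_vec x)) = shift n V (F (basis_vec x))"
      unfolding xt shift_tensor [OF S V homogeneous_in [OF e0] b] F
      by (simp add: shift_string n F)
  next
    fix b assume "b \<in> basis V"
    then show "G (basis_vec b) \<in> vectors (tensor_comodule n 1 ?S V)" "F (G (basis_vec b)) = basis_vec b"
      by (simp_all add: F_def G_def)
  qed
qed

end

subsection \<open>Multiplicities of strings\<close>

definition graded_kernel :: "nat \<Rightarrow> ('a, 'k::field) comodule \<Rightarrow> nat \<Rightarrow> nat \<Rightarrow> ('a \<Rightarrow>\<^sub>0 'k) set" where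
  "graded_kernel n U i l = {v \<in> vectors U. act U (i, 0) v = v \<and> act U (i, l) v = 0}"

definition kernel_jump :: "nat \<Rightarrow> ('a, 'k::field) comodule \<Rightarrow> nat \<Rightarrow> nat \<Rightarrow> int" where
  "kernel_jump n U i l = int (vec.dim (graded_kernel n U i (Suc l))) - int (vec.dim (graded_kernel n U i l))"

text \<open>The jump at \<open>(i, l)\<close> counts the strings that visit the vertex \<open>i\<close> exactly \<open>l\<close> steps before
  their end. Those that do not start there visit the preceding vertex \<open>Suc l\<close> steps before their end.\<close>

definition multiplicity_of :: "nat \<Rightarrow> ('a, 'k::field) comodule \<Rightarrow> nat \<Rightarrow> nat \<Rightarrow> int" where
  "multiplicity_of n U i l = kernel_jump n U i l - kernel_jump n U ((i + (n - 1)) mod n) (Suc l)"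

lemma subspace_graded_kernel: "vec.subspace (graded_kernel n U i l)"
  by (auto simp: vec.subspace_def graded_kernel_def lin_0 [OF lin_act'] lin_add [OF lin_act']
    lin_scale [OF lin_act'] free_space_add free_space_scale)

lemma graded_kernel_map:
  assumes F: "iso_maps U V F G" and "v \<in> graded_kernel n U i l"
  shows "F v \<in> graded_kernel n V i l"
proof -
  have v: "v \<in> vectors U" "act U (i, 0) v = v" "act U (i, l) v = 0"
    using assms(2) by (auto simp: graded_kernel_def)
  show ?thesis
    using iso_maps_in(1) [OF F v(1)] iso_maps_act [OF F v(1), symmetric] v(2,3)
    by (simp add: graded_kernel_def lin_0 [OF iso_maps_lin(1) [OF F]])
qed

lemma dim_graded_kernel_iso:
  assumes U: "fd_comodule n U" and "comodule_iso U V"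
  shows "vec.dim (graded_kernel n U i l) = vec.dim (graded_kernel n V i l)"
proof -
  obtain F G where FG: "iso_maps U V F G" using assms(2) unfolding comodule_iso_iff by blast
  note GF = iso_maps_sym [OF U FG]
  have "F ` graded_kernel n U i l = graded_kernel n V i l"
  proof safe
    show "F v \<in> graded_kernel n V i l" if "v \<in> graded_kernel n U i l" for v
      by (rule graded_kernel_map [OF FG that])
    show "w \<in> F ` graded_kernel n U i l" if w: "w \<in> graded_kernel n V i l" for w
    proof -
      have "F (G w) = w" using w iso_maps_inverse(2) [OF FG] by (simp add: graded_kernel_def)
      then show ?thesis using imageI [OF graded_kernel_map [OF GF w], of F] by simp
    qed
  qed
  moreover have "inj_on F (graded_kernel n U i l)"
    by (rule inj_on_inverseI [where g = G]) (simp add: graded_kernel_def iso_maps_inverse(1) [OF FG])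
  ultimately show ?thesis
    using dim_injective_image [OF iso_maps_lin(1) [OF FG] subspace_graded_kernel, of n U i l] by simp
qed

text \<open>The action is componentwise, so the graded kernel of a sum consists of the sums of
  vectors from the two graded kernels.\<close>

lemma dim_graded_kernel_sum:
  fixes U :: "('a, 'k::field) comodule" and V :: "('b, 'k) comodule"
  assumes U: "fd_comodule n U" and V: "fd_comodule n V"
  shows "vec.dim (graded_kernel n (direct_sum U V) i l) =
    vec.dim (graded_kernel n U i l) + vec.dim (graded_kernel n V i l)"
proof -
  have "graded_kernel n (direct_sum U V) i l =
    {inl_vec u + inr_vec v | u v. u \<in> graded_kernel n U i l \<and> v \<in> graded_kernel n V i l}" (is "?L = ?R")
  proof
    show "?L \<subseteq> ?R"
    proof
      fix x assume x: "x \<in> ?L"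
      have "outl_vec x \<in> graded_kernel n U i l" "outr_vec x \<in> graded_kernel n V i l"
        using x outl_in [of x U V] outr_in [of x U V]
        by (simp_all add: graded_kernel_def act_outl [of U _ _ V] act_outr [of V _ _ U] lin_0 [OF lin_in_out(3)] lin_0 [OF lin_in_out(4)])
      then show "x \<in> ?R" using inl_inr_split [of x, symmetric] by blast
    qed
    show "?R \<subseteq> ?L"
      by (auto simp: graded_kernel_def lin_add [OF lin_act'] act_inl act_inr lin_0 [OF lin_in_out(1)]
          lin_0 [OF lin_in_out(2)] intro!: free_space_add inl_in inr_in)
  qed
  moreover have "graded_kernel n U i l \<subseteq> vectors U" "graded_kernel n V i l \<subseteq> vectors V"
    by (auto simp: graded_kernel_def)
  ultimately show ?thesis
    using dim_inl_inr [OF fd_finite [OF U] _ fd_finite [OF V] _ subspace_graded_kernel subspace_graded_kernel]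
    by simp
qed

lemma multiplicity_iso:
  assumes "fd_comodule n U" "comodule_iso U V"
  shows "multiplicity_of n U i l = multiplicity_of n V i l"
  unfolding multiplicity_of_def kernel_jump_def dim_graded_kernel_iso [OF assms] ..

lemma multiplicity_sum:
  "fd_comodule n U \<Longrightarrow> fd_comodule n V \<Longrightarrow>
    multiplicity_of n (direct_sum U V) i l = multiplicity_of n U i l + multiplicity_of n V i l"
  by (simp add: multiplicity_of_def kernel_jump_def dim_graded_kernel_sum)

lemma multiplicity_eventually_0:
  assumes "fd_comodule n U"
  obtains N where "\<And>i l. l \<ge> N \<Longrightarrow> multiplicity_of n U i l = 0"
proof -
  obtain N where N: "\<And>i l v. l \<ge> N \<Longrightarrow> v \<in> vectors U \<Longrightarrow> act U (i, l) v = 0"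
    using act_nilpotent [OF assms] by blast
  have "graded_kernel n U i (Suc l) = graded_kernel n U i l" if "l \<ge> N" for i l
    using N [of l] N [of "Suc l"] that by (auto simp: graded_kernel_def)
  then have "kernel_jump n U i l = 0" if "l \<ge> N" for i l
    using that by (simp add: kernel_jump_def)
  then show ?thesis using that [of N] by (simp add: multiplicity_of_def)
qed

lemma multiplicity_empty:
  assumes "basis U = {}"
  shows "multiplicity_of n U i l = 0"
proof -
  have "graded_kernel n U i l = free_space {}" for i l
    using assms by (auto simp: graded_kernel_def free_space_def lin_0 [OF lin_act'])
  then show ?thesis by (simp add: multiplicity_of_def kernel_jump_def)
qed

lemma coeff_act_string:
  assumes "v \<in> free_space {..m}"
  shows "coeff_at (act (string n j m) (i, l) v) b =
    (if l \<le> b \<and> b \<le> m \<and> i = (j + (b - l)) mod n then coeff_at v (b - l) else (0 :: 'k::field))"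
proof -
  let ?c = "l \<le> b \<and> b \<le> m \<and> i = (j + (b - l)) mod n"
  \<comment> \<open>The scalar identity is stated for multiples of \<open>basis_vec ()\<close>, so
    that it becomes an equality of linear maps and can be compared on basis vectors.\<close>
  have "scale_vec (coeff_at (act (string n j m) (i, l) v) b) (basis_vec ()) =
    (if ?c then scale_vec (coeff_at v (b - l)) (basis_vec ()) else (0 :: unit \<Rightarrow>\<^sub>0 'k))"
  proof (rule lin_eqI [OF lin_coeff [OF lin_act'] lin_if [OF lin_coeff [OF lin_id] lin_zero] assms])
    fix k assume "k \<in> {..m}"
    then have k: "k \<le> m" by simp
    show "scale_vec (coeff_at (act (string n j m) (i, l) (basis_vec k)) b) (basis_vec ()) =
      (if ?c then scale_vec (coeff_at (basis_vec k) (b - l)) (basis_vec ()) else (0 :: unit \<Rightarrow>\<^sub>0 'k))"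
      using k by (auto simp: act_string coeff_basis)
  qed
  from arg_cong [OF this, of "\<lambda>x. coeff_at x ()"] show ?thesis
    by (simp add: coeff_basis split: if_splits)
qed

lemma graded_kernel_string:
  assumes "i < n"
  shows "graded_kernel n (string n j m) i l =
    (free_space {k. k \<le> m \<and> (j + k) mod n = i \<and> m < k + l} :: (nat \<Rightarrow>\<^sub>0 'k::field) set)" (is "?L = free_space ?S")
proof
  show "?L \<subseteq> free_space ?S"
  proof
    fix v assume "v \<in> ?L"
    then have v: "v \<in> free_space {..m}" "act (string n j m) (i, 0) v = v" "act (string n j m) (i, l) v = 0"
      by (auto simp: graded_kernel_def)
    show "v \<in> free_space ?S"
      unfolding free_space_coeff
    proof (intro allI impI)
      fix k assume k: "k \<notin> ?S"
      show "coeff_at v k = 0"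
      proof (cases "k \<le> m \<and> (j + k) mod n = i")
        case True
        then have "k + l \<le> m" using k by auto
        then have "coeff_at (act (string n j m) (i, l) v) (k + l) = coeff_at v k"
          using True by (simp add: coeff_act_string [OF v(1)])
        then show ?thesis using v(3) by simp
      next
        case False
        then have "coeff_at (act (string n j m) (i, 0) v) k = 0"
          by (auto simp: coeff_act_string [OF v(1)])
        then show ?thesis unfolding v(2) .
      qed
    qed
  qed
  show "free_space ?S \<subseteq> ?L"
    unfolding span_basis [symmetric]
  proof (rule vec.span_minimal [OF _ subspace_graded_kernel], safe)
    fix k assume "k \<le> m" "m < k + l" "i = (j + k) mod n"
    then show "basis_vec k \<in> graded_kernel n (string n j m) ((j + k) mod n) l"
      by (simp add: graded_kernel_def act_string)
  qed
qed

text \<open>Passing from \<open>l\<close> to \<open>l + 1\<close> adds exactly the vector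
  \<open>l\<close> steps before the end, at position \<open>m - l\<close>, provided it lies in
  degree \<open>i\<close>.\<close>

lemma kernel_jump_string:
  assumes "i < n"
  shows "kernel_jump n (string n j m :: (nat, 'k::field) comodule) i l =
    (if l \<le> m \<and> (j + (m - l)) mod n = i then 1 else 0)"
proof -
  let ?S = "\<lambda>l. {k. k \<le> m \<and> (j + k) mod n = i \<and> m < k + l}"
  have "?S (Suc l) = ?S l \<union> (if l \<le> m \<and> (j + (m - l)) mod n = i then {m - l} else {})"
  proof (rule Set.set_eqI)
    fix k
    have "m < k + Suc l \<longleftrightarrow> m < k + l \<or> l \<le> m \<and> k = m - l" by linarith
    then show "k \<in> ?S (Suc l) \<longleftrightarrow> k \<in> ?S l \<union> (if l \<le> m \<and> (j + (m - l)) mod n = i then {m - l} else {})"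
      by auto
  qed
  moreover have "?S l \<inter> (if l \<le> m \<and> (j + (m - l)) mod n = i then {m - l} else {}) = {}" by auto
  ultimately have "card (?S (Suc l)) = card (?S l) + card (if l \<le> m \<and> (j + (m - l)) mod n = i then {m - l} else {})"
    by (simp only: card_Un_disjoint finite_Collect_conjI finite_Collect_le_nat) (simp add: card_Un_disjoint)
  then show ?thesis
    unfolding kernel_jump_def graded_kernel_string [OF assms] dim_free_space
    by (cases "l \<le> m \<and> (j + (m - l)) mod n = i") (simp_all only: if_True if_False, simp_all)
qed

text \<open>The two jumps cancel unless the vector \<open>l\<close> steps before the end is the
  first one of the string, that is, unless \<open>l = m\<close>. The vertex before \<open>i\<close>
  is written \<open>i + (n - 1)\<close> modulo \<open>n\<close>.\<close>

lemma multiplicity_string: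
  assumes "i < n" "j < n"
  shows "multiplicity_of n (string n j m :: (nat, 'k::field) comodule) i l = (if i = j \<and> l = m then 1 else 0)"
proof -
  let ?p = "(i + (n - 1)) mod n"
  have n: "n > 0" using assms by simp
  have p: "?p < n" using n by simp
  have suc: "Suc ?p mod n = i" using assms n by (simp add: mod_Suc_eq)
  have "(j + (m - Suc l)) mod n = ?p \<longleftrightarrow> (j + (m - l)) mod n = i" if "Suc l \<le> m"
  proof -
    have "m - l = Suc (m - Suc l)" using that by simp
    then have "(j + (m - l)) mod n = Suc ((j + (m - Suc l)) mod n) mod n" by (simp add: mod_Suc_eq)
    moreover have "Suc a mod n = Suc b mod n \<longleftrightarrow> a = b" if "a < n" "b < n" for a b
      using that by (auto simp: mod_Suc split: if_splits)
    moreover have "(j + (m - Suc l)) mod n < n" using n by simp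
    ultimately have "Suc ((j + (m - Suc l)) mod n) mod n = Suc ?p mod n \<longleftrightarrow> (j + (m - Suc l)) mod n = ?p"
      "(j + (m - l)) mod n = Suc ((j + (m - Suc l)) mod n) mod n" using p by blast+
    then show ?thesis unfolding suc by (simp only:)
  qed
  then show ?thesis
    unfolding multiplicity_of_def kernel_jump_string [OF assms(1)] kernel_jump_string [OF p]
    using assms(2) by auto
qed

subsection \<open>The class of a comodule as a polynomial\<close>

definition var_y :: "int poly poly" where
  "var_y = [:0, 1:]"

text \<open>If \<open>y = a + b\<close> and \<open>x = a b\<close>, this is the sum of all monomials
  of degree \<open>l\<close> in \<open>a\<close> and \<open>b\<close>, a homogeneous form of the
  Chebyshev polynomials of the second kind.\<close>

fun string_poly :: "nat \<Rightarrow> int poly poly" where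
  "string_poly 0 = 1"
| "string_poly (Suc 0) = var_y"
| "string_poly (Suc (Suc l)) = var_y * string_poly (Suc l) - var_x * string_poly l"

text \<open>Only finitely many lengths occur for a comodule
  (\<open>multiplicity_eventually_0\<close>). Using multiplicities and not a chosen decomposition
  makes the value an isomorphism invariant, for comodules over any index type.\<close>

definition comodule_poly :: "nat \<Rightarrow> ('a, 'k::field) comodule \<Rightarrow> int poly poly" where
  "comodule_poly n U = (\<Sum>l | \<exists>i<n. multiplicity_of n U i l \<noteq> 0.
     \<Sum>i<n. of_int (multiplicity_of n U i l) * (var_x ^ i * string_poly l))"

lemma comodule_poly_bound:
  assumes "\<And>i l. i < n \<Longrightarrow> l \<ge> N \<Longrightarrow> multiplicity_of n U i l = 0"
  shows "comodule_poly n U = (\<Sum>l<N. \<Sum>i<n. of_int (multiplicity_of n U i l) * (var_x ^ i * string_poly l))"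
  unfolding comodule_poly_def
proof (rule sum.mono_neutral_left)
  show "{l. \<exists>i<n. multiplicity_of n U i l \<noteq> 0} \<subseteq> {..<N}"
    using assms by (auto simp: not_less [symmetric])
qed auto

lemma comodule_poly_iso:
  assumes "fd_comodule n U" "comodule_iso U V"
  shows "comodule_poly n U = comodule_poly n V"
  unfolding comodule_poly_def multiplicity_iso [OF assms] ..

lemma comodule_poly_sum:
  assumes U: "fd_comodule n U" and V: "fd_comodule n V"
  shows "comodule_poly n (direct_sum U V) = comodule_poly n U + comodule_poly n V"
proof -
  obtain N where N: "\<And>i l. l \<ge> N \<Longrightarrow> multiplicity_of n U i l = 0"
    using multiplicity_eventually_0 [OF U] by blast
  obtain N' where N': "\<And>i l. l \<ge> N' \<Longrightarrow> multiplicity_of n V i l = 0"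
    using multiplicity_eventually_0 [OF V] by blast
  note bound = comodule_poly_bound [of n "max N N'"]
  have "comodule_poly n (direct_sum U V) =
    (\<Sum>l<max N N'. \<Sum>i<n. of_int (multiplicity_of n (direct_sum U V) i l) * (var_x ^ i * string_poly l))"
    by (rule bound) (simp add: multiplicity_sum [OF U V] N N')
  moreover have "comodule_poly n U = (\<Sum>l<max N N'. \<Sum>i<n. of_int (multiplicity_of n U i l) * (var_x ^ i * string_poly l))"
    by (rule bound) (simp add: N)
  moreover have "comodule_poly n V = (\<Sum>l<max N N'. \<Sum>i<n. of_int (multiplicity_of n V i l) * (var_x ^ i * string_poly l))"
    by (rule bound) (simp add: N')
  ultimately show ?thesis
    by (simp add: multiplicity_sum [OF U V] sum.distrib distrib_right)
qed

lemma comodule_poly_empty: "basis U = {} \<Longrightarrow> comodule_poly n U = 0"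
  by (simp add: comodule_poly_def multiplicity_empty)

lemma comodule_poly_string:
  assumes "j < n"
  shows "comodule_poly n (string n j m :: (nat, 'k::field) comodule) = var_x ^ j * string_poly m"
proof -
  have "comodule_poly n (string n j m :: (nat, 'k) comodule) =
    (\<Sum>l<Suc m. \<Sum>i<n. of_int (multiplicity_of n (string n j m :: (nat, 'k) comodule) i l) * (var_x ^ i * string_poly l))"
    by (rule comodule_poly_bound) (simp add: multiplicity_string [OF _ assms])
  also have "\<dots> = (\<Sum>l<Suc m. \<Sum>i<n. if i = j then if l = m then var_x ^ i * string_poly l else 0 else 0)"
    by (intro sum.cong refl) (simp add: multiplicity_string [OF _ assms])
  also have "\<dots> = var_x ^ j * string_poly m" using assms by simp
  finally show ?thesis .
qed

section \<open>Congruence modulo x^n - 1 and multiplicativity\<close>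

abbreviation cong_poly :: "nat \<Rightarrow> int poly poly \<Rightarrow> int poly poly \<Rightarrow> bool" where
  "cong_poly n f g \<equiv> var_x ^ n - 1 dvd f - g"

lemma cong_poly_sym: "cong_poly n f g \<Longrightarrow> cong_poly n g f"
  by (metis dvd_minus_iff minus_diff_eq)

lemma cong_poly_trans: "cong_poly n f g \<Longrightarrow> cong_poly n g h \<Longrightarrow> cong_poly n f h"
  using dvd_add [of "var_x ^ n - 1" "f - g" "g - h"] by simp

lemma cong_poly_add: "cong_poly n f g \<Longrightarrow> cong_poly n f' g' \<Longrightarrow> cong_poly n (f + f') (g + g')"
  using dvd_add [of "var_x ^ n - 1" "f - g" "f' - g'"] by (simp add: algebra_simps)

lemma cong_poly_diff: "cong_poly n f g \<Longrightarrow> cong_poly n f' g' \<Longrightarrow> cong_poly n (f - f') (g - g')"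
  using dvd_diff [of "var_x ^ n - 1" "f - g" "f' - g'"] by (simp add: algebra_simps)

lemma cong_poly_mult:
  assumes "cong_poly n f g" "cong_poly n f' g'"
  shows "cong_poly n (f * f') (g * g')"
proof -
  have "f * f' - g * g' = (f - g) * f' + g * (f' - g')" by (simp add: algebra_simps)
  then show ?thesis using dvd_add [OF dvd_mult2 [OF assms(1)] dvd_mult [OF assms(2)]] by simp
qed

text \<open>At \<open>i = n - 1\<close> the vertices wrap around the cycle and the two powers are 1
  and x^n. This is the origin of the relation in the quotient.\<close>

lemma cong_poly_var_x:
  assumes "i < n"
  shows "cong_poly n (var_x ^ (Suc i mod n)) (var_x ^ Suc i)"
proof (cases "Suc i = n")
  case True
  have "1 - var_x ^ n = - (var_x ^ n - 1 :: int poly poly)" by simp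
  then show ?thesis using True by (metis dvd_minus_iff dvd_refl mod_self power_0)
qed (use assms in auto)

context
  fixes n :: nat
  assumes n1: "n > 1"
begin

lemma n_pos: "n > 0"
  using n1 by simp

text \<open>Both sides are additive in \<open>U\<close>, so splitting off strings reduces the claim
  to a single string.\<close>

lemma poly_tensor_string_left:
  fixes S :: "(nat, 'k::field_char_0) comodule"
  assumes S: "fd_comodule n S" and U: "fd_comodule n (U :: (nat, 'k) comodule)"
    and string: "\<And>i l. i < n \<Longrightarrow> cong_poly n (comodule_poly n (tensor_comodule n 1 S (string n i l)))
      (r * comodule_poly n (string n i l :: (nat, 'k) comodule))"
  shows "cong_poly n (comodule_poly n (tensor_comodule n 1 S U)) (r * comodule_poly n U)"
  using U n_pos
proof (induction U rule: comodule_induct)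
  case (zero U)
  then show ?case by (simp add: comodule_poly_empty)
next
  case (step U i l Y)
  let ?V = "string n i l :: (nat, 'k) comodule"
  have V: "fd_comodule n ?V" by (rule fd_string [OF n_pos])
  note VY = fd_direct_sum [OF V step(3)]
  have "comodule_iso (tensor_comodule n 1 S U) (tensor_comodule n 1 S (direct_sum ?V Y))"
    by (rule tensor_iso [OF S step(1) S VY n_pos comodule_iso_refl step(4)])
  then have "comodule_iso (tensor_comodule n 1 S U) (direct_sum (tensor_comodule n 1 S ?V) (tensor_comodule n 1 S Y))"
    by (rule comodule_iso_trans [OF _ tensor_sum_distrib_left [OF V step(3) S n_pos]])
  from trans [OF comodule_poly_iso [OF fd_tensor [OF S step(1) n_pos] this]
      comodule_poly_sum [OF fd_tensor [OF S V n_pos] fd_tensor [OF S step(3) n_pos]]]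
  have "comodule_poly n (tensor_comodule n 1 S U) =
    comodule_poly n (tensor_comodule n 1 S ?V) + comodule_poly n (tensor_comodule n 1 S Y)" .
  moreover have "comodule_poly n U = comodule_poly n ?V + comodule_poly n Y"
    using comodule_poly_iso [OF step(1,4)] comodule_poly_sum [OF V step(3)] by simp
  ultimately show ?case
    using cong_poly_add [OF string [OF step(2)] step(5)] by (simp add: distrib_left)
qed

lemma poly_tensor_point_string:
  assumes i: "i < n"
  shows "cong_poly n (comodule_poly n (tensor_comodule n 1 (string n 1 0) (string n i l :: (nat, 'k::field_char_0) comodule)))
    (var_x * comodule_poly n (string n i l :: (nat, 'k) comodule))"
proof -
  have "comodule_poly n (tensor_comodule n 1 (string n 1 0) (string n i l :: (nat, 'k) comodule)) =
    comodule_poly n (string n (Suc i mod n) l :: (nat, 'k) comodule)"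
    by (rule comodule_poly_iso [OF fd_string [OF n_pos] string_tensor_point [OF n_pos], symmetric])
  also have "\<dots> = var_x ^ (Suc i mod n) * string_poly l"
    by (rule comodule_poly_string) (use n_pos in simp)
  finally have eq: "comodule_poly n (tensor_comodule n 1 (string n 1 0) (string n i l :: (nat, 'k) comodule)) =
    var_x ^ (Suc i mod n) * string_poly l" .
  have "cong_poly n (var_x ^ (Suc i mod n) * string_poly l) (var_x ^ Suc i * string_poly l)"
    by (rule cong_poly_mult [OF cong_poly_var_x [OF i]]) simp
  then show ?thesis unfolding eq comodule_poly_string [OF i] by (simp add: mult.assoc)
qed

lemma poly_tensor_arrow_string:
  assumes i: "i < n"
  shows "cong_poly n (comodule_poly n (tensor_comodule n 1 (string n 0 1) (string n i l :: (nat, 'k::field_char_0) comodule)))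
    (var_y * comodule_poly n (string n i l :: (nat, 'k) comodule))"
proof (cases l)
  case 0
  have "comodule_poly n (tensor_comodule n 1 (string n 0 1) (string n i l :: (nat, 'k) comodule)) =
    comodule_poly n (string n i 1 :: (nat, 'k) comodule)"
    unfolding 0 by (rule comodule_poly_iso [OF fd_string [OF n_pos] string_tensor_arrow_0 [OF n_pos], symmetric])
  then show ?thesis by (simp add: comodule_poly_string [OF i] 0 mult.commute)
next
  case (Suc m)
  let ?A = "string n i (Suc (Suc m)) :: (nat, 'k) comodule" and ?B = "string n (Suc i mod n) m :: (nat, 'k) comodule"
  have fd: "fd_comodule n ?A" "fd_comodule n ?B" by (rule fd_string [OF n_pos])+
  have "comodule_poly n (tensor_comodule n 1 (string n 0 1) (string n i l :: (nat, 'k) comodule)) =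
    comodule_poly n (direct_sum ?A ?B)"
    unfolding Suc by (rule comodule_poly_iso [OF fd_direct_sum [OF fd] string_tensor_arrow [OF n_pos], symmetric])
  also have "\<dots> = var_x ^ i * string_poly (Suc (Suc m)) + var_x ^ (Suc i mod n) * string_poly m"
    using n_pos by (simp add: comodule_poly_sum [OF fd] comodule_poly_string i del: string_poly.simps)
  finally have eq: "comodule_poly n (tensor_comodule n 1 (string n 0 1) (string n i l :: (nat, 'k) comodule)) =
    var_x ^ i * string_poly (Suc (Suc m)) + var_x ^ (Suc i mod n) * string_poly m" .
  have "cong_poly n (var_x ^ i * string_poly (Suc (Suc m)) + var_x ^ (Suc i mod n) * string_poly m)
    (var_x ^ i * string_poly (Suc (Suc m)) + var_x ^ Suc i * string_poly m)"
    by (rule cong_poly_add [OF _ cong_poly_mult [OF cong_poly_var_x [OF i]]]) simp_all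
  \<comment> \<open>The recursion of \<open>string_poly\<close>, solved for
    \<open>var_y * string_poly l\<close>.\<close>
  moreover have "var_x ^ i * string_poly (Suc (Suc m)) + var_x ^ Suc i * string_poly m =
    var_y * (var_x ^ i * string_poly l)"
    unfolding Suc by (simp add: algebra_simps)
  ultimately show ?thesis unfolding eq comodule_poly_string [OF i] by (simp only:)
qed

text \<open>The property of left factors that spreads from the point and the arrow to all strings.
  The comodule \<open>U\<close> ranges over a single index type, since a definition cannot quantify
  over types; \<open>multiplicative_any\<close> extends it to the others.\<close>

definition multiplicative :: "('a, 'k::field_char_0) comodule \<Rightarrow> bool" where
  "multiplicative S \<longleftrightarrow> fd_comodule n S \<and> (\<forall>U :: (nat, 'k) comodule. fd_comodule n U \<longrightarrow>
     cong_poly n (comodule_poly n (tensor_comodule n 1 S U)) (comodule_poly n S * comodule_poly n U))"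

lemma multiplicativeD:
  fixes S :: "('a, 'k::field_char_0) comodule" and U :: "(nat, 'k) comodule"
  assumes "multiplicative S" "fd_comodule n U"
  shows "cong_poly n (comodule_poly n (tensor_comodule n 1 S U)) (comodule_poly n S * comodule_poly n U)"
  using assms unfolding multiplicative_def by blast

lemma multiplicative_fd: "multiplicative S \<Longrightarrow> fd_comodule n S"
  unfolding multiplicative_def by blast

lemma multiplicative_any:
  fixes S :: "('a, 'k::field_char_0) comodule" and U :: "('b, 'k) comodule"
  assumes S: "multiplicative S" and U: "fd_comodule n U"
  shows "cong_poly n (comodule_poly n (tensor_comodule n 1 S U)) (comodule_poly n S * comodule_poly n U)"
proof -
  obtain U' :: "(nat, 'k) comodule" where U': "fd_comodule n U'" "comodule_iso U U'"
    by (rule nat_copy_exists [OF U])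
  note S' = multiplicative_fd [OF S]
  have "comodule_poly n (tensor_comodule n 1 S U) = comodule_poly n (tensor_comodule n 1 S U')"
    by (rule comodule_poly_iso [OF fd_tensor [OF S' U n_pos] tensor_iso [OF S' U S' U'(1) n_pos comodule_iso_refl U'(2)]])
  then show ?thesis using multiplicativeD [OF S U'(1)] comodule_poly_iso [OF U U'(2)] by simp
qed

lemma multiplicative_iso:
  fixes S :: "('a, 'k::field_char_0) comodule" and S' :: "('b, 'k) comodule"
  assumes S: "multiplicative S" and S': "fd_comodule n S'" and iso: "comodule_iso S S'"
  shows "multiplicative S'"
  unfolding multiplicative_def
proof (intro conjI allI impI)
  fix U :: "(nat, 'k) comodule" assume U: "fd_comodule n U"
  note S'' = multiplicative_fd [OF S]
  have "comodule_poly n (tensor_comodule n 1 S U) = comodule_poly n (tensor_comodule n 1 S' U)"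
    by (rule comodule_poly_iso [OF fd_tensor [OF S'' U n_pos] tensor_iso [OF S'' U S' U n_pos iso comodule_iso_refl]])
  then show "cong_poly n (comodule_poly n (tensor_comodule n 1 S' U)) (comodule_poly n S' * comodule_poly n U)"
    using multiplicativeD [OF S U] comodule_poly_iso [OF S'' iso] by simp
qed fact

lemma poly_tensor_sum:
  fixes A :: "('a, 'k::field_char_0) comodule" and B :: "('b, 'k) comodule" and U :: "('c, 'k) comodule"
  assumes "fd_comodule n A" "fd_comodule n B" "fd_comodule n U"
  shows "comodule_poly n (tensor_comodule n 1 (direct_sum A B) U) =
    comodule_poly n (tensor_comodule n 1 A U) + comodule_poly n (tensor_comodule n 1 B U)"
  using comodule_poly_iso [OF fd_tensor [OF fd_direct_sum [OF assms(1,2)] assms(3) n_pos]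
      tensor_sum_distrib_right [OF assms n_pos]]
    comodule_poly_sum [OF fd_tensor [OF assms(1,3) n_pos] fd_tensor [OF assms(2,3) n_pos]] by simp

lemma multiplicative_sum:
  fixes A :: "('a, 'k::field_char_0) comodule" and B :: "('b, 'k) comodule"
  assumes A: "multiplicative A" and B: "multiplicative B"
  shows "multiplicative (direct_sum A B)"
  unfolding multiplicative_def
proof (intro conjI allI impI)
  note fd = multiplicative_fd [OF A] multiplicative_fd [OF B]
  show "fd_comodule n (direct_sum A B)" by (rule fd_direct_sum [OF fd])
  fix U :: "(nat, 'k) comodule" assume U: "fd_comodule n U"
  show "cong_poly n (comodule_poly n (tensor_comodule n 1 (direct_sum A B) U)) (comodule_poly n (direct_sum A B) * comodule_poly n U)"
    unfolding poly_tensor_sum [OF fd U] comodule_poly_sum [OF fd] distrib_right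
    by (rule cong_poly_add [OF multiplicativeD [OF A U] multiplicativeD [OF B U]])
qed

text \<open>Everything is additive in the left factor, so the congruence for \<open>B\<close> can be
  subtracted from the one for the sum. This is what reaches the longer strings, which arise as
  summands of products.\<close>

lemma multiplicative_cancel:
  fixes A :: "('a, 'k::field_char_0) comodule" and B :: "('b, 'k) comodule"
  assumes AB: "multiplicative (direct_sum A B)" and A: "fd_comodule n A" and B: "multiplicative B"
  shows "multiplicative A"
  unfolding multiplicative_def
proof (intro conjI allI impI)
  note fd = A multiplicative_fd [OF B]
  fix U :: "(nat, 'k) comodule" assume U: "fd_comodule n U"
  show "cong_poly n (comodule_poly n (tensor_comodule n 1 A U)) (comodule_poly n A * comodule_poly n U)"
    using cong_poly_diff [OF multiplicativeD [OF AB U] multiplicativeD [OF B U]]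
    unfolding poly_tensor_sum [OF fd U] comodule_poly_sum [OF fd] distrib_right by simp
qed fact

text \<open>Associativity moves \<open>A\<close> outside, where it acts on the tensor product of
  \<open>B\<close> and \<open>U\<close>; the property of \<open>B\<close> then finishes.\<close>

lemma multiplicative_tensor:
  fixes A :: "('a, 'k::field_char_0) comodule" and B :: "('b, 'k) comodule"
  assumes A: "multiplicative A" and B: "multiplicative B"
  shows "multiplicative (tensor_comodule n 1 A B)"
  unfolding multiplicative_def
proof (intro conjI allI impI)
  note fd = multiplicative_fd [OF A] multiplicative_fd [OF B]
  show AB: "fd_comodule n (tensor_comodule n 1 A B)" by (rule fd_tensor [OF fd n_pos])
  fix U :: "(nat, 'k) comodule" assume U: "fd_comodule n U"
  note BU = fd_tensor [OF fd(2) U n_pos]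
  have "comodule_poly n (tensor_comodule n 1 (tensor_comodule n 1 A B) U) =
    comodule_poly n (tensor_comodule n 1 A (tensor_comodule n 1 B U))"
    by (rule comodule_poly_iso [OF fd_tensor [OF AB U n_pos] tensor_assoc [OF fd U n_pos]])
  moreover have "cong_poly n (comodule_poly n (tensor_comodule n 1 A (tensor_comodule n 1 B U)))
    (comodule_poly n A * (comodule_poly n B * comodule_poly n U))"
    by (rule cong_poly_trans [OF multiplicative_any [OF A BU] cong_poly_mult [OF _ multiplicativeD [OF B U]]]) simp
  moreover have "cong_poly n (comodule_poly n A * (comodule_poly n B * comodule_poly n U))
    (comodule_poly n (tensor_comodule n 1 A B) * comodule_poly n U)"
    unfolding mult.assoc [symmetric]
    by (rule cong_poly_mult [OF cong_poly_sym [OF multiplicative_any [OF A fd(2)]]]) simp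
  ultimately show "cong_poly n (comodule_poly n (tensor_comodule n 1 (tensor_comodule n 1 A B) U))
    (comodule_poly n (tensor_comodule n 1 A B) * comodule_poly n U)"
    by (simp only:) (rule cong_poly_trans)
qed

text \<open>The unit is the start; each further vertex is reached by tensoring with the
  point.\<close>

lemma multiplicative_string_0: "multiplicative (string n i 0 :: (nat, 'k::field_char_0) comodule)" if "i < n"
  using that
proof (induction i)
  case 0
  let ?S = "string n 0 0 :: (nat, 'k) comodule"
  have S: "fd_comodule n ?S" by (rule fd_string [OF n_pos])
  have "comodule_poly n ?S = 1" using comodule_poly_string [OF n_pos, of 0, where 'k = 'k] by simp
  moreover have "comodule_poly n (tensor_comodule n 1 ?S U) = comodule_poly n U"
    if U: "fd_comodule n U" for U :: "(nat, 'k) comodule"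
    by (rule comodule_poly_iso [OF fd_tensor [OF S U n_pos] tensor_unit_left [OF n_pos U]])
  ultimately show ?case using S by (simp add: multiplicative_def)
next
  case (Suc i)
  let ?P = "string n 1 0 :: (nat, 'k) comodule" and ?S = "string n i 0 :: (nat, 'k) comodule"
  have P: "fd_comodule n ?P" by (rule fd_string [OF n_pos])
  have "comodule_poly n ?P = var_x" using comodule_poly_string [OF n1, of 0, where 'k = 'k] by simp
  then have "multiplicative ?P"
    unfolding multiplicative_def using P poly_tensor_string_left [OF P _ poly_tensor_point_string] by simp
  then have "multiplicative (tensor_comodule n 1 ?P ?S)"
    using Suc by (intro multiplicative_tensor) simp_all
  moreover have "comodule_iso (tensor_comodule n 1 ?P ?S) (string n (Suc i mod n) 0)"
    by (rule comodule_iso_sym [OF fd_string [OF n_pos] string_tensor_point [OF n_pos]])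
  ultimately have "multiplicative (string n (Suc i mod n) 0 :: (nat, 'k) comodule)"
    by (rule multiplicative_iso [OF _ fd_string [OF n_pos]])
  then show ?case using Suc.prems by simp
qed

text \<open>Strong induction on the length: the arrow times a string of length \<open>m + 1\<close>
  is the sum of the wanted string of length \<open>m + 2\<close> and one of length \<open>m\<close>,
  which is cancelled.\<close>

lemma multiplicative_string:
  assumes "i < n"
  shows "multiplicative (string n i l :: (nat, 'k::field_char_0) comodule)"
  using assms
proof (induction l arbitrary: i rule: less_induct)
  case (less l)
  let ?A = "string n 0 1 :: (nat, 'k) comodule"
  have A: "fd_comodule n ?A" by (rule fd_string [OF n_pos])
  have "comodule_poly n ?A = var_y" using comodule_poly_string [OF n_pos, of 1, where 'k = 'k] by simp
  then have mA: "multiplicative ?A"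
    unfolding multiplicative_def using A poly_tensor_string_left [OF A _ poly_tensor_arrow_string] by simp
  consider "l = 0" | "l = 1" | m where "l = Suc (Suc m)" by (metis One_nat_def not0_implies_Suc)
  then show ?case
  proof cases
    case 1
    then show ?thesis using multiplicative_string_0 [OF less.prems] by simp
  next
    case 2
    show ?thesis unfolding 2
      by (rule multiplicative_iso [OF multiplicative_tensor [OF mA multiplicative_string_0 [OF less.prems]]
        fd_string [OF n_pos] comodule_iso_sym [OF fd_string [OF n_pos] string_tensor_arrow_0 [OF n_pos]]])
  next
    case 3
    have "multiplicative (string n i (Suc m) :: (nat, 'k) comodule)"
      by (rule less.IH) (use 3 less.prems in auto)
    note m = multiplicative_tensor [OF mA this]
    have B: "multiplicative (string n (Suc i mod n) m :: (nat, 'k) comodule)"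
      by (rule less.IH) (use 3 n_pos in auto)
    note fd = fd_direct_sum [OF fd_string [OF n_pos] fd_string [OF n_pos]]
    have "multiplicative (direct_sum (string n i (Suc (Suc m))) (string n (Suc i mod n) m) :: (nat + nat, 'k) comodule)"
      by (rule multiplicative_iso [OF m fd comodule_iso_sym [OF fd string_tensor_arrow [OF n_pos]]])
    then show ?thesis unfolding 3 by (rule multiplicative_cancel [OF _ fd_string [OF n_pos] B])
  qed
qed

lemma multiplicative_fd_comodule:
  fixes U :: "(nat, 'k::field_char_0) comodule"
  assumes "fd_comodule n U"
  shows "multiplicative U"
  using assms n_pos
proof (induction U rule: comodule_induct)
  case (zero U)
  then show ?case by (simp add: multiplicative_def comodule_poly_empty)
next
  case (step U i l Y)
  have "multiplicative (direct_sum (string n i l) Y)"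
    by (rule multiplicative_sum [OF multiplicative_string [OF step(2)] step(5)])
  then show ?case by (rule multiplicative_iso [OF _ step(1) comodule_iso_sym [OF step(1,4)]])
qed

lemma comodule_poly_tensor:
  fixes U V :: "(nat, 'k::field_char_0) comodule"
  assumes "fd_comodule n U" "fd_comodule n V"
  shows "cong_poly n (comodule_poly n (tensor_comodule n 1 U V)) (comodule_poly n U * comodule_poly n V)"
  by (rule multiplicativeD [OF multiplicative_fd_comodule [OF assms(1)] assms(2)])

end

subsection \<open>Polynomials attached to formal combinations of classes\<close>

text \<open>Additive extension with values in a ring; \<open>frag_extend\<close> takes its values in
  a free abelian group.\<close>

definition frag_eval :: "('a \<Rightarrow> 'b::ring_1) \<Rightarrow> ('a \<Rightarrow>\<^sub>0 int) \<Rightarrow> 'b" where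
  "frag_eval g c = (\<Sum>a\<in>Poly_Mapping.keys c. of_int (coeff_at c a) * g a)"

lemma frag_eval_superset:
  assumes "finite S" "Poly_Mapping.keys c \<subseteq> S"
  shows "frag_eval g c = (\<Sum>a\<in>S. of_int (coeff_at c a) * g a)"
  unfolding frag_eval_def
  by (rule sum.mono_neutral_left) (use assms in \<open>auto simp: Poly_Mapping.in_keys_iff\<close>)

lemma frag_eval_0 [simp]: "frag_eval g 0 = 0"
  by (simp add: frag_eval_def)

lemma frag_eval_of [simp]: "frag_eval g (frag_of a) = g a"
  by (simp add: frag_eval_def)

lemma frag_eval_diff: "frag_eval g (c - d) = frag_eval g c - frag_eval g d"
proof -
  let ?S = "Poly_Mapping.keys c \<union> Poly_Mapping.keys d"
  have "Poly_Mapping.keys (c - d) \<subseteq> ?S" by (rule keys_diff)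
  then show ?thesis
    by (simp add: frag_eval_superset [of ?S] Poly_Mapping.lookup_minus left_diff_distrib sum_subtractf)
qed

lemma frag_eval_add: "frag_eval g (c + d) = frag_eval g c + frag_eval g d"
  using frag_eval_diff [of g c "- d"] frag_eval_diff [of g 0 d] by simp

lemma frag_eval_minus: "frag_eval g (- d) = - frag_eval g d"
  using frag_eval_diff [of g 0 d] by simp

lemmas free_frag_induct = free_Abelian_group_induct [consumes 1, case_names zero diff of]

lemma frag_eval_extend: "frag_eval g (frag_extend f c) = frag_eval (\<lambda>a. frag_eval g (f a)) c"
proof -
  have "Poly_Mapping.keys c \<subseteq> UNIV" by simp
  then show ?thesis
    by (induction c rule: free_frag_induct) (simp_all add: frag_extend_diff frag_eval_diff)
qed

lemma coeff_string_poly: "l < m \<Longrightarrow> coeff (string_poly l) m = 0" "coeff (string_poly l) l = 1"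
proof (induction l arbitrary: m rule: string_poly.induct)
  case (3 l)
  have x: "coeff (var_x * p) j = [:0, 1:] * coeff p j" for p :: "int poly poly" and j
    by (simp add: var_x_def)
  have y: "coeff (var_y * p) (Suc j) = coeff p j" for p :: "int poly poly" and j
    by (simp add: var_y_def)
  {
    case 1
    then obtain m' where "m = Suc m'" by (cases m) auto
    then show ?case using 1 "3.IH"(1) [of m'] "3.IH"(3) [of m] by (simp add: x y)
  next
    case 2
    then show ?case using "3.IH"(2) "3.IH"(3) [of "Suc (Suc l)"] by (simp add: x y)
  }
qed (auto simp: var_y_def coeff_pCons split: nat.splits)

text \<open>Since \<open>P\<^sub>l\<close> is monic of degree \<open>l\<close> in \<open>y\<close>, the coefficient of the highest power of \<open>y\<close> is a
  polynomial in \<open>x\<close> of degree less than \<open>n\<close>, hence not divisible by \<open>x\<^sup>n - 1\<close>.\<close>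

lemma string_poly_independent:
  assumes n: "n > 0" and keys: "Poly_Mapping.keys N \<subseteq> {..<n} \<times> UNIV"
    and dvd: "var_x ^ n - 1 dvd frag_eval (\<lambda>(i, l). var_x ^ i * string_poly l) N"
  shows "N = 0"
proof (rule ccontr)
  let ?f = "frag_eval (\<lambda>(i, l). var_x ^ i * string_poly l) N"
  assume "N \<noteq> 0"
  then have ne: "Poly_Mapping.keys N \<noteq> {}" by simp
  define L where "L = Max (snd ` Poly_Mapping.keys N)"
  have "L \<in> snd ` Poly_Mapping.keys N" unfolding L_def using ne by (intro Max_in) auto
  then obtain i0 where i0: "(i0, L) \<in> Poly_Mapping.keys N" by force
  have le: "snd p \<le> L" if "p \<in> Poly_Mapping.keys N" for p
    unfolding L_def using that by (intro Max_ge) auto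
  define q :: "int poly" where "q = (\<Sum>p\<in>Poly_Mapping.keys N. if snd p = L then monom (coeff_at N p) (fst p) else 0)"
  have "coeff ?f L = q"
    unfolding frag_eval_def q_def coeff_sum
  proof (rule sum.cong [OF refl])
    fix p assume p: "p \<in> Poly_Mapping.keys N"
    obtain i l where il: "p = (i, l)" by (cases p)
    have "var_x ^ i = [:[:0, 1:] ^ i:]" by (induction i) (simp_all add: var_x_def)
    then have "of_int (coeff_at N p) * (var_x ^ i * string_poly l) = [:monom (coeff_at N p) i:] * string_poly l"
      by (simp add: of_int_poly monom_altdef mult.assoc [symmetric])
    moreover have "coeff (string_poly l) L = (if l = L then 1 else 0)"
      using le [OF p] coeff_string_poly [of l] by (auto simp: il)
    ultimately show "coeff (of_int (coeff_at N p) * (case p of (i, l) \<Rightarrow> var_x ^ i * string_poly l)) L =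
      (if snd p = L then monom (coeff_at N p) (fst p) else 0)"
      by (simp add: il)
  qed
  \<comment> \<open>The divisor is constant in the outer variable, so it divides each coefficient
    separately.\<close>
  moreover have "var_x ^ n - 1 = [:[:0, 1:] ^ n - 1:]"
  proof -
    have "var_x ^ n = [:[:0, 1:] ^ n:]" by (induction n) (simp_all add: var_x_def)
    then show ?thesis by (simp add: one_pCons)
  qed
  ultimately have dvd': "[:0, 1:] ^ n - 1 dvd q" using dvd by (metis const_poly_dvd_iff)
  \<comment> \<open>Distinct strings of length \<open>L\<close> give distinct powers of x, so
    nothing cancels in \<open>q\<close>.\<close>
  have coeff_q: "coeff q j = (\<Sum>p\<in>Poly_Mapping.keys N. if p = (j, L) then coeff_at N p else 0)" for j
    unfolding q_def coeff_sum by (intro sum.cong refl) auto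
  have "coeff q i0 \<noteq> 0" using i0 by (simp add: coeff_q Poly_Mapping.in_keys_iff)
  moreover have "degree q < n"
  proof -
    have "coeff q j = 0" if "j \<ge> n" for j
      unfolding coeff_q using that keys by (intro sum.neutral) auto
    then have "degree q \<le> n - 1" by (intro degree_le) auto
    then show ?thesis using n by simp
  qed
  moreover have "n \<le> degree ([:0, 1:] ^ n - 1 :: int poly)"
    using n by (intro le_degree) (simp add: monom_altdef [of 1, simplified, symmetric])
  ultimately show False using dvd_imp_degree_le [OF dvd'] by fastforce
qed

subsection \<open>Isomorphism classes\<close>

lemma iso_class_eq:
  assumes "fd_comodule n U" "comodule_iso U V"
  shows "iso_class n U = iso_class n V"
  using comodule_iso_trans [OF assms(2)] comodule_iso_trans [OF comodule_iso_sym [OF assms]]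
  unfolding iso_class_def by blast

lemma iso_class_in_classes:
  fixes U :: "('a, 'k::field) comodule"
  assumes "fd_comodule n U"
  shows "iso_class n U \<in> iso_classes n"
proof -
  obtain V :: "(nat, 'k) comodule" where V: "fd_comodule n V" "comodule_iso U V"
    by (rule nat_copy_exists [OF assms])
  then show ?thesis unfolding iso_classes_def using iso_class_eq [OF assms V(2)] by blast
qed

text \<open>The choice is harmless, because all members of a class have the same polynomial.\<close>

definition class_poly :: "nat \<Rightarrow> (nat, 'k::field) comodule set \<Rightarrow> int poly poly" where
  "class_poly n A = comodule_poly n (SOME U. U \<in> A)"

lemma class_poly_iso_class:
  fixes U :: "('a, 'k::field) comodule"
  assumes "fd_comodule n U"
  shows "class_poly n (iso_class n U) = comodule_poly n U"
proof -
  obtain V :: "(nat, 'k) comodule" where "fd_comodule n V" "comodule_iso U V"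
    by (rule nat_copy_exists [OF assms])
  then have "V \<in> iso_class n U" by (simp add: iso_class_def)
  then have "(SOME V. V \<in> iso_class n U) \<in> iso_class n U" by (rule someI)
  moreover have "comodule_poly n W = comodule_poly n U" if "W \<in> iso_class n U" for W
  proof -
    have "comodule_iso U W" using that by (simp add: iso_class_def)
    then show ?thesis by (rule comodule_poly_iso [OF assms, symmetric])
  qed
  ultimately show ?thesis unfolding class_poly_def by blast
qed

text \<open>The product is defined as a union over all pairs of representatives; by
  \<open>tensor_iso\<close> every pair contributes the same class.\<close>

lemma class_mult_iso_class:
  fixes U V :: "(nat, 'k::field_char_0) comodule"
  assumes n: "n > 0" and U: "fd_comodule n U" and V: "fd_comodule n V"
  shows "class_mult n 1 (iso_class n U) (iso_class n V) = iso_class n (tensor_comodule n 1 U V)"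
proof -
  have "iso_class n (tensor_comodule n 1 U' V') = iso_class n (tensor_comodule n 1 U V)"
    if "U' \<in> iso_class n U" "V' \<in> iso_class n V" for U' V'
  proof -
    have "fd_comodule n U'" "fd_comodule n V'" "comodule_iso U U'" "comodule_iso V V'"
      using that by (simp_all add: iso_class_def)
    then show ?thesis
      by (rule iso_class_eq [OF fd_tensor [OF U V n] tensor_iso [OF U V _ _ n], symmetric])
  qed
  moreover have "U \<in> iso_class n U" "V \<in> iso_class n V"
    using U V by (simp_all add: iso_class_def comodule_iso_refl)
  ultimately show ?thesis unfolding class_mult_def by blast
qed

section \<open>The subgroup of split relations\<close>

lemma subgroup_split_relations:
  "subgroup (split_relations n :: ((nat, 'k::field) comodule set \<Rightarrow>\<^sub>0 int) set)
    (free_Abelian_group (iso_classes n))"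
  unfolding split_relations_def
proof (rule group.generate_is_subgroup [OF group_free_Abelian_group], safe)
  fix U V :: "(nat, 'k) comodule"
  assume "fd_comodule n U" "fd_comodule n V"
  then have "iso_class n U \<in> iso_classes n" "iso_class n V \<in> iso_classes n" "iso_class n (direct_sum U V) \<in> iso_classes n"
    by (auto intro: iso_class_in_classes fd_direct_sum)
  then show "frag_of (iso_class n (direct_sum U V)) - (frag_of (iso_class n U) + frag_of (iso_class n V))
      \<in> carrier (free_Abelian_group (iso_classes n))"
    using keys_diff [of "frag_of (iso_class n (direct_sum U V))" "frag_of (iso_class n U) + frag_of (iso_class n V)"]
      Poly_Mapping.keys_add [of "frag_of (iso_class n U)" "frag_of (iso_class n V)"]
    by auto
qed

lemma split_relations_keys:
  "c \<in> split_relations n \<Longrightarrow> Poly_Mapping.keys c \<subseteq> iso_classes n"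
  using subgroup.subset [OF subgroup_split_relations] by fastforce

lemma split_relations_0: "0 \<in> split_relations n"
  using subgroup.one_closed [OF subgroup_split_relations] by simp

lemma split_relations_add: "c \<in> split_relations n \<Longrightarrow> d \<in> split_relations n \<Longrightarrow> c + d \<in> split_relations n"
  using subgroup.m_closed [OF subgroup_split_relations] by simp

lemma split_relations_minus: "c \<in> split_relations n \<Longrightarrow> - c \<in> split_relations n"
  using subgroup.m_inv_closed [OF subgroup_split_relations, of c] split_relations_keys [of c] by simp

lemma split_relations_diff: "c \<in> split_relations n \<Longrightarrow> d \<in> split_relations n \<Longrightarrow> c - d \<in> split_relations n"
  using split_relations_add [OF _ split_relations_minus] by fastforce

lemma split_relations_direct_sum:
  fixes U V :: "(nat, 'k::field) comodule"
  assumes "fd_comodule n U" "fd_comodule n V"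
  shows "frag_of (iso_class n (direct_sum U V)) - (frag_of (iso_class n U) + frag_of (iso_class n V)) \<in> split_relations n"
  unfolding split_relations_def by (rule generate.incl) (use assms in blast)

text \<open>This is an equality and not only a congruence: polynomials are exactly additive on
  direct sums, and reduction modulo x^n - 1 is needed for products alone.\<close>

lemma frag_eval_split_relations:
  fixes c :: "(nat, 'k::field) comodule set \<Rightarrow>\<^sub>0 int"
  assumes "c \<in> split_relations n"
  shows "frag_eval (class_poly n) c = 0"
proof -
  have rel: "frag_eval (class_poly n) (frag_of (iso_class n (direct_sum U V)) -
      (frag_of (iso_class n U) + frag_of (iso_class n V))) = 0"
    if "fd_comodule n U" "fd_comodule n V" for U V :: "(nat, 'k) comodule"
    unfolding frag_eval_diff frag_eval_add frag_eval_of
    by (simp add: class_poly_iso_class [OF fd_direct_sum [OF that]] class_poly_iso_class [OF that(1)]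
        class_poly_iso_class [OF that(2)] comodule_poly_sum [OF that])
  from assms show ?thesis
    unfolding split_relations_def
  proof (induction c rule: generate.induct)
    case one
    show ?case by simp
  next
    case (incl h)
    then show ?case using rel by blast
  next
    case (inv h)
    then have "h \<in> split_relations n" unfolding split_relations_def by (rule generate.incl)
    then have "inv\<^bsub>free_Abelian_group (iso_classes n)\<^esub> h = - h"
      by (intro inv_free_Abelian_group split_relations_keys)
    then show ?case using inv rel by (auto simp: frag_eval_minus)
  next
    case (eng h1 h2)
    then show ?case by (simp add: frag_eval_add)
  qed
qed

section \<open>Normal form, kernel and image of the evaluation\<close>

context
  fixes n :: nat
  assumes n1: "n > 1"
begin

definition string_class :: "nat \<times> nat \<Rightarrow> ((nat, 'k::field) comodule set \<Rightarrow>\<^sub>0 int)" where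
  "string_class = (\<lambda>(i, l). frag_of (iso_class n (string n i l)))"

lemma class_normal_form:
  fixes U :: "(nat, 'k::field) comodule"
  assumes "fd_comodule n U"
  shows "\<exists>N. Poly_Mapping.keys N \<subseteq> {..<n} \<times> UNIV \<and>
    frag_of (iso_class n U) - frag_extend string_class N \<in> split_relations n"
  using assms n_pos [OF n1]
proof (induction U rule: comodule_induct)
  case (zero U)
  \<comment> \<open>The class of the zero comodule is a generator of the free group, different from
    its 0. That it lies among the relations follows because \<open>U\<close> is isomorphic to the
    sum of two copies of itself.\<close>
  have UU: "basis (direct_sum U U) = {}" using zero(2) by (simp add: basis_direct_sum)
  have iso: "comodule_iso U (direct_sum U U)"
    by (rule comodule_isoI [OF zero(1) fd_direct_sum [OF zero(1,1)] lin_zero lin_zero]) (use zero(2) UU in auto)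
  have "frag_of (iso_class n U) - (frag_of (iso_class n U) + frag_of (iso_class n U)) \<in> split_relations n"
    using split_relations_direct_sum [OF zero(1,1)] iso_class_eq [OF zero(1) iso] by simp
  from split_relations_minus [OF this] show ?case by (intro exI [of _ 0]) simp
next
  case (step U i l Y)
  obtain N where N: "Poly_Mapping.keys N \<subseteq> {..<n} \<times> UNIV"
    "frag_of (iso_class n Y) - frag_extend string_class N \<in> split_relations n"
    using step.IH by blast
  let ?V = "string n i l :: (nat, 'k) comodule"
  have V: "fd_comodule n ?V" by (rule fd_string [OF n_pos [OF n1]])
  have "frag_of (iso_class n U) - (frag_of (iso_class n ?V) + frag_of (iso_class n Y)) \<in> split_relations n"
    unfolding iso_class_eq [OF step(1,4)] by (rule split_relations_direct_sum [OF V step(3)])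
  from split_relations_add [OF this N(2)]
  have "frag_of (iso_class n U) - frag_extend string_class (frag_of (i, l) + N) \<in> split_relations n"
    by (simp add: frag_extend_add string_class_def algebra_simps)
  moreover have "Poly_Mapping.keys (frag_of (i, l) + N) \<subseteq> {..<n} \<times> UNIV"
    using Poly_Mapping.keys_add [of "frag_of (i, l)" N] N(1) step(2) by auto
  ultimately show ?case by blast
qed

lemma normal_form:
  fixes c :: "(nat, 'k::field) comodule set \<Rightarrow>\<^sub>0 int"
  assumes "Poly_Mapping.keys c \<subseteq> iso_classes n"
  shows "\<exists>N. Poly_Mapping.keys N \<subseteq> {..<n} \<times> UNIV \<and> c - frag_extend string_class N \<in> split_relations n"
  using assms
proof (induction c rule: free_frag_induct)
  case zero
  show ?case by (intro exI [of _ 0]) (simp add: split_relations_0)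
next
  case (diff c d)
  then obtain N M where N: "Poly_Mapping.keys N \<subseteq> {..<n} \<times> UNIV" "c - frag_extend string_class N \<in> split_relations n"
    and M: "Poly_Mapping.keys M \<subseteq> {..<n} \<times> UNIV" "d - frag_extend string_class M \<in> split_relations n" by blast
  have eq: "c - d - frag_extend string_class (N - M) = (c - frag_extend string_class N) - (d - frag_extend string_class M)"
    by (simp add: frag_extend_diff)
  have "c - d - frag_extend string_class (N - M) \<in> split_relations n"
    unfolding eq by (rule split_relations_diff [OF N(2) M(2)])
  moreover have "Poly_Mapping.keys (N - M) \<subseteq> {..<n} \<times> UNIV"
    using keys_diff [of N M] N(1) M(1) by blast
  ultimately show ?case by blast
next
  case (of A)
  then obtain U :: "(nat, 'k) comodule" where "fd_comodule n U" "A = iso_class n U"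
    unfolding iso_classes_def by blast
  then show ?case using class_normal_form by blast
qed

lemma frag_eval_string_class:
  assumes "Poly_Mapping.keys N \<subseteq> {..<n} \<times> UNIV"
  shows "frag_eval (class_poly n) (frag_extend (string_class :: _ \<Rightarrow> ((nat, 'k::field) comodule set \<Rightarrow>\<^sub>0 int)) N) =
    frag_eval (\<lambda>(i, l). var_x ^ i * string_poly l) N"
  unfolding frag_eval_extend unfolding frag_eval_def [of _ N]
proof (rule sum.cong [OF refl])
  fix p assume "p \<in> Poly_Mapping.keys N"
  then obtain i l where p: "p = (i, l)" "i < n" using assms by auto
  show "of_int (coeff_at N p) * frag_eval (class_poly n) (string_class p :: (nat, 'k) comodule set \<Rightarrow>\<^sub>0 int) =
    of_int (coeff_at N p) * (case p of (i, l) \<Rightarrow> var_x ^ i * string_poly l)"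
    by (simp add: p string_class_def class_poly_iso_class [OF fd_string [OF n_pos [OF n1]]] comodule_poly_string)
qed

text \<open>The source of injectivity. Modulo relations \<open>c\<close> is a combination
  \<open>N\<close> of strings; its evaluation is a combination of the independent polynomials x^i
  P_l, so \<open>N = 0\<close> and \<open>c\<close> is itself a relation.\<close>

lemma kernel_frag_eval:
  fixes c :: "(nat, 'k::field) comodule set \<Rightarrow>\<^sub>0 int"
  assumes c: "Poly_Mapping.keys c \<subseteq> iso_classes n" and dvd: "var_x ^ n - 1 dvd frag_eval (class_poly n) c"
  shows "c \<in> split_relations n"
proof -
  obtain N where N: "Poly_Mapping.keys N \<subseteq> {..<n} \<times> UNIV" "c - frag_extend string_class N \<in> split_relations n"
    using normal_form [OF c] by blast
  have "frag_eval (class_poly n) c = frag_eval (\<lambda>(i, l). var_x ^ i * string_poly l) N"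
    using frag_eval_split_relations [OF N(2)] by (simp add: frag_eval_diff frag_eval_string_class [OF N(1)])
  then have "N = 0" using string_poly_independent [OF n_pos [OF n1] N(1)] dvd by simp
  then show ?thesis using N(2) by simp
qed

definition frag_mult :: "((nat, 'k::field) comodule set \<Rightarrow>\<^sub>0 int) \<Rightarrow> ((nat, 'k) comodule set \<Rightarrow>\<^sub>0 int) \<Rightarrow>
    ((nat, 'k) comodule set \<Rightarrow>\<^sub>0 int)" where
  "frag_mult c d = frag_extend (\<lambda>A. frag_extend (\<lambda>B. frag_of (class_mult n 1 A B)) d) c"

text \<open>Both sides of the congruence are biadditive, so two nested inductions over the free
  group reduce it to single classes, where it is \<open>comodule_poly_tensor\<close>.\<close>

lemma frag_mult:
  fixes c d :: "(nat, 'k::field_char_0) comodule set \<Rightarrow>\<^sub>0 int"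
  assumes "Poly_Mapping.keys c \<subseteq> iso_classes n" "Poly_Mapping.keys d \<subseteq> iso_classes n"
  shows "Poly_Mapping.keys (frag_mult c d) \<subseteq> iso_classes n \<and>
    cong_poly n (frag_eval (class_poly n) (frag_mult c d)) (frag_eval (class_poly n) c * frag_eval (class_poly n) d)"
  using assms(1)
proof (induction c rule: free_frag_induct)
  case zero
  then show ?case by (simp add: frag_mult_def)
next
  case (diff c c')
  have "frag_mult (c - c') d = frag_mult c d - frag_mult c' d" by (simp add: frag_mult_def frag_extend_diff)
  then show ?case
    using diff keys_diff [of "frag_mult c d" "frag_mult c' d"] cong_poly_diff [of n "frag_eval (class_poly n) (frag_mult c d)"]
    by (auto simp: frag_eval_diff left_diff_distrib)
next
  case (of A)
  then obtain U :: "(nat, 'k) comodule" where U: "fd_comodule n U" "A = iso_class n U"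
    unfolding iso_classes_def by blast
  show ?case
    using assms(2)
  proof (induction d rule: free_frag_induct)
    case zero
    then show ?case by (simp add: frag_mult_def)
  next
    case (diff d d')
    have "frag_mult (frag_of A) (d - d') = frag_mult (frag_of A) d - frag_mult (frag_of A) d'"
      by (simp add: frag_mult_def frag_extend_diff)
    then show ?case
      using diff keys_diff [of "frag_mult (frag_of A) d" "frag_mult (frag_of A) d'"]
        cong_poly_diff [of n "frag_eval (class_poly n) (frag_mult (frag_of A) d)"]
      by (auto simp: frag_eval_diff right_diff_distrib)
  next
    case (of B)
    then obtain V :: "(nat, 'k) comodule" where V: "fd_comodule n V" "B = iso_class n V"
      unfolding iso_classes_def by blast
    have "frag_mult (frag_of A) (frag_of B) = frag_of (iso_class n (tensor_comodule n 1 U V))"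
      by (simp add: frag_mult_def U(2) V(2) class_mult_iso_class [OF n_pos [OF n1] U(1) V(1)])
    then show ?case
      using iso_class_in_classes [OF fd_tensor [OF U(1) V(1) n_pos [OF n1]]] comodule_poly_tensor [OF n1 U(1) V(1)]
      by (simp add: class_poly_iso_class [OF fd_tensor [OF U(1) V(1) n_pos [OF n1]]] U V class_poly_iso_class)
  qed
qed

text \<open>The polynomials attained modulo x^n - 1 are closed under differences and products, and
  they contain 1, x and y, the values at \<open>V(0, 0)\<close>, \<open>V(1, 0)\<close> and
  \<open>V(0, 1)\<close>.\<close>

lemma frag_eval_surj:
  "\<exists>c :: (nat, 'k::field_char_0) comodule set \<Rightarrow>\<^sub>0 int.
    Poly_Mapping.keys c \<subseteq> iso_classes n \<and> cong_poly n (frag_eval (class_poly n) c) f"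
proof -
  define hit where "hit f \<longleftrightarrow> (\<exists>c :: (nat, 'k) comodule set \<Rightarrow>\<^sub>0 int.
    Poly_Mapping.keys c \<subseteq> iso_classes n \<and> cong_poly n (frag_eval (class_poly n) c) f)" for f
  have diff: "hit (f - g)" if fg: "hit f" "hit g" for f g
  proof -
    obtain c :: "(nat, 'k) comodule set \<Rightarrow>\<^sub>0 int" where
      c: "Poly_Mapping.keys c \<subseteq> iso_classes n" "cong_poly n (frag_eval (class_poly n) c) f"
      using fg(1) unfolding hit_def by blast
    obtain d :: "(nat, 'k) comodule set \<Rightarrow>\<^sub>0 int" where
      d: "Poly_Mapping.keys d \<subseteq> iso_classes n" "cong_poly n (frag_eval (class_poly n) d) g"
      using fg(2) unfolding hit_def by blast
    have "Poly_Mapping.keys (c - d) \<subseteq> iso_classes n" using keys_diff [of c d] c(1) d(1) by blast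
    moreover have "cong_poly n (frag_eval (class_poly n) (c - d)) (f - g)"
      unfolding frag_eval_diff by (rule cong_poly_diff [OF c(2) d(2)])
    ultimately show ?thesis unfolding hit_def by (intro exI conjI)
  qed
  have mult: "hit (f * g)" if fg: "hit f" "hit g" for f g
  proof -
    obtain c :: "(nat, 'k) comodule set \<Rightarrow>\<^sub>0 int" where
      c: "Poly_Mapping.keys c \<subseteq> iso_classes n" "cong_poly n (frag_eval (class_poly n) c) f"
      using fg(1) unfolding hit_def by blast
    obtain d :: "(nat, 'k) comodule set \<Rightarrow>\<^sub>0 int" where
      d: "Poly_Mapping.keys d \<subseteq> iso_classes n" "cong_poly n (frag_eval (class_poly n) d) g"
      using fg(2) unfolding hit_def by blast
    note cd = frag_mult [OF c(1) d(1)]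
    have "cong_poly n (frag_eval (class_poly n) (frag_mult c d)) (f * g)"
      by (rule cong_poly_trans [OF conjunct2 [OF cd] cong_poly_mult [OF c(2) d(2)]])
    then show ?thesis unfolding hit_def using conjunct1 [OF cd] by (intro exI conjI)
  qed
  have string: "hit (var_x ^ i * string_poly l)" if "i < n" for i l
  proof -
    let ?V = "string n i l :: (nat, 'k) comodule"
    have V: "fd_comodule n ?V" by (rule fd_string [OF n_pos [OF n1]])
    have "Poly_Mapping.keys (frag_of (iso_class n ?V)) \<subseteq> iso_classes n"
      using iso_class_in_classes [OF V] by simp
    moreover have "frag_eval (class_poly n) (frag_of (iso_class n ?V)) = var_x ^ i * string_poly l"
      unfolding frag_eval_of class_poly_iso_class [OF V] by (rule comodule_poly_string [OF that])
    ultimately show ?thesis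
      unfolding hit_def by (intro exI [of _ "frag_of (iso_class n ?V)"]) (intro conjI, assumption, simp only: diff_self dvd_0_right)
  qed
  have one: "hit 1" using string [OF n_pos [OF n1], of 0] by simp
  have x: "hit var_x" using string [OF n1, of 0] by simp
  have y: "hit var_y" using string [OF n_pos [OF n1], of 1] by simp
  have zero: "hit 0" using diff [OF one one] by simp
  have add: "hit (f + g)" if "hit f" "hit g" for f g
    using diff [OF that(1) diff [OF zero that(2)]] by simp
  have int: "hit (of_int k)" for k
  proof (induction k rule: int_induct [where k = 0])
    case base
    then show ?case using zero by simp
  next
    case (step1 i)
    then show ?case using add [OF _ one] by simp
  next
    case (step2 i)
    then show ?case using diff [OF _ one] by simp
  qed
  have const: "hit [:a:]" for a
  proof (induction a)
    case (pCons b a)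
    have "[:pCons b a:] = of_int b + var_x * [:a:]"
      by (simp add: var_x_def of_int_poly)
    then show ?case using add [OF int mult [OF x pCons.IH]] by simp
  qed (use zero in simp)
  have "hit f"
  proof (induction f)
    case (pCons a f)
    have "pCons a f = [:a:] + var_y * f" by (simp add: var_y_def)
    then show ?case using add [OF const mult [OF y pCons.IH]] by simp
  qed (rule zero)
  then show ?thesis unfolding hit_def .
qed

end

subsection \<open>The isomorphism\<close>

text \<open>Turns membership in the generated ideal into divisibility, hence cosets into classes of
  \<open>cong_poly\<close>.\<close>

lemma polynomial_ideal:
  "Idl\<^bsub>ring_of_type_algebra\<^esub> {p} = {f. p dvd (f :: int poly poly)}"
proof -
  have "PIdl\<^bsub>ring_of_type_algebra\<^esub> p = Idl\<^bsub>ring_of_type_algebra\<^esub> {p}"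
    by (rule cring.cgenideal_eq_genideal [OF cring_from_type_algebra]) (simp add: ring_of_type_algebra_def)
  then show ?thesis
    by (auto simp: cgenideal_def ring_of_type_algebra_def dvd_def mult.commute)
qed

theorem theorem3p7:
  fixes n :: nat
  assumes "n > 1"
  shows "green_ring n (1 :: 'k :: {alg_closed_field, field_char_0}) \<simeq>
         (ring_of_type_algebra :: int poly poly ring) Quot
           (Idl\<^bsub>ring_of_type_algebra\<^esub> {var_x ^ n - 1})"
proof -
  let ?R = "ring_of_type_algebra :: int poly poly ring"
  let ?I = "Idl\<^bsub>?R\<^esub> {var_x ^ n - 1}"
  let ?C = "class_ring n (1 :: 'k)"
  let ?K = "split_relations n :: ((nat, 'k) comodule set \<Rightarrow>\<^sub>0 int) set"
  let ?E = "frag_eval (class_poly n) :: ((nat, 'k) comodule set \<Rightarrow>\<^sub>0 int) \<Rightarrow> int poly poly"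
  define Car :: "((nat, 'k) comodule set \<Rightarrow>\<^sub>0 int) set" where "Car = {c. Poly_Mapping.keys c \<subseteq> iso_classes n}"
  \<comment> \<open>Fibres of the evaluation modulo x^n - 1, which turn out to be the cosets of the
    split relations. With \<open>res\<close> on the other side, both quotients become sets of
    congruence classes whose operations can be computed directly.\<close>
  define cls :: "((nat, 'k) comodule set \<Rightarrow>\<^sub>0 int) \<Rightarrow> ((nat, 'k) comodule set \<Rightarrow>\<^sub>0 int) set"
    where "cls c = {a \<in> Car. cong_poly n (?E a) (?E c)}" for c
  define res :: "int poly poly \<Rightarrow> int poly poly set" where "res f = {g. cong_poly n g f}" for f
  have carrier: "carrier ?C = Car"
    by (auto simp: class_ring_def Car_def)
  have Car_add: "c + d \<in> Car" and Car_diff: "c - d \<in> Car" if "c \<in> Car" "d \<in> Car" for c d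
    using that Poly_Mapping.keys_add [of c d] keys_diff [of c d] by (auto simp: Car_def)
  have cls_eqI: "cls c = cls d" if "cong_poly n (?E c) (?E d)" for c d
    unfolding cls_def using cong_poly_trans [OF _ that] cong_poly_trans [OF _ cong_poly_sym [OF that]] by blast
  have res_eqI: "res f = res g" if "cong_poly n f g" for f g
    unfolding res_def using cong_poly_trans [OF _ that] cong_poly_trans [OF _ cong_poly_sym [OF that]] by blast
  have cls_self: "c \<in> cls c" if "c \<in> Car" for c using that by (simp add: cls_def)
  have res_self: "f \<in> res f" for f by (simp add: res_def)
  have coset: "?K +>\<^bsub>?C\<^esub> c = cls c" if c: "c \<in> Car" for c
  proof
    show "?K +>\<^bsub>?C\<^esub> c \<subseteq> cls c"
    proof
      fix a assume "a \<in> ?K +>\<^bsub>?C\<^esub> c"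
      then obtain k where k: "k \<in> ?K" "a = k + c"
        by (auto simp: a_r_coset_def' class_ring_def)
      have "k \<in> Car" using split_relations_keys [OF k(1)] by (simp add: Car_def)
      then show "a \<in> cls c"
        using Car_add [OF _ c] by (simp add: cls_def k(2) frag_eval_add frag_eval_split_relations [OF k(1)])
    qed
    show "cls c \<subseteq> ?K +>\<^bsub>?C\<^esub> c"
    proof
      fix a assume "a \<in> cls c"
      then have a: "a \<in> Car" "cong_poly n (?E a) (?E c)" by (simp_all add: cls_def)
      have "Poly_Mapping.keys (a - c) \<subseteq> iso_classes n" using Car_diff [OF a(1) c] by (simp add: Car_def)
      then have "a - c \<in> ?K" by (rule kernel_frag_eval [OF assms]) (simp add: frag_eval_diff a(2))
      then show "a \<in> ?K +>\<^bsub>?C\<^esub> c"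
        by (auto simp: a_r_coset_def' class_ring_def intro!: bexI [of _ "a - c"])
    qed
  qed
  have coset_res: "?I +>\<^bsub>?R\<^esub> f = res f" for f
  proof -
    have "g \<in> ?I +>\<^bsub>?R\<^esub> f \<longleftrightarrow> g - f \<in> ?I" for g
      by (auto simp: a_r_coset_def' ring_of_type_algebra_def intro!: bexI [of _ "g - f"])
    then show ?thesis by (auto simp: polynomial_ideal res_def)
  qed
  have mult_C: "c \<otimes>\<^bsub>?C\<^esub> d = frag_mult n c d" for c d
    by (simp add: class_ring_def frag_mult_def [OF assms])
  have Car_mult: "frag_mult n c d \<in> Car" and E_mult: "cong_poly n (?E (frag_mult n c d)) (?E c * ?E d)"
    if "c \<in> Car" "d \<in> Car" for c d
    using frag_mult [OF assms, of c d] that by (simp_all add: Car_def)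
  have green_carrier: "carrier (green_ring n (1 :: 'k)) = cls ` Car"
    unfolding green_ring_def FactRing_def A_RCOSETS_def' by (auto simp: carrier coset)
  have quot_carrier: "carrier (?R Quot ?I) = range res"
  proof -
    have "carrier ?R = UNIV" by (simp add: ring_of_type_algebra_def)
    then show ?thesis unfolding FactRing_def A_RCOSETS_def' by (auto simp: coset_res)
  qed
  have green_mult: "cls c \<otimes>\<^bsub>green_ring n (1 :: 'k)\<^esub> cls d = cls (frag_mult n c d)"
    if c: "c \<in> Car" and d: "d \<in> Car" for c d
  proof -
    \<comment> \<open>The product of cosets is a union over all representatives, so independence of
      the representatives is what has to be shown.\<close>
    have "?K +>\<^bsub>?C\<^esub> (a \<otimes>\<^bsub>?C\<^esub> b) = cls (frag_mult n c d)" if "a \<in> cls c" "b \<in> cls d" for a b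
    proof -
      have a: "a \<in> Car" "cong_poly n (?E a) (?E c)" and b: "b \<in> Car" "cong_poly n (?E b) (?E d)"
        using that by (simp_all add: cls_def)
      have "cong_poly n (?E (frag_mult n a b)) (?E c * ?E d)"
        by (rule cong_poly_trans [OF E_mult [OF a(1) b(1)] cong_poly_mult [OF a(2) b(2)]])
      then have "cong_poly n (?E (frag_mult n a b)) (?E (frag_mult n c d))"
        by (rule cong_poly_trans [OF _ cong_poly_sym [OF E_mult [OF c d]]])
      then show ?thesis unfolding mult_C coset [OF Car_mult [OF a(1) b(1)]] by (rule cls_eqI)
    qed
    then have "(\<Union>a\<in>cls c. \<Union>b\<in>cls d. ?K +>\<^bsub>?C\<^esub> (a \<otimes>\<^bsub>?C\<^esub> b)) = cls (frag_mult n c d)"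
      using cls_self [OF c] cls_self [OF d] by blast
    then show ?thesis by (simp add: green_ring_def FactRing_def rcoset_mult_def)
  qed
  have quot_mult: "res f \<otimes>\<^bsub>?R Quot ?I\<^esub> res g = res (f * g)" for f g
  proof -
    have "?I +>\<^bsub>?R\<^esub> (a \<otimes>\<^bsub>?R\<^esub> b) = res (f * g)" if "a \<in> res f" "b \<in> res g" for a b
    proof -
      have "cong_poly n (a * b) (f * g)" using that by (intro cong_poly_mult) (simp_all add: res_def)
      then have "res (a * b) = res (f * g)" by (rule res_eqI)
      then show ?thesis unfolding coset_res by (simp add: ring_of_type_algebra_def)
    qed
    then have "(\<Union>a\<in>res f. \<Union>b\<in>res g. ?I +>\<^bsub>?R\<^esub> (a \<otimes>\<^bsub>?R\<^esub> b)) = res (f * g)"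
      using res_self [of f] res_self [of g] by blast
    then show ?thesis by (simp add: FactRing_def rcoset_mult_def)
  qed
  have green_add: "cls c \<oplus>\<^bsub>green_ring n (1 :: 'k)\<^esub> cls d = cls (c + d)"
    if c: "c \<in> Car" and d: "d \<in> Car" for c d
  proof -
    have "a + b \<in> cls (c + d)" if "a \<in> cls c" "b \<in> cls d" for a b
      using that Car_add by (auto simp: cls_def frag_eval_add intro: cong_poly_add)
    \<comment> \<open>For the converse inclusion the second summand is fixed as \<open>d\<close>,
      which leaves \<open>x - d\<close> as the first.\<close>
    moreover have "x - d \<in> cls c" if "x \<in> cls (c + d)" for x
      using that Car_diff [OF _ d] by (simp add: cls_def frag_eval_add frag_eval_diff algebra_simps)
    then have "\<exists>a\<in>cls c. x = a + d" if "x \<in> cls (c + d)" for x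
      using that by (intro bexI [of _ "x - d"]) simp_all
    ultimately have "(\<Union>a\<in>cls c. \<Union>b\<in>cls d. {a + b}) = cls (c + d)"
      using cls_self [OF d] by blast
    then show ?thesis by (simp add: green_ring_def FactRing_def set_add_def' class_ring_def)
  qed
  have quot_add: "res f \<oplus>\<^bsub>?R Quot ?I\<^esub> res g = res (f + g)" for f g
  proof -
    have "a + b \<in> res (f + g)" if "a \<in> res f" "b \<in> res g" for a b
      using that by (auto simp: res_def intro: cong_poly_add)
    moreover have "\<exists>a\<in>res f. x = a + g" if "x \<in> res (f + g)" for x
      using that by (intro bexI [of _ "x - g"]) (simp_all add: res_def algebra_simps)
    ultimately have "(\<Union>a\<in>res f. \<Union>b\<in>res g. {a + b}) = res (f + g)"
      using res_self [of g] by blast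
    then show ?thesis by (simp add: FactRing_def set_add_def' ring_of_type_algebra_def)
  qed
  define unit where "unit = (frag_of (iso_class n (unit_comodule :: (unit, 'k) comodule)))"
  note fd_u = fd_unit [OF n_pos [OF assms], where 'k = 'k]
  have unit_Car: "unit \<in> Car"
    using iso_class_in_classes [OF fd_u] by (simp add: unit_def Car_def)
  have "comodule_poly n (unit_comodule :: (unit, 'k) comodule) = comodule_poly n (string n 0 0 :: (nat, 'k) comodule)"
    by (rule comodule_poly_iso [OF fd_string [OF n_pos [OF assms]] string_unit_iso [OF n_pos [OF assms]], symmetric])
  then have E_unit: "?E unit = 1"
    using comodule_poly_string [OF n_pos [OF assms], of 0, where 'k = 'k]
    by (simp add: unit_def class_poly_iso_class [OF fd_u])
  have green_one: "\<one>\<^bsub>green_ring n (1 :: 'k)\<^esub> = cls unit"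
    using coset [OF unit_Car] by (simp add: green_ring_def FactRing_def class_ring_def unit_def)
  have quot_one: "\<one>\<^bsub>?R Quot ?I\<^esub> = res 1"
    using coset_res [of 1] by (simp add: FactRing_def ring_of_type_algebra_def)
  \<comment> \<open>The union of the residue classes of all values on \<open>A\<close>. No
    representative is chosen, and on a coset these classes coincide.\<close>
  define h where "h A = {g. \<exists>a\<in>A. cong_poly n g (?E a)}" for A
  have h: "h (cls c) = res (?E c)" if "c \<in> Car" for c
    using cls_self [OF that] cong_poly_trans unfolding h_def res_def cls_def by blast
  have "h \<in> ring_hom (green_ring n (1 :: 'k)) (?R Quot ?I)"
  proof (rule ring_hom_memI)
    fix A B assume "A \<in> carrier (green_ring n (1 :: 'k))" "B \<in> carrier (green_ring n (1 :: 'k))"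
    then obtain c d where c: "c \<in> Car" "A = cls c" and d: "d \<in> Car" "B = cls d"
      unfolding green_carrier by blast
    show "h (A \<otimes>\<^bsub>green_ring n (1 :: 'k)\<^esub> B) = h A \<otimes>\<^bsub>?R Quot ?I\<^esub> h B"
      unfolding c(2) d(2) green_mult [OF c(1) d(1)] h [OF c(1)] h [OF d(1)] h [OF Car_mult [OF c(1) d(1)]] quot_mult
      by (rule res_eqI [OF E_mult [OF c(1) d(1)]])
    show "h (A \<oplus>\<^bsub>green_ring n (1 :: 'k)\<^esub> B) = h A \<oplus>\<^bsub>?R Quot ?I\<^esub> h B"
      unfolding c(2) d(2) green_add [OF c(1) d(1)] h [OF c(1)] h [OF d(1)] h [OF Car_add [OF c(1) d(1)]] quot_add
        frag_eval_add ..
  next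
    fix A assume "A \<in> carrier (green_ring n (1 :: 'k))"
    then show "h A \<in> carrier (?R Quot ?I)" unfolding green_carrier quot_carrier using h by blast
  next
    show "h \<one>\<^bsub>green_ring n (1 :: 'k)\<^esub> = \<one>\<^bsub>?R Quot ?I\<^esub>"
      unfolding green_one quot_one h [OF unit_Car] E_unit ..
  qed
  moreover have "bij_betw h (cls ` Car) (range res)"
  proof (rule bij_betw_imageI)
    show "inj_on h (cls ` Car)"
    proof (rule inj_onI)
      fix A B assume "A \<in> cls ` Car" "B \<in> cls ` Car" and eq: "h A = h B"
      then obtain c d where c: "c \<in> Car" "A = cls c" and d: "d \<in> Car" "B = cls d" by blast
      have "?E c \<in> res (?E d)" using eq res_self [of "?E c"] by (simp add: c(2) d(2) h [OF c(1)] h [OF d(1)])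
      then have "cong_poly n (?E c) (?E d)" by (simp add: res_def)
      then show "A = B" unfolding c(2) d(2) by (rule cls_eqI)
    qed
    have "res f \<in> h ` cls ` Car" for f
    proof -
      obtain c :: "(nat, 'k) comodule set \<Rightarrow>\<^sub>0 int" where c: "c \<in> Car" "cong_poly n (?E c) f"
        using frag_eval_surj [OF assms, of f, where 'k = 'k] unfolding Car_def by blast
      have "res f = h (cls c)" unfolding h [OF c(1)] by (rule res_eqI [OF c(2), symmetric])
      then show ?thesis using c(1) by blast
    qed
    then show "h ` cls ` Car = range res" using h by blast
  qed
  ultimately have "h \<in> ring_iso (green_ring n (1 :: 'k)) (?R Quot ?I)"
    by (simp add: ring_iso_def green_carrier quot_carrier)
  then show ?thesis unfolding is_ring_iso_def by blast
qed

end
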